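(* Suppose we have a homogeneous system in which $\lambda_1=\dots=\lambda_d$, $\mu_1=\dots=\mu_d$ and $c_1=\dots=c_d$. Then, for any integer $K\geq 1$, the system is stable under the $K$-stop heuristic policy when $\rho<1$. Furthermore, if the network $(V,E)$ is a complete graph, then the $K$-stop heuristic policy is optimal.
   Context: Network. Let $(V,E)$ be a finite connected graph. $D\subseteq V$ is a set of $d$ nodes called demand points, numbered $1,\dots,d$; the remaining nodes $N=V\setminus D$ are called intermediate stages. Jobs of type $i$ arrive at demand point $i\in D$ according to independent Poisson processes with rates $\lambda_i>0$. A single server occupies one node at a time. At any time it may remain at its node or attempt to move to an adjacent node. If it remains at a demand point $i$ with at least one job present, jobs there are processed at rate $\mu_i>0$; if it attempts to move to an adjacent node, the switch occurs at rate $\tau>0$. Processing and switching times are exponential, independent of the arrivals, and can be interrupted at any time. Each job at demand point $i$ incurs holding cost $c_i>0$ per unit time. Assume $\lambda_i<\mu_i$ for all $i\in D$, and let $\rho=\sum_{i\in D}\lambda_i/\mu_i$. MDP. The state space is $S=\{(v,(x_1,\dots,x_d)) : v\in V,\ x_i\in\mathbb{Z}_{\ge 0}\text{ for }i\in D\}$, where $v=v(\mathbf{x})$ is the server's node and $x_i$ is the number of jobs at demand point $i$ (including any in process). In state $\mathbf{x}$ the action set $A_{\mathbf{x}}$ consists of $v(\mathbf{x})$ (remain) and the nodes adjacent to $v(\mathbf{x})$ (attempt to move there). Time is scaled so that $\sum_{i\in D}\lambda_i+\max\{\mu_1,\dots,\mu_d,\tau\}=1$, and the system evolves in discrete unit time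 steps, an action being chosen at every step. In state $\mathbf{x}$ under action $a$: with probability $\lambda_i$ a job arrives at $i$ ($x_i$ increases by one), for each $i\in D$; if $a=v(\mathbf{x})=i\in D$ and $x_i\ge1$, then with probability $\mu_i$ the value $x_i$ decreases by one; if $a$ is adjacent to $v(\mathbf{x})$, then with probability $\tau$ the server's node becomes $a$; otherwise the state is unchanged. The single-step cost is $f(\mathbf{x})=\sum_{i\in D}c_ix_i$. Policies may in general be history-dependent and randomized. The long-run average cost of a policy $\theta$ is $g_\theta(\mathbf{x})=\liminf_{T\to\infty}T^{-1}\,\mathbb{E}_\theta\left[\sum_{t=0}^{T-1}f(\mathbf{x}(t))\,\middle|\,\mathbf{x}(0)=\mathbf{x}\right]$. A policy $\theta^*$ is optimal if $g_{\theta^*}(\mathbf{x})\le g_\theta(\mathbf{x})$ for every admissible policy $\theta$ and every $\mathbf{x}\in S$. The system is stable under $\theta$ if $\theta$ induces an ergodic Markov chain on $S$. Index quantities. $\delta(i,j)$ is the length of a shortest path between nodes $i,j\in V$ (graph distance), with $\delta(i,i)=0$. For a state $\mathbf{x}=(v,(x_1,\dots,x_d))$ and a sequence $s=(s_1,\dots,s_m)$ of demand points, put $|s|=m$, $s_0=v$, and for $t\ge 0$ and $1\le j\le |s|$ define recursively $$T_j(\mathbf{x},s,t)=\frac{x_{s_j}+\lambda_{s_j}\left[t+\sum_{k=1}^{j-1}\left(\delta(s_{k-1},s_k)/\tau+T_k(\mathbf{x},s,t)\right)+\delta(s_{j-1},s_j)/\tau\right]}{\mu_{s_j}-\lambda_{s_j}},\qquad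 R_j(\mathbf{x},s,t)=c_{s_j}\mu_{s_j}T_j(\mathbf{x},s,t),$$ $$\psi(\mathbf{x},s,t)=\frac{\sum_{k=1}^{|s|}R_k(\mathbf{x},s,t)}{t+\sum_{k=1}^{|s|}\left[\delta(s_{k-1},s_k)/\tau+T_k(\mathbf{x},s,t)\right]},$$ $$\phi_j(\mathbf{x},s,t)=\frac{\sum_{k=1}^{j}R_k(\mathbf{x},s,t)}{t+\sum_{k=1}^{j}\left[\delta(s_{k-1},s_k)/\tau+T_k(\mathbf{x},s,t)\right]+\delta(s_j,v)/\tau},$$ $$\beta_j(\mathbf{x},s,t)=\begin{cases}\dfrac{\sum_{k=1}^{j}R_k(\mathbf{x},s,t)}{\sum_{k=1}^{j}T_k(\mathbf{x},s,t)}\,\rho+c_v\mu_v(1-\rho),& v\notin\{s_1,\dots,s_j\},\\ 0,&\text{otherwise,}\end{cases}\qquad \gamma(\mathbf{x},s,t)=\frac{\sum_{k=1}^{|s|}R_k(\mathbf{x},s,t)}{\sum_{k=1}^{|s|}T_k(\mathbf{x},s,t)}\,\rho$$ ($\beta_j$ is used only when $v\in D$). $K$-stop heuristic policy. At every time step, in state $\mathbf{x}=(v,(x_1,\dots,x_d))$, let $\mathcal{S}$ be the set of all sequences $s=(s_1,\dots,s_m)$ with $1\le m\le K$, pairwise distinct entries $s_j\in D$, and $s_1\ne v$. Case 1: $v\in D$ and $x_v>0$. Let $\sigma$ be the set of $s\in\mathcal{S}$ with $\frac{\partial}{\partial t}\psi(\mathbf{x},s,t)\big|_{t=0}\le 0$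 and $\phi_j(\mathbf{x},s,0)\ge\beta_j(\mathbf{x},s,0)$ for all $j\in\{1,\dots,|s|\}$. Case 2: $v\in D$ with $x_v=0$, or $v\in N$. Let $\sigma_2'$ be the set of $s\in\mathcal{S}$ with $\frac{\partial}{\partial t}\psi(\mathbf{x},s,t)\big|_{t=0}\le 0$. Let $\sigma_1$ be the set of $s\in\sigma_2'$ such that $\psi(\mathbf{x},s,0)\ge\gamma(\mathbf{x},s,0)$ and either $|s|=1$, or $|s|\ge2$ and $\psi(\mathbf{y},s,0)\ge\gamma(\mathbf{y},s,0)$, where $\mathbf{y}$ is the state identical to $\mathbf{x}$ except that the server is located at $s_1$. Let $\sigma_2=\sigma_2'\setminus\sigma_1$. Set $\sigma=\sigma_1$ if $\sigma_1\ne\emptyset$, and $\sigma=\sigma_2$ otherwise. In both cases: if $\sigma=\emptyset$, the server remains at $v$. Otherwise let $s^*$ be the sequence in $\sigma$ with the largest value of $\psi(\mathbf{x},s,0)$, ties being broken according to a fixed priority ordering of the demand points applied lexicographically to sequences; the action is to attempt to switch to the first node (after $v$) on a shortest path from $v$ to $s_1^*$ (if there are several shortest paths, one is selected using an arbitrary fixed priority ordering of the nodes).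
   Formalization: "Ergodic" is taken to mean: one closed irreducible positive recurrent class, reached with probability 1 from every state; irreducibility on all of S and aperiodicity are not claimed, since they can fail (e.g. V={1,2}, D={1}: the server never leaves node 1). *)

theory Defs
  imports "HOL-Probability.Probability" "Graph_Theory.Graph_Theory"
begin

section \<open>The network\<close>

text \<open>
  The demand points are a subset of the nodes instead of being numbered \<open>1, \<dots>, d\<close>, so that
  demand points and nodes have the same type. Undirected simple graphs are the symmetric
  loop-free digraphs of the locale \<open>pair_graph\<close>.
\<close>

record 'v network =
  graph_of :: "'v pair_pre_digraph"
  demand :: "'v set"
  lam :: "'v \<Rightarrow> real"
  mu :: "'v \<Rightarrow> real"
  tau :: real
  hold :: "'v \<Rightarrow> real"

abbreviation nodes :: "'v network \<Rightarrow> 'v set" where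
  "nodes P \<equiv> pverts (graph_of P)"

definition adjacent :: "'v network \<Rightarrow> 'v \<Rightarrow> 'v \<Rightarrow> bool" where
  "adjacent P v w \<longleftrightarrow> (v, w) \<in> parcs (graph_of P)"

text \<open>
  The last clause of \<open>valid_network\<close> is the time scaling.
\<close>

definition valid_network :: "'v network \<Rightarrow> bool" where
  "valid_network P \<longleftrightarrow>
     pair_graph (graph_of P) \<and> Digraph_Component.connected (with_proj (graph_of P)) \<and>
     demand P \<subseteq> nodes P \<and> demand P \<noteq> {} \<and>
     (\<forall>i\<in>demand P. 0 < lam P i \<and> lam P i < mu P i \<and> 0 < hold P i) \<and>
     0 < tau P \<and>
     (\<Sum>i\<in>demand P. lam P i) + Max (insert (tau P) (mu P ` demand P)) = 1"

definition homogeneous :: "'v network \<Rightarrow> bool" where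
  "homogeneous P \<longleftrightarrow>
     (\<forall>i\<in>demand P. \<forall>j\<in>demand P. lam P i = lam P j \<and> mu P i = mu P j \<and> hold P i = hold P j)"

definition complete_network :: "'v network \<Rightarrow> bool" where
  "complete_network P \<longleftrightarrow> complete_digraph (card (nodes P)) (with_proj (graph_of P))"

definition traffic :: "'v network \<Rightarrow> real" where
  "traffic P = (\<Sum>i\<in>demand P. lam P i / mu P i)"

definition \<delta> :: "'v network \<Rightarrow> 'v \<Rightarrow> 'v \<Rightarrow> real" where
  "\<delta> P u w = real_of_ereal (wf_digraph.\<mu> (with_proj (graph_of P)) (\<lambda>_. 1) u w)"


section \<open>The Markov decision process\<close>

text \<open>
  Queue lengths are functions on all nodes, equal to \<open>0\<close> outside the demand points; hence
  \<open>states P\<close> is in bijection with \<open>V \<times> \<nat>\<^sup>d\<close>.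
\<close>

type_synonym 'v state = "'v \<times> ('v \<Rightarrow> nat)"

definition states :: "'v network \<Rightarrow> 'v state set" where
  "states P = {(v, x). v \<in> nodes P \<and> (\<forall>i. i \<notin> demand P \<longrightarrow> x i = 0)}"

definition actions :: "'v network \<Rightarrow> 'v state \<Rightarrow> 'v set" where
  "actions P = (\<lambda>(v, x). insert v {w. adjacent P v w})"

definition served :: "'v network \<Rightarrow> 'v state \<Rightarrow> 'v \<Rightarrow> bool" where
  "served P = (\<lambda>(v, x) a. a = v \<and> v \<in> demand P \<and> 1 \<le> x v)"

definition trans_prob :: "'v network \<Rightarrow> 'v state \<Rightarrow> 'v \<Rightarrow> 'v state \<Rightarrow> real" where
  "trans_prob P = (\<lambda>(v, x) a z.
     (\<Sum>i\<in>demand P. lam P i * of_bool (z = (v, x(i := x i + 1))))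
     + mu P v * of_bool (served P (v, x) a) * of_bool (z = (v, x(v := x v - 1)))
     + tau P * of_bool (adjacent P v a) * of_bool (z = (a, x))
     + (1 - (\<Sum>i\<in>demand P. lam P i) - mu P v * of_bool (served P (v, x) a)
          - tau P * of_bool (adjacent P v a)) * of_bool (z = (v, x)))"

definition transition :: "'v network \<Rightarrow> 'v state \<Rightarrow> 'v \<Rightarrow> 'v state pmf" where
  "transition P s a = embed_pmf (trans_prob P s a)"

text \<open>\<open>embed_pmf\<close> is only meaningful for genuine probability mass functions:\<close>

lemma pmf_transition:
  assumes P: "valid_network P"
  shows "pmf (transition P s a) z = trans_prob P s a z"
proof -
  obtain v x where s: "s = (v, x)" by (cases s)
  from P interpret pair_graph "graph_of P" by (simp add: valid_network_def)
  have fin: "finite (demand P)"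
    using P pair_finite_verts by (auto simp: valid_network_def intro: finite_subset)
  define M where "M = Max (insert (tau P) (mu P ` demand P))"
  have M: "tau P \<le> M" "\<And>i. i \<in> demand P \<Longrightarrow> mu P i \<le> M"
    using fin unfolding M_def by (auto intro: Max_ge)
  have one: "(\<Sum>i\<in>demand P. lam P i) + M = 1" and t0: "0 < tau P"
    and l0: "\<And>i. i \<in> demand P \<Longrightarrow> 0 < lam P i" and m0: "\<And>i. i \<in> demand P \<Longrightarrow> 0 < mu P i"
    using P by (force simp: valid_network_def M_def)+
  have na: "\<not> adjacent P v v"
    using pair_no_loops by (force simp: adjacent_def)
  define L B C R where "L = (\<Sum>i\<in>demand P. lam P i)"
    and "B = mu P v * of_bool (served P (v, x) a)" and "C = tau P * of_bool (adjacent P v a)"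
    and "R = 1 - L - B - C"
  have B0: "0 \<le> B" using m0 by (auto simp: B_def served_def less_imp_le)
  have C0: "0 \<le> C" using t0 by (auto simp: C_def)
  have R0: "0 \<le> R"
  proof (cases "served P (v, x) a")
    case True
    then show ?thesis
      using one M(2)[of v] na by (auto simp: R_def L_def B_def C_def served_def)
  next
    case False
    then show ?thesis
      using one M(1) t0 by (auto simp: R_def L_def B_def C_def)
  qed
  have L0: "\<And>i. i \<in> demand P \<Longrightarrow> 0 \<le> lam P i" using l0 by (simp add: less_imp_le)
  have pt: "(\<integral>\<^sup>+z. ennreal (c * of_bool (z = y)) \<partial>count_space UNIV) = ennreal c"
    for c :: real and y :: "'a state"
  proof -
    have "(\<integral>\<^sup>+z. ennreal (c * of_bool (z = y)) \<partial>count_space UNIV)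
        = (\<integral>\<^sup>+z. ennreal c * indicator {y} z \<partial>count_space UNIV)"
      by (intro nn_integral_cong) (auto split: split_indicator)
    then show ?thesis by (simp add: nn_integral_cmult_indicator)
  qed
  have eq: "trans_prob P s a z =
      (\<Sum>i\<in>demand P. lam P i * of_bool (z = (v, x(i := x i + 1))))
      + B * of_bool (z = (v, x(v := x v - 1))) + C * of_bool (z = (a, x))
      + R * of_bool (z = (v, x))" for z
    by (simp add: trans_prob_def s L_def B_def C_def R_def)
  have nn: "0 \<le> trans_prob P s a z" for z
    unfolding eq using B0 C0 R0 L0 by (intro add_nonneg_nonneg sum_nonneg) auto
  have "ennreal (trans_prob P s a z) =
      (\<Sum>i\<in>demand P. ennreal (lam P i * of_bool (z = (v, x(i := x i + 1)))))
      + ennreal (B * of_bool (z = (v, x(v := x v - 1)))) + ennreal (C * of_bool (z = (a, x)))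
      + ennreal (R * of_bool (z = (v, x)))" for z
    unfolding eq using B0 C0 R0 L0
    by (subst sum_ennreal, simp) (simp add: ennreal_plus[symmetric] sum_nonneg del: ennreal_plus)
  then have "(\<integral>\<^sup>+z. ennreal (trans_prob P s a z) \<partial>count_space UNIV)
      = (\<Sum>i\<in>demand P. ennreal (lam P i)) + ennreal B + ennreal C + ennreal R"
    by (simp add: nn_integral_add nn_integral_sum pt)
  also have "\<dots> = ennreal (L + B + C + R)"
    using B0 C0 R0 L0 by (simp add: L_def sum_ennreal ennreal_plus[symmetric] sum_nonneg del: ennreal_plus)
  also have "\<dots> = 1" by (simp add: R_def)
  finally show ?thesis
    unfolding transition_def using nn by (intro pmf_embed_pmf)
qed

definition cost :: "'v network \<Rightarrow> 'v state \<Rightarrow> real" where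
  "cost P = (\<lambda>(v, x). \<Sum>i\<in>demand P. hold P i * real (x i))"

text \<open>
  A policy maps the past, a list of state-action pairs with the oldest first, and the current
  state to a distribution of actions.
\<close>

type_synonym 'v history = "('v state \<times> 'v) list"

type_synonym 'v policy = "'v history \<Rightarrow> 'v state \<Rightarrow> 'v pmf"

definition admissible :: "'v network \<Rightarrow> 'v policy \<Rightarrow> bool" where
  "admissible P \<theta> \<longleftrightarrow> (\<forall>h. \<forall>s\<in>states P. set_pmf (\<theta> h s) \<subseteq> actions P s)"

text \<open>
  \<open>run P \<theta> s T\<close> is the joint distribution of the first \<open>T\<close> state-action pairs and the
  state at time \<open>T\<close>, started in \<open>s\<close>.
\<close>

primrec run :: "'v network \<Rightarrow> 'v policy \<Rightarrow> 'v state \<Rightarrow> nat \<Rightarrow> ('v history \<times> 'v state) pmf" where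
  "run P \<theta> s 0 = return_pmf ([], s)"
| "run P \<theta> s (Suc T) = bind_pmf (run P \<theta> s T) (\<lambda>(h, y).
     bind_pmf (\<theta> h y) (\<lambda>a. map_pmf (\<lambda>z. (h @ [(y, a)], z)) (transition P y a)))"

definition expected_cost :: "'v network \<Rightarrow> 'v policy \<Rightarrow> 'v state \<Rightarrow> nat \<Rightarrow> ennreal" where
  "expected_cost P \<theta> s T =
     (\<integral>\<^sup>+(h, y). ennreal (\<Sum>(u, a)\<leftarrow>h. cost P u) \<partial>measure_pmf (run P \<theta> s T))"

definition average_cost :: "'v network \<Rightarrow> 'v policy \<Rightarrow> 'v state \<Rightarrow> ennreal" where
  "average_cost P \<theta> s = liminf (\<lambda>T. expected_cost P \<theta> s T / of_nat T)"

definition optimal :: "'v network \<Rightarrow> 'v policy \<Rightarrow> bool" where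
  "optimal P \<theta> \<longleftrightarrow> admissible P \<theta> \<and>
     (\<forall>\<theta>'. admissible P \<theta>' \<longrightarrow> (\<forall>s\<in>states P. average_cost P \<theta> s \<le> average_cost P \<theta>' s))"


section \<open>Ergodicity and stability\<close>

text \<open>
  \<open>no_visit Q A n x\<close> is the probability that the chain with kernel \<open>Q\<close> started in \<open>x\<close> is
  outside \<open>A\<close> at each of the times \<open>1, \<dots>, n\<close>. If \<open>\<tau>\<close> is the first time \<open>\<ge> 1\<close> at which the
  chain is in \<open>A\<close>, this is \<open>P(\<tau> > n)\<close>, and \<open>E \<tau>\<close> is the sum of these probabilities.
\<close>

primrec no_visit :: "('s \<Rightarrow> 's pmf) \<Rightarrow> 's set \<Rightarrow> nat \<Rightarrow> 's \<Rightarrow> ennreal" where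
  "no_visit Q A 0 x = 1"
| "no_visit Q A (Suc n) x = (\<integral>\<^sup>+z. no_visit Q A n z * indicator (- A) z \<partial>measure_pmf (Q x))"

definition mean_hitting_time :: "('s \<Rightarrow> 's pmf) \<Rightarrow> 's set \<Rightarrow> 's \<Rightarrow> ennreal" where
  "mean_hitting_time Q A x = (\<Sum>n. no_visit Q A n x)"

definition irreducible_class :: "('s \<Rightarrow> 's pmf) \<Rightarrow> 's set \<Rightarrow> bool" where
  "irreducible_class Q R \<longleftrightarrow> R \<noteq> {} \<and> (\<forall>x\<in>R. set_pmf (Q x) \<subseteq> R) \<and>
     (\<forall>x\<in>R. \<forall>y\<in>R. (x, y) \<in> {(u, w). w \<in> set_pmf (Q u)}\<^sup>*)"

text \<open>
  Ergodic on \<open>S\<close>: there is exactly one closed irreducible class, it is positive recurrent, and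
  it is reached with probability one from every state (uniqueness follows from the last
  clause). Equivalently, there is a probability distribution on \<open>S\<close> to which
  the time averages of the \<open>n\<close>-step distributions converge from every initial state.

  Transient states are allowed because \<open>S\<close> contains states in which the server is at an
  intermediate stage that it never visits again; for instance, with nodes \<open>{1, 2}\<close> and the
  single demand point \<open>1\<close>, the server never leaves \<open>1\<close> under the \<open>K\<close>-stop policy.
  Aperiodicity is not required, as in the underlying continuous-time system. Periodicity can
  occur as an artefact of uniformization: for two adjacent homogeneous demand points
  with \<open>\<mu> = \<tau>\<close>, each step of the uniformized chain under the \<open>K\<close>-stop policy changes the
  parity of (position + total number of jobs).
\<close>

definition ergodic_on :: "'s set \<Rightarrow> ('s \<Rightarrow> 's pmf) \<Rightarrow> bool" where
  "ergodic_on S Q \<longleftrightarrow> (\<forall>x\<in>S. set_pmf (Q x) \<subseteq> S) \<and>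
     (\<exists>R\<subseteq>S. irreducible_class Q R \<and>
        (\<forall>x\<in>R. mean_hitting_time Q {x} x < \<infinity>) \<and>
        (\<forall>x\<in>S. (\<lambda>n. no_visit Q R n x) \<longlonglongrightarrow> 0))"

definition stable :: "'v network \<Rightarrow> 'v policy \<Rightarrow> bool" where
  "stable P \<theta> \<longleftrightarrow> (\<exists>\<pi>. (\<forall>h. \<forall>s\<in>states P. \<theta> h s = \<pi> s) \<and>
     ergodic_on (states P) (\<lambda>s. bind_pmf (\<pi> s) (transition P s)))"


section \<open>Index quantities\<close>

text \<open>
  A sequence \<open>(s\<^sub>1, \<dots>, s\<^sub>m)\<close> is a list \<open>q\<close> of length \<open>m\<close>; in state \<open>(v, x)\<close> the entry \<open>s\<^sub>k\<close>, with
  \<open>s\<^sub>0 = v\<close>, is \<open>(v # q) ! k\<close>. The index \<open>j\<close> ranges over \<open>1, \<dots>, m\<close> throughout.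
\<close>

definition leg :: "'v network \<Rightarrow> 'v \<Rightarrow> 'v list \<Rightarrow> nat \<Rightarrow> real" where
  "leg P v q k = \<delta> P ((v # q) ! (k - 1)) ((v # q) ! k) / tau P"

fun Tj :: "'v network \<Rightarrow> 'v state \<Rightarrow> 'v list \<Rightarrow> real \<Rightarrow> nat \<Rightarrow> real" where
  "Tj P (v, x) q t j =
     (let i = (v # q) ! j in
       (real (x i) + lam P i * (t + (\<Sum>k\<in>{1..<j}. leg P v q k + Tj P (v, x) q t k) + leg P v q j))
       / (mu P i - lam P i))"

definition Rj :: "'v network \<Rightarrow> 'v state \<Rightarrow> 'v list \<Rightarrow> real \<Rightarrow> nat \<Rightarrow> real" where
  "Rj P s q t j = (let i = (fst s # q) ! j in hold P i * mu P i * Tj P s q t j)"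

definition \<psi> :: "'v network \<Rightarrow> 'v state \<Rightarrow> 'v list \<Rightarrow> real \<Rightarrow> real" where
  "\<psi> P s q t = (\<Sum>k=1..length q. Rj P s q t k) /
     (t + (\<Sum>k=1..length q. leg P (fst s) q k + Tj P s q t k))"

definition \<phi> :: "'v network \<Rightarrow> 'v state \<Rightarrow> 'v list \<Rightarrow> real \<Rightarrow> nat \<Rightarrow> real" where
  "\<phi> P s q t j = (\<Sum>k=1..j. Rj P s q t k) /
     (t + (\<Sum>k=1..j. leg P (fst s) q k + Tj P s q t k)
        + \<delta> P ((fst s # q) ! j) (fst s) / tau P)"

definition \<beta> :: "'v network \<Rightarrow> 'v state \<Rightarrow> 'v list \<Rightarrow> real \<Rightarrow> nat \<Rightarrow> real" where
  "\<beta> P s q t j =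
     (if fst s \<notin> set (take j q)
      then (\<Sum>k=1..j. Rj P s q t k) / (\<Sum>k=1..j. Tj P s q t k) * traffic P
           + hold P (fst s) * mu P (fst s) * (1 - traffic P)
      else 0)"

definition \<gamma> :: "'v network \<Rightarrow> 'v state \<Rightarrow> 'v list \<Rightarrow> real \<Rightarrow> real" where
  "\<gamma> P s q t =
     (\<Sum>k=1..length q. Rj P s q t k) / (\<Sum>k=1..length q. Tj P s q t k) * traffic P"


section \<open>The \<open>K\<close>-stop heuristic policy\<close>

definition sequences :: "'v network \<Rightarrow> nat \<Rightarrow> 'v \<Rightarrow> 'v list set" where
  "sequences P K v =
     {q. 1 \<le> length q \<and> length q \<le> K \<and> distinct q \<and> set q \<subseteq> demand P \<and> hd q \<noteq> v}"

definition \<sigma>\<^sub>2' :: "'v network \<Rightarrow> nat \<Rightarrow> 'v state \<Rightarrow> 'v list set" where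
  "\<sigma>\<^sub>2' P K s = {q \<in> sequences P K (fst s). deriv (\<lambda>t. \<psi> P s q t) 0 \<le> 0}"

definition \<sigma>\<^sub>1 :: "'v network \<Rightarrow> nat \<Rightarrow> 'v state \<Rightarrow> 'v list set" where
  "\<sigma>\<^sub>1 P K s = {q \<in> \<sigma>\<^sub>2' P K s. \<psi> P s q 0 \<ge> \<gamma> P s q 0 \<and>
     (length q = 1 \<or>
      length q \<ge> 2 \<and> (let y = (hd q, snd s) in \<psi> P y q 0 \<ge> \<gamma> P y q 0))}"

definition \<sigma>\<^sub>2 :: "'v network \<Rightarrow> nat \<Rightarrow> 'v state \<Rightarrow> 'v list set" where
  "\<sigma>\<^sub>2 P K s = \<sigma>\<^sub>2' P K s - \<sigma>\<^sub>1 P K s"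

definition \<sigma> :: "'v network \<Rightarrow> nat \<Rightarrow> 'v state \<Rightarrow> 'v list set" where
  "\<sigma> P K = (\<lambda>(v, x).
     if v \<in> demand P \<and> x v > 0 then
       {q \<in> sequences P K v. deriv (\<lambda>t. \<psi> P (v, x) q t) 0 \<le> 0 \<and>
          (\<forall>j\<in>{1..length q}. \<phi> P (v, x) q 0 j \<ge> \<beta> P (v, x) q 0 j)}
     else if \<sigma>\<^sub>1 P K (v, x) \<noteq> {} then \<sigma>\<^sub>1 P K (v, x)
     else \<sigma>\<^sub>2 P K (v, x))"

text \<open>
  Priority orderings are given by injective ranks, a smaller rank meaning a higher priority.
\<close>

definition before :: "('v \<Rightarrow> nat) \<Rightarrow> 'v list \<Rightarrow> 'v list \<Rightarrow> bool" where
  "before rk p q \<longleftrightarrow> (p, q) \<in> lexord {(a, b). rk a < rk b}"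

definition best_sequence :: "'v network \<Rightarrow> ('v \<Rightarrow> nat) \<Rightarrow> nat \<Rightarrow> 'v state \<Rightarrow> 'v list" where
  "best_sequence P drk K s = (THE q. q \<in> \<sigma> P K s \<and>
     (\<forall>p\<in>\<sigma> P K s. p \<noteq> q \<longrightarrow>
        \<psi> P s p 0 < \<psi> P s q 0 \<or> \<psi> P s p 0 = \<psi> P s q 0 \<and> before drk q p))"

definition shortest_paths :: "'v network \<Rightarrow> 'v \<Rightarrow> 'v \<Rightarrow> 'v list set" where
  "shortest_paths P u w = {p. vwalk p (with_proj (graph_of P)) \<and> hd p = u \<and> last p = w \<and>
     real (vwalk_length p) = \<delta> P u w}"

definition selected_path :: "'v network \<Rightarrow> ('v \<Rightarrow> nat) \<Rightarrow> 'v \<Rightarrow> 'v \<Rightarrow> 'v list" where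
  "selected_path P nrk u w = (THE p. p \<in> shortest_paths P u w \<and>
     (\<forall>p'\<in>shortest_paths P u w. p' \<noteq> p \<longrightarrow> before nrk p p'))"

definition K_stop_action ::
    "'v network \<Rightarrow> ('v \<Rightarrow> nat) \<Rightarrow> ('v \<Rightarrow> nat) \<Rightarrow> nat \<Rightarrow> 'v state \<Rightarrow> 'v" where
  "K_stop_action P drk nrk K s =
     (if \<sigma> P K s = {} then fst s
      else selected_path P nrk (fst s) (hd (best_sequence P drk K s)) ! 1)"

definition K_stop_policy ::
    "'v network \<Rightarrow> ('v \<Rightarrow> nat) \<Rightarrow> ('v \<Rightarrow> nat) \<Rightarrow> nat \<Rightarrow> 'v policy" where
  "K_stop_policy P drk nrk K = (\<lambda>h s. return_pmf (K_stop_action P drk nrk K s))"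

end

theory Submission
  imports Defs "HOL-Library.List_Lexorder"
begin

text \<open>
  In a homogeneous system let \<open>l\<close>, \<open>m\<close>, \<open>c\<close> be the common arrival rate, service rate and holding
  cost. All indices then reduce to two numbers attached to a sequence \<open>q\<close>: its total travel
  time \<open>L\<close>, and the time \<open>E\<close> at which the fluid server finishes \<open>q\<close>. The reward rate is
  \<open>\<psi> = c m (1 - L / E)\<close>, so maximising \<open>\<psi>\<close> means maximising \<open>E / L\<close>. At a nonempty queue
  \<open>\<phi>\<^sub>1 < c m = \<beta>\<^sub>1\<close>, so the server serves each queue exhaustively; otherwise it heads for the first
  entry of an admissible sequence with the largest \<open>E / L\<close>.

  Stability. A server that moves one step along the chosen sequence shortens \<open>L\<close> by one leg and
  changes \<open>E\<close> only by a bounded amount. Hence, when many jobs are present, each move multiplies the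
  best attainable ratio \<open>H = max E / (L + const)\<close> by a factor bounded away from \<open>1\<close>
  (\<open>move_gains\<close>), while one service lowers \<open>H\<close> by at most a constant and arrivals never lower it. As
  \<open>H\<close> is of the order of the number \<open>X\<close> of jobs, the function \<open>X - \<kappa> ln H\<close> with large \<open>\<kappa>\<close> has
  negative drift outside a finite set: at a move because of the logarithm, and during service
  because of \<open>\<rho> < 1\<close> (\<open>lyapunov_drift\<close>). Foster's criterion (\<open>foster_ergodic_on\<close>) then needs
  one state reached from everywhere. The empty system with the server at a fixed demand point is
  such a state: many arrivals at one queue force the server to go there and empty it, and this
  can be done for one queue after the other (\<open>reach_empty\<close>).

  Optimality. On a complete graph every leg of a sequence has length one, and an exchange argument
  shows that the chosen sequence starts at a longest queue (\<open>K_stop_greedy\<close>). It remains to see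
  that serving a nonempty queue, and otherwise moving to a longest one, minimises the expected
  cost over every finite horizon (\<open>val_Suc_greedy\<close>). This is an induction over the horizon which
  carries four inequalities for the optimal cost: more jobs cost more; a job is cheaper at the
  server's queue than elsewhere; serving a job now is better than moving away together with that job;
  and a demand point is a better position than an intermediate stage. The third one is preserved by
  itself, because serving and then moving leads to the same state as moving with the job and then
  serving it; with the second one it shows that a server with work should serve. That a longest queue
  is the best target follows from the second one and the symmetry between demand points.
  Comparing the average costs is then a comparison of the expected costs horizon by horizon.
\<close>

section \<open>Foster's criterion for a countable Markov chain\<close>

abbreviation steps :: "('s \<Rightarrow> 's pmf) \<Rightarrow> ('s \<times> 's) set" where
  "steps Q \<equiv> {(u, w). w \<in> set_pmf (Q u)}"

lemma no_visit_antimono_set: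
  assumes "A \<subseteq> B"
  shows "no_visit Q B n x \<le> no_visit Q A n x"
proof (induction n arbitrary: x)
  case (Suc n)
  show ?case
    using assms Suc by (auto intro!: nn_integral_mono simp: indicator_def)
qed simp

lemma no_visit_le_1: "no_visit Q A n x \<le> 1"
proof (induction n arbitrary: x)
  case (Suc n)
  have "no_visit Q A (Suc n) x \<le> (\<integral>\<^sup>+z. 1 \<partial>measure_pmf (Q x))"
    unfolding no_visit.simps
  proof (intro nn_integral_mono)
    show "no_visit Q A n z * indicator (- A) z \<le> 1" for z
      using Suc[of z] by (auto simp: indicator_def)
  qed
  then show ?case by simp
qed simp

lemma decseq_no_visit: "decseq (\<lambda>n. no_visit Q A n x)"
proof -
  have "no_visit Q A (Suc n) x \<le> no_visit Q A n x" for n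
  proof (induction n arbitrary: x)
    case 0
    show ?case using no_visit_le_1[of Q A 1 x] by simp
  next
    case (Suc n)
    show ?case
      using Suc unfolding no_visit.simps(2)[of Q A "Suc n"] no_visit.simps(2)[of Q A n]
      by (intro nn_integral_mono mult_right_mono) auto
  qed
  then show ?thesis by (simp add: decseq_Suc_iff)
qed

lemma nn_integral_pmf_less_1:
  assumes "\<And>z. g z \<le> (1::ennreal)" and "y \<in> set_pmf M" and "g y < 1"
  shows "(\<integral>\<^sup>+z. g z \<partial>measure_pmf M) < 1"
proof -
  have "0 < (1 - g y) * ennreal (pmf M y)"
    using assms by (simp add: ennreal_zero_less_mult_iff pmf_positive diff_gr0_ennreal)
  also have "(1 - g y) * ennreal (pmf M y)
      = (\<integral>\<^sup>+z. (1 - g y) * indicator {y} z \<partial>measure_pmf M)"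
    by (simp add: nn_integral_cmult_indicator emeasure_pmf_single)
  also have "\<dots> \<le> (\<integral>\<^sup>+z. 1 - g z \<partial>measure_pmf M)"
    by (intro nn_integral_mono) (auto simp: indicator_def)
  finally have pos: "0 < (\<integral>\<^sup>+z. 1 - g z \<partial>measure_pmf M)" .
  have "(\<integral>\<^sup>+z. g z \<partial>measure_pmf M) + (\<integral>\<^sup>+z. 1 - g z \<partial>measure_pmf M)
      = (\<integral>\<^sup>+z. g z + (1 - g z) \<partial>measure_pmf M)"
    by (simp add: nn_integral_add)
  also have "\<dots> = 1" using assms(1) by (simp add: add_diff_inverse_ennreal)
  finally have sum: "(\<integral>\<^sup>+z. g z \<partial>measure_pmf M) + (\<integral>\<^sup>+z. 1 - g z \<partial>measure_pmf M) = 1" .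
  show ?thesis
  proof (rule ccontr)
    assume "\<not> ?thesis"
    then have "1 \<le> (\<integral>\<^sup>+z. g z \<partial>measure_pmf M)" by simp
    then have "1 + (\<integral>\<^sup>+z. 1 - g z \<partial>measure_pmf M) \<le> 1 + 0"
      using add_right_mono[of 1 "\<integral>\<^sup>+z. g z \<partial>measure_pmf M" "\<integral>\<^sup>+z. 1 - g z \<partial>measure_pmf M"] sum by simp
    then have "(\<integral>\<^sup>+z. 1 - g z \<partial>measure_pmf M) \<le> 0"
      by (rule ennreal_add_left_cancel_le[THEN iffD1, THEN disjE]) auto
    with pos show False by simp
  qed
qed

lemma no_visit_less_1:
  assumes "(x, z) \<in> (steps Q)\<^sup>+"
  shows "\<exists>n. no_visit Q {z} n x < 1"
  using assms
proof (induction rule: converse_trancl_induct)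
  case (base y)
  have "no_visit Q {z} 1 y < 1"
    unfolding One_nat_def no_visit.simps
    by (rule nn_integral_pmf_less_1[where y = z]) (use base in \<open>auto simp: indicator_def\<close>)
  then show ?case ..
next
  case (step x y)
  then obtain n where n: "no_visit Q {z} n y < 1" by blast
  have "no_visit Q {z} n w * indicator (- {z}) w \<le> no_visit Q {z} n w" for w
    by (auto simp: indicator_def)
  then have "no_visit Q {z} (Suc n) x < 1"
    unfolding no_visit.simps
    by (intro nn_integral_pmf_less_1[where y = y])
       (use n step(1) no_visit_le_1[of Q "{z}" n] in \<open>auto intro: order_trans le_less_trans\<close>)
  then show ?case ..
qed

lemma sum_no_visit_Suc:
  "(\<Sum>n<Suc N. no_visit Q A n x)
    = 1 + (\<integral>\<^sup>+z. (\<Sum>n<N. no_visit Q A n z) * indicator (- A) z \<partial>measure_pmf (Q x))"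
proof -
  have "(\<integral>\<^sup>+z. (\<Sum>n<N. no_visit Q A n z) * indicator (- A) z \<partial>measure_pmf (Q x))
      = (\<Sum>n<N. \<integral>\<^sup>+z. no_visit Q A n z * indicator (- A) z \<partial>measure_pmf (Q x))"
    unfolding sum_distrib_right by (rule nn_integral_sum) simp
  then show ?thesis
    unfolding sum.lessThan_Suc_shift no_visit.simps by simp
qed

text \<open>
  The truncated mean hitting times obey the one-step recursion with equality, so by induction they
  stay below every solution \<open>W\<close> of the corresponding inequality.
\<close>

lemma mean_hitting_time_le:
  fixes W :: "'s \<Rightarrow> ennreal"
  assumes closed: "\<And>x. x \<in> S \<Longrightarrow> set_pmf (Q x) \<subseteq> S"
    and drift: "\<And>x. x \<in> S \<Longrightarrow> (\<integral>\<^sup>+z. W z * indicator (- A) z \<partial>measure_pmf (Q x)) + 1 \<le> W x"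
    and "x \<in> S"
  shows "mean_hitting_time Q A x \<le> W x"
proof -
  have "(\<Sum>n<N. no_visit Q A n x) \<le> W x" for N
    using \<open>x \<in> S\<close>
  proof (induction N arbitrary: x)
    case (Suc N)
    have "(\<integral>\<^sup>+z. (\<Sum>n<N. no_visit Q A n z) * indicator (- A) z \<partial>measure_pmf (Q x))
        \<le> (\<integral>\<^sup>+z. W z * indicator (- A) z \<partial>measure_pmf (Q x))"
      using Suc.IH closed[OF Suc.prems]
      by (intro nn_integral_mono_AE) (auto simp: AE_measure_pmf_iff intro!: mult_right_mono)
    then have "(\<Sum>n<Suc N. no_visit Q A n x)
        \<le> 1 + (\<integral>\<^sup>+z. W z * indicator (- A) z \<partial>measure_pmf (Q x))"
      unfolding sum_no_visit_Suc by (intro add_left_mono)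
    also have "\<dots> \<le> W x" using drift[OF Suc.prems] by (simp add: add.commute)
    finally show ?case .
  qed simp
  then show ?thesis
    unfolding mean_hitting_time_def by (intro suminf_le_const summableI) auto
qed

text \<open>
  The drift condition by itself controls only the returns to \<open>F\<close>. Since \<open>F\<close> is finite, there are \<open>N\<close>
  and \<open>p > 0\<close> such that from each state of \<open>F\<close> the state \<open>z\<close> is hit within \<open>N\<close> steps with
  probability at least \<open>p\<close>. Let \<open>U\<close> be the expected number of the first \<open>N\<close> times before the
  hit. Killing the chain at \<open>z\<close>, one step lowers \<open>U\<close> by one minus the probability of not having hit
  \<open>z\<close> after \<open>N\<close> steps: never an increase, and at least \<open>p\<close> on \<open>F\<close>. So \<open>(b / p) U\<close> pays for the
  excess \<open>b\<close> on \<open>F\<close>, and \<open>W + (b / p) U\<close> bounds the mean hitting time of \<open>z\<close>.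
\<close>

lemma foster_mean_hitting_time_finite:
  fixes W :: "'s \<Rightarrow> real" and b :: real
  assumes closed: "\<And>x. x \<in> S \<Longrightarrow> set_pmf (Q x) \<subseteq> S"
    and drift: "\<And>x. x \<in> S \<Longrightarrow>
      (\<integral>\<^sup>+y. ennreal (W y) \<partial>measure_pmf (Q x)) + 1 \<le> ennreal (W x) + ennreal b * indicator F x"
    and F: "finite F" and reach: "\<And>x. x \<in> F \<Longrightarrow> (x, z) \<in> (steps Q)\<^sup>+"
    and b0: "0 \<le> b" and x: "x \<in> S"
  shows "mean_hitting_time Q {z} x < \<infinity>"
proof -
  let ?f = "no_visit Q {z}"
  have "\<forall>x\<in>F. \<exists>n. ?f n x < 1" using no_visit_less_1[OF reach] by blast
  then obtain k where k: "\<And>x. x \<in> F \<Longrightarrow> ?f (k x) x < 1" by metis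
  define N where "N = Max (insert 0 (k ` F))"
  have fN: "?f N x < 1" if "x \<in> F" for x
  proof -
    have "k x \<le> N" using F that by (auto simp: N_def)
    then have "?f N x \<le> ?f (k x) x" using decseq_no_visit[of Q "{z}" x] by (simp add: decseq_def)
    then show ?thesis using k[OF that] by simp
  qed
  \<comment> \<open>the value \<open>1\<close> is a harmless default for empty \<open>F\<close>\<close>
  define p where "p = Min (insert 1 ((\<lambda>x. 1 - enn2real (?f N x)) ` F))"
  have er: "enn2real (?f N x) \<le> 1" and ef: "ennreal (enn2real (?f N x)) = ?f N x" for x
    using no_visit_le_1[of Q "{z}" N x]
    by (auto intro: enn2real_leI intro!: ennreal_enn2real simp: le_less_trans)
  have lt: "enn2real (?f N x) < 1" if "x \<in> F" for x
    using fN[OF that] ef[of x] by (metis ennreal_less_one_iff)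
  have p0: "0 < p" unfolding p_def using F lt by (subst Min_gr_iff) auto
  have fp: "enn2real (?f N x) + p \<le> 1" if "x \<in> F" for x
  proof -
    have "p \<le> 1 - enn2real (?f N x)" unfolding p_def using F that by (intro Min_le) auto
    then show ?thesis by simp
  qed
  define U where "U x = (\<Sum>n<N. ?f n x)" for x
  define c where "c = b / p"
  have c0: "0 \<le> c" using b0 p0 by (simp add: c_def)
  have U: "(\<integral>\<^sup>+y. U y * indicator (- {z}) y \<partial>measure_pmf (Q x)) + 1 = U x + ?f N x" for x
    unfolding U_def using sum_no_visit_Suc[where Q = Q and A = "{z}" and N = N and x = x]
    by (simp add: add.commute)
  define W' where "W' x = ennreal (W x) + ennreal c * U x" for x
  have "mean_hitting_time Q {z} x \<le> W' x"
  proof (rule mean_hitting_time_le[where S = S, OF closed _ x])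
    fix x assume xS: "x \<in> S"
    have "(\<integral>\<^sup>+y. W' y * indicator (- {z}) y \<partial>measure_pmf (Q x))
        \<le> (\<integral>\<^sup>+y. ennreal (W y) + ennreal c * (U y * indicator (- {z}) y) \<partial>measure_pmf (Q x))"
      by (intro nn_integral_mono) (auto simp: W'_def indicator_def)
    also have "\<dots> = (\<integral>\<^sup>+y. ennreal (W y) \<partial>measure_pmf (Q x))
        + ennreal c * (\<integral>\<^sup>+y. U y * indicator (- {z}) y \<partial>measure_pmf (Q x))"
      by (simp add: nn_integral_add nn_integral_cmult)
    finally have "(\<integral>\<^sup>+y. W' y * indicator (- {z}) y \<partial>measure_pmf (Q x)) + 1 + ennreal c
        \<le> ((\<integral>\<^sup>+y. ennreal (W y) \<partial>measure_pmf (Q x)) + 1)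
        + ennreal c * ((\<integral>\<^sup>+y. U y * indicator (- {z}) y \<partial>measure_pmf (Q x)) + 1)"
      by (simp add: distrib_left add_ac add_mono)
    also have "\<dots> \<le> (ennreal (W x) + ennreal b * indicator F x) + ennreal c * (U x + ?f N x)"
      unfolding U by (intro add_mono drift xS order_refl)
    also have "\<dots> = W' x + (ennreal b * indicator F x + ennreal c * ?f N x)"
      by (simp add: W'_def distrib_left add_ac)
    also have "\<dots> \<le> W' x + ennreal c"
    proof (intro add_left_mono)
      have "ennreal b * indicator F x + ennreal c * ?f N x
          = ennreal (b * indicator F x + c * enn2real (?f N x))"
        using b0 c0 by (auto simp: indicator_def ennreal_mult'' ef ennreal_plus[symmetric] simp del: ennreal_plus)
          (simp_all add: ennreal_mult'[OF c0] ef)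
      also have "\<dots> \<le> ennreal c"
      proof (intro ennreal_leI)
        show "b * indicator F x + c * enn2real (?f N x) \<le> c"
        proof (cases "x \<in> F")
          case True
          have "c * (enn2real (?f N x) + p) \<le> c * 1" using fp[OF True] c0 by (intro mult_left_mono)
          then show ?thesis using True p0 by (simp add: c_def algebra_simps)
        next
          case False
          then show ?thesis using c0 er[of x] mult_left_mono[of _ 1 c] by simp
        qed
      qed
      finally show "ennreal b * indicator F x + ennreal c * ?f N x \<le> ennreal c" .
    qed
    finally show "(\<integral>\<^sup>+y. W' y * indicator (- {z}) y \<partial>measure_pmf (Q x)) + 1 \<le> W' x"
      by (simp add: add.commute[of _ "ennreal c"] )
  qed
  also have "W' x < \<infinity>"
  proof -
    have "U x \<le> (\<Sum>n<N. 1)" unfolding U_def by (intro sum_mono no_visit_le_1)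
    then have "U x < \<infinity>" using le_less_trans by (fastforce simp: of_nat_less_top)
    then show ?thesis by (simp add: W'_def ennreal_mult_less_top)
  qed
  finally show ?thesis .
qed

text \<open>
  The recurrent class consists of the states that can be reached from \<open>z\<close>. As \<open>z\<close> is reached from
  everywhere, each of its members can play the part of \<open>z\<close> in the preceding lemma.
\<close>

theorem foster_ergodic_on:
  fixes W :: "'s \<Rightarrow> real" and b :: real
  assumes closed: "\<And>x. x \<in> S \<Longrightarrow> set_pmf (Q x) \<subseteq> S"
    and drift: "\<And>x. x \<in> S \<Longrightarrow>
      (\<integral>\<^sup>+y. ennreal (W y) \<partial>measure_pmf (Q x)) + 1 \<le> ennreal (W x) + ennreal b * indicator F x"
    and F: "finite F" "F \<subseteq> S" and b0: "0 \<le> b"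
    and z: "z \<in> S" "\<And>x. x \<in> S \<Longrightarrow> (x, z) \<in> (steps Q)\<^sup>*"
  shows "ergodic_on S Q"
proof -
  define R where "R = {y. (z, y) \<in> (steps Q)\<^sup>*}"
  have RS: "R \<subseteq> S"
  proof
    fix y assume "y \<in> R"
    then have "(z, y) \<in> (steps Q)\<^sup>*" by (simp add: R_def)
    then show "y \<in> S" by (induction rule: rtrancl_induct) (use z closed in auto)
  qed
  have plus: "(x, y) \<in> (steps Q)\<^sup>+" if x: "x \<in> S" and y: "y \<in> R" for x y
  proof -
    obtain w where w: "w \<in> set_pmf (Q x)" using set_pmf_not_empty[of "Q x"] by blast
    then have "(w, z) \<in> (steps Q)\<^sup>*" using closed[OF x] z(2) by blast
    moreover have "(z, y) \<in> (steps Q)\<^sup>*" using y by (simp add: R_def)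
    moreover have "(x, w) \<in> steps Q" using w by simp
    ultimately show ?thesis by (meson rtrancl_into_trancl2 rtrancl_trans)
  qed
  have fin: "mean_hitting_time Q {y} x < \<infinity>" if "x \<in> S" "y \<in> R" for x y
    by (rule foster_mean_hitting_time_finite[OF closed drift F(1) _ b0 that(1)])
       (use plus F(2) that in auto)
  have irr: "irreducible_class Q R"
    unfolding irreducible_class_def
  proof (intro conjI ballI)
    show "R \<noteq> {}" by (auto simp: R_def)
    show "set_pmf (Q x) \<subseteq> R" if "x \<in> R" for x
      using that unfolding R_def by (auto intro: rtrancl_into_rtrancl)
    show "(x, y) \<in> (steps Q)\<^sup>*" if "x \<in> R" "y \<in> R" for x y
      using plus[of x y] that RS by (auto intro: trancl_into_rtrancl)
  qed
  have lim: "(\<lambda>n. no_visit Q R n x) \<longlonglongrightarrow> 0" if x: "x \<in> S" for x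
  proof -
    have zR: "z \<in> R" by (simp add: R_def)
    have "(\<Sum>n. no_visit Q {z} n x) \<noteq> \<top>"
      using fin[OF x zR] by (simp add: mean_hitting_time_def)
    moreover have eq: "ennreal (enn2real (no_visit Q {z} n x)) = no_visit Q {z} n x" for n
      using no_visit_le_1[of Q "{z}" n x] by (intro ennreal_enn2real) (auto simp: le_less_trans)
    ultimately have "summable (\<lambda>n. enn2real (no_visit Q {z} n x))"
      by (intro summable_suminf_not_top) auto
    then have "(\<lambda>n. ennreal (enn2real (no_visit Q {z} n x))) \<longlonglongrightarrow> ennreal 0"
      by (intro tendsto_ennrealI summable_LIMSEQ_zero)
    then have "(\<lambda>n. no_visit Q {z} n x) \<longlonglongrightarrow> 0" by (simp add: eq)
    then show ?thesis
      by (rule tendsto_sandwich[OF _ _ tendsto_const, rotated 2])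
         (use zR in \<open>auto intro!: always_eventually no_visit_antimono_set\<close>)
  qed
  show ?thesis
    unfolding ergodic_on_def using closed RS irr fin lim by blast
qed

section \<open>Optimality of serving and then visiting a longest queue\<close>

definition inc :: "'v \<Rightarrow> ('v \<Rightarrow> nat) \<Rightarrow> 'v \<Rightarrow> nat" where
  "inc i x = x(i := x i + 1)"

definition dec :: "'v \<Rightarrow> ('v \<Rightarrow> nat) \<Rightarrow> 'v \<Rightarrow> nat" where
  "dec i x = x(i := x i - 1)"

lemma inc_apply [simp]: "inc i x j = (if j = i then Suc (x j) else x j)"
  by (simp add: inc_def)

lemma dec_apply [simp]: "dec i x j = (if j = i then x j - 1 else x j)"
  by (simp add: dec_def)

lemma dec_inc [simp]: "dec i (inc i x) = x"
  by (simp add: inc_def dec_def)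

lemma inc_dec [simp]: "0 < x i \<Longrightarrow> inc i (dec i x) = x"
  by (simp add: inc_def dec_def)

lemma inc_commute: "inc i (inc j x) = inc j (inc i x)"
  by (auto simp: fun_eq_iff)

lemma inc_dec_commute: "i \<noteq> j \<or> 0 < x i \<Longrightarrow> inc j (dec i x) = dec i (inc j x)"
  by (auto simp: fun_eq_iff)

text \<open>
  The decision process on a complete graph with nodes \<open>Nd\<close> and demand points \<open>D\<close>. The
  number \<open>M\<close> stands for the probability that a step brings no arrival.
\<close>

locale symmetric_polling =
  fixes Nd D :: "'v set" and l m \<tau> c :: real and M :: real
  assumes fin: "finite Nd" and sub: "D \<subseteq> Nd"
    and l0: "0 \<le> l" and m0: "0 < m" and t0: "0 < \<tau>" and c0: "0 \<le> c"
    and mM: "m \<le> M" and tM: "\<tau> \<le> M"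
begin

definition busy :: "'v \<Rightarrow> ('v \<Rightarrow> nat) \<Rightarrow> bool" where
  "busy v x \<longleftrightarrow> v \<in> D \<and> 0 < x v"

text \<open>
  The expected value after one step in which action \<open>a\<close> is chosen, restricted to the event that no
  arrival takes place. The arrivals do not depend on the action and enter \<open>base\<close>.
\<close>

definition act :: "('v \<Rightarrow> ('v \<Rightarrow> nat) \<Rightarrow> real) \<Rightarrow> 'v \<Rightarrow> ('v \<Rightarrow> nat) \<Rightarrow> 'v \<Rightarrow> real" where
  "act V v x a =
     (if a \<noteq> v then \<tau> * V a x + (M - \<tau>) * V v x
      else if busy v x then m * V v (dec v x) + (M - m) * V v x
      else M * V v x)"

definition base :: "('v \<Rightarrow> ('v \<Rightarrow> nat) \<Rightarrow> real) \<Rightarrow> 'v \<Rightarrow> ('v \<Rightarrow> nat) \<Rightarrow> real" where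
  "base V v x = (\<Sum>i\<in>D. c * real (x i)) + (\<Sum>i\<in>D. l * V v (inc i x))"

definition backup :: "('v \<Rightarrow> ('v \<Rightarrow> nat) \<Rightarrow> real) \<Rightarrow> 'v \<Rightarrow> ('v \<Rightarrow> nat) \<Rightarrow> real" where
  "backup V v x = base V v x + Min (act V v x ` Nd)"

primrec val :: "nat \<Rightarrow> 'v \<Rightarrow> ('v \<Rightarrow> nat) \<Rightarrow> real" where
  "val 0 = (\<lambda>v x. 0)"
| "val (Suc n) = backup (val n)"

definition mono_jobs where
  "mono_jobs V \<longleftrightarrow> (\<forall>v\<in>Nd. \<forall>i\<in>D. \<forall>x. V v x \<le> V v (inc i x))"

definition local_better where
  "local_better V \<longleftrightarrow> (\<forall>w\<in>D. \<forall>v\<in>D. \<forall>x. V w (inc w x) \<le> V w (inc v x))"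

text \<open>
  Divide by \<open>m + \<tau>\<close>. The left-hand side then is the outcome of an attempt to serve a job at \<open>w\<close>, which
  succeeds with probability \<open>m / (m + \<tau>)\<close>; the right-hand side is the outcome of an attempt to move to
  \<open>v\<close> and to take this job along, which succeeds with the complementary probability.
\<close>

definition serve_first where
  "serve_first V \<longleftrightarrow> (\<forall>w\<in>D. \<forall>v\<in>D. \<forall>x. w \<noteq> v \<longrightarrow>
     m * V w x + \<tau> * V w (inc w x) \<le> m * V w (inc w x) + \<tau> * V v (inc v x))"

definition demand_better where
  "demand_better V \<longleftrightarrow> (\<forall>w\<in>D. \<forall>n\<in>Nd - D. \<forall>x. V w x \<le> V n x)"

definition good where
  "good V \<longleftrightarrow> mono_jobs V \<and> local_better V \<and> serve_first V \<and> demand_better V"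

lemma goodD:
  assumes "good V"
  shows "\<And>v i x. v \<in> Nd \<Longrightarrow> i \<in> D \<Longrightarrow> V v x \<le> V v (inc i x)"
    and "\<And>w v x. w \<in> D \<Longrightarrow> v \<in> D \<Longrightarrow> V w (inc w x) \<le> V w (inc v x)"
    and "\<And>w v x. w \<in> D \<Longrightarrow> v \<in> D \<Longrightarrow> w \<noteq> v \<Longrightarrow>
       m * V w x + \<tau> * V w (inc w x) \<le> m * V w (inc w x) + \<tau> * V v (inc v x)"
    and "\<And>w n x. w \<in> D \<Longrightarrow> n \<in> Nd \<Longrightarrow> n \<notin> D \<Longrightarrow> V w x \<le> V n x"
  using assms
  by (auto simp: good_def mono_jobs_def local_better_def serve_first_def demand_better_def)

lemma backup_le: "a \<in> Nd \<Longrightarrow> backup V v x \<le> base V v x + act V v x a"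
  unfolding backup_def using fin by (intro add_left_mono Min_le) auto

lemma backup_attained: "v \<in> Nd \<Longrightarrow> \<exists>a\<in>Nd. backup V v x = base V v x + act V v x a"
proof -
  assume "v \<in> Nd"
  then have "Min (act V v x ` Nd) \<in> act V v x ` Nd" using fin by (intro Min_in) auto
  then show ?thesis by (auto simp: backup_def)
qed

lemma serve_le_idle:
  assumes "good V" "w \<in> D"
  shows "act V w x w \<le> M * V w x"
proof (cases "busy w x")
  case True
  then have "V w (dec w x) \<le> V w x"
    using goodD(1)[OF assms(1), of w w "dec w x"] assms(2) sub by (auto simp: busy_def)
  then have "m * V w (dec w x) \<le> m * V w x" using m0 by simp
  then show ?thesis using True by (simp add: act_def algebra_simps)
qed (simp add: act_def)

text \<open>
  After moving away, the job left behind is at most as favourable as a job carried along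
  (\<open>local_better\<close>), and even that is no better than serving (\<open>serve_first\<close>).
\<close>

lemma serve_optimal:
  assumes V: "good V" and w: "w \<in> D" and x: "0 < x w" and a: "a \<in> Nd"
  shows "act V w x w \<le> act V w x a"
proof (cases "a = w")
  case False
  have b: "busy w x" using w x by (simp add: busy_def)
  obtain z where z: "x = inc w z" using x by (intro that[of "dec w x"]) simp
  have "m * V w z + \<tau> * V w (inc w z) \<le> m * V w (inc w z) + \<tau> * V a (inc w z)"
  proof (cases "a \<in> D")
    case True
    then have "\<tau> * V a (inc a z) \<le> \<tau> * V a (inc w z)"
      using goodD(2)[OF V True w] t0 by simp
    then show ?thesis using goodD(3)[OF V w True, of z] False by simp
  next
    case aN: False
    have "\<tau> * V w (inc w z) \<le> \<tau> * V a (inc w z)" "m * V w z \<le> m * V w (inc w z)"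
      using goodD(4)[OF V w a aN] goodD(1)[OF V, of w w z] w sub t0 m0 by auto
    then show ?thesis by simp
  qed
  then show ?thesis using False b unfolding act_def z by (simp add: algebra_simps)
qed simp

lemma backup_busy:
  assumes "good V" "w \<in> D" "0 < x w"
  shows "backup V w x = base V w x + (m * V w (dec w x) + (M - m) * V w x)"
proof -
  have wN: "w \<in> Nd" using assms sub by auto
  obtain a where a: "a \<in> Nd" "backup V w x = base V w x + act V w x a"
    using backup_attained[OF wN] by blast
  have "backup V w x = base V w x + act V w x w"
    using serve_optimal[where V = V and w = w and x = x, OF assms a(1)] backup_le[OF wN, of V w x] a(2) by linarith
  then show ?thesis using assms by (simp add: act_def busy_def)
qed

lemma sum_inc: "i \<in> D \<Longrightarrow> (\<Sum>j\<in>D. c * real (inc i x j)) = c + (\<Sum>j\<in>D. c * real (x j))"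
proof -
  assume i: "i \<in> D"
  have fD: "finite D" using fin sub finite_subset by blast
  show ?thesis
    using i by (simp add: sum.remove[OF fD i] algebra_simps)
qed

lemma act_mono:
  assumes "good V" "v \<in> Nd" "i \<in> D" "a \<in> Nd"
  shows "act V v x a \<le> act V v (inc i x) a"
proof -
  note V = goodD(1)[OF assms(1)]
  show ?thesis
  proof (cases "a = v")
    case False
    then show ?thesis
      using V[OF assms(4,3), of x] V[OF assms(2,3), of x] t0 tM
      by (auto simp: act_def intro!: add_mono mult_left_mono)
  next
    case [simp]: True
    have le: "V v x \<le> V v (inc i x)" by (rule V) fact+
    show ?thesis
    proof (cases "busy v (inc i x)")
      case b: True
      show ?thesis
      proof (cases "busy v x")
        case True
        have "dec v (inc i x) = inc i (dec v x)"
          using True by (intro inc_dec_commute[symmetric]) (auto simp: busy_def)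
        then show ?thesis
          using True b V[OF assms(2,3), of "dec v x"] le m0 mM
          by (auto simp: act_def intro!: add_mono mult_left_mono)
      next
        case False
        with b have "i = v" "dec v (inc i x) = x" by (auto simp: busy_def split: if_splits)
        moreover have "(M - m) * V v x \<le> (M - m) * V v (inc i x)"
          using le mM by (intro mult_left_mono) auto
        ultimately show ?thesis using False b by (simp add: act_def algebra_simps)
      qed
    next
      case False
      then have "\<not> busy v x" by (auto simp: busy_def split: if_splits)
      then show ?thesis using False le m0 mM by (simp add: act_def mult_left_mono)
    qed
  qed
qed

lemma backup_mono_jobs:
  assumes V: "good V"
  shows "mono_jobs (backup V)"
  unfolding mono_jobs_def
proof (intro ballI allI)
  fix v i x assume v: "v \<in> Nd" and i: "i \<in> D"
  obtain a where a: "a \<in> Nd" "backup V v (inc i x) = base V v (inc i x) + act V v (inc i x) a"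
    using backup_attained[OF v] by blast
  have "base V v x \<le> base V v (inc i x)"
  proof -
    have "(\<Sum>j\<in>D. l * V v (inc j x)) \<le> (\<Sum>j\<in>D. l * V v (inc i (inc j x)))"
      by (intro sum_mono mult_left_mono goodD(1)[OF V v i] l0)
    then show ?thesis
      using c0 unfolding base_def sum_inc[OF i] inc_commute[of _ i] by linarith
  qed
  then show "backup V v x \<le> backup V v (inc i x)"
    unfolding a(2) using backup_le[OF a(1), of V v x] act_mono[OF V v i a(1), of x] by linarith
qed

text \<open>
  The delicate case is a server at an empty queue \<open>w\<close>, moving to some \<open>a\<close>, compared with a server
  that has one job at \<open>w\<close> and serves it. There \<open>serve_first\<close> compares the service with a move to \<open>a\<close>
  that takes the job along, and at \<open>a\<close> a job at the server's queue beats a job at \<open>v\<close>.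
\<close>

lemma backup_local_better:
  assumes V: "good V"
  shows "local_better (backup V)"
  unfolding local_better_def
proof (intro ballI allI)
  fix w v x assume w: "w \<in> D" and v: "v \<in> D"
  have wN: "w \<in> Nd" and vN: "v \<in> Nd" using w v sub by auto
  note mono = goodD(1)[OF V] and loc = goodD(2)[OF V] and ser = goodD(3)[OF V]
    and dem = goodD(4)[OF V]
  show "backup V w (inc w x) \<le> backup V w (inc v x)"
  proof (cases "v = w")
    case vw: False
    have R: "backup V w (inc w x) = base V w (inc w x) + (m * V w x + (M - m) * V w (inc w x))"
      using backup_busy[OF V w, of "inc w x"] by simp
    have B: "base V w (inc w x) \<le> base V w (inc v x)"
      unfolding base_def sum_inc[OF w] sum_inc[OF v] inc_commute[of _ w] inc_commute[of _ v]
      by (intro add_mono sum_mono mult_left_mono loc w v l0 order_refl)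
    obtain a where a: "a \<in> Nd" "backup V w (inc v x) = base V w (inc v x) + act V w (inc v x) a"
      using backup_attained[OF wN] by blast
    have lw: "V w (inc w x) \<le> V w (inc v x)" by (rule loc[OF w v])
    have mw: "m * V w x \<le> m * V w (inc w x)" using mono[OF wN w] m0 by simp
    have "m * V w x + (M - m) * V w (inc w x) \<le> act V w (inc v x) a"
    proof (cases "0 < x w")
      case True
      have "act V w (inc v x) w \<le> act V w (inc v x) a"
        using True vw by (intro serve_optimal V w a) auto
      moreover have "act V w (inc v x) w = m * V w (inc v (dec w x)) + (M - m) * V w (inc v x)"
        using True vw w by (simp add: act_def busy_def inc_dec_commute)
      moreover have "m * V w x \<le> m * V w (inc v (dec w x))"
        using loc[OF w v, of "dec w x"] True m0 by simp
      moreover have "(M - m) * V w (inc w x) \<le> (M - m) * V w (inc v x)"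
        using lw mM by (intro mult_left_mono) auto
      ultimately show ?thesis by linarith
    next
      case False
      then have nb: "\<not> busy w (inc v x)" using vw by (auto simp: busy_def)
      have idle: "m * V w x + (M - m) * V w (inc w x) \<le> M * V w (inc w x)"
        using mw by (simp add: algebra_simps)
      have Ml: "M * V w (inc w x) \<le> M * V w (inc v x)" using lw m0 mM by (intro mult_left_mono) auto
      show ?thesis
      proof (cases "a = w")
        case True
        then show ?thesis using nb idle Ml by (simp add: act_def)
      next
        case aw: False
        then have act: "act V w (inc v x) a = \<tau> * V a (inc v x) + (M - \<tau>) * V w (inc v x)"
          by (simp add: act_def)
        have Mt: "(M - \<tau>) * V w (inc w x) \<le> (M - \<tau>) * V w (inc v x)"
          using lw tM by (intro mult_left_mono) auto
        show ?thesis
        proof (cases "a \<in> D")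
          case True
          have "\<tau> * V a (inc a x) \<le> \<tau> * V a (inc v x)" using loc[OF True v] t0 by simp
          then show ?thesis
            using ser[OF w True, of x] aw Mt unfolding act by (simp add: algebra_simps)
        next
          case False
          have "\<tau> * V w (inc v x) \<le> \<tau> * V a (inc v x)" using dem[OF w a(1) False] t0 by simp
          then show ?thesis using idle Ml unfolding act by (simp add: algebra_simps)
        qed
      qed
    qed
    then show ?thesis using B unfolding R a(2) by linarith
  qed simp
qed

text \<open>
  Bound the optimal cost at \<open>(w, x)\<close> from above by moving to \<open>v\<close>; in the other states the server
  serves. Both orders, serving then moving and moving then serving, end in \<open>(v, x)\<close>, these terms
  cancel, and what is left is \<open>M - m\<close> times the inequality to be preserved.
\<close>

lemma backup_serve_first:
  assumes V: "good V"
  shows "serve_first (backup V)"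
  unfolding serve_first_def
proof (intro ballI allI impI)
  fix w v x assume w: "w \<in> D" and v: "v \<in> D" and wv: "w \<noteq> v"
  have vN: "v \<in> Nd" using v sub by auto
  note ser = goodD(3)[OF V w v wv]
  have 1: "backup V w (inc w x) = base V w (inc w x) + (m * V w x + (M - m) * V w (inc w x))"
    using backup_busy[OF V w, of "inc w x"] by simp
  have 2: "backup V v (inc v x) = base V v (inc v x) + (m * V v x + (M - m) * V v (inc v x))"
    using backup_busy[OF V v, of "inc v x"] by simp
  have 3: "backup V w x \<le> base V w x + (\<tau> * V v x + (M - \<tau>) * V w x)"
    using backup_le[OF vN, of V w x] wv by (simp add: act_def)
  have B: "m * base V w x + \<tau> * base V w (inc w x) \<le> m * base V w (inc w x) + \<tau> * base V v (inc v x)"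
  proof -
    define S where "S = (\<Sum>j\<in>D. c * real (x j))"
    define a1 where "a1 = (\<Sum>i\<in>D. l * V w (inc i x))"
    define a2 where "a2 = (\<Sum>i\<in>D. l * V w (inc w (inc i x)))"
    define a3 where "a3 = (\<Sum>i\<in>D. l * V v (inc v (inc i x)))"
    have "m * a1 + \<tau> * a2
        = (\<Sum>i\<in>D. l * (m * V w (inc i x) + \<tau> * V w (inc w (inc i x))))"
      by (simp add: a1_def a2_def sum_distrib_left sum.distrib algebra_simps)
    also have "\<dots> \<le> (\<Sum>i\<in>D. l * (m * V w (inc w (inc i x)) + \<tau> * V v (inc v (inc i x))))"
      by (intro sum_mono mult_left_mono ser l0)
    also have "\<dots> = m * a2 + \<tau> * a3"
      by (simp add: a2_def a3_def sum_distrib_left sum.distrib algebra_simps)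
    finally have le: "m * a1 + \<tau> * a2 \<le> m * a2 + \<tau> * a3" .
    have b1: "base V w x = S + a1" by (simp add: base_def S_def a1_def)
    have b2: "base V w (inc w x) = c + S + a2"
      unfolding base_def sum_inc[OF w] S_def a2_def inc_commute[of _ w] ..
    have b3: "base V v (inc v x) = c + S + a3"
      unfolding base_def sum_inc[OF v] S_def a3_def inc_commute[of _ v] ..
    have "0 \<le> m * c" using m0 c0 by simp
    with le show ?thesis unfolding b1 b2 b3 by (simp add: algebra_simps)
  qed
  have "0 \<le> (M - m) * (m * V w (inc w x) + \<tau> * V v (inc v x) - m * V w x - \<tau> * V w (inc w x))"
    using ser[of x] mM by (intro mult_nonneg_nonneg) auto
  then have "m * (\<tau> * V v x + (M - \<tau>) * V w x) + \<tau> * (m * V w x + (M - m) * V w (inc w x))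
      \<le> m * (m * V w x + (M - m) * V w (inc w x)) + \<tau> * (m * V v x + (M - m) * V v (inc v x))"
    by (simp add: algebra_simps)
  moreover have "m * backup V w x \<le> m * (base V w x + (\<tau> * V v x + (M - \<tau>) * V w x))"
    using 3 m0 by simp
  ultimately show "m * backup V w x + \<tau> * backup V w (inc w x)
      \<le> m * backup V w (inc w x) + \<tau> * backup V v (inc v x)"
    using B unfolding 1 2 distrib_left by linarith
qed

lemma backup_demand_better:
  assumes V: "good V"
  shows "demand_better (backup V)"
  unfolding demand_better_def
proof (intro ballI allI)
  fix w n x assume w: "w \<in> D" and n: "n \<in> Nd - D"
  have wN: "w \<in> Nd" using w sub by auto
  have dem: "V w y \<le> V n' y" if "n' \<in> Nd - D" for n' y using goodD(4)[OF V w] that by auto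
  obtain a where a: "a \<in> Nd" "backup V n x = base V n x + act V n x a"
    using backup_attained n by blast
  have B: "base V w x \<le> base V n x"
    unfolding base_def by (auto intro!: sum_mono mult_left_mono dem n l0)
  have stay: "backup V w x \<le> base V w x + M * V w x"
    using backup_le[OF wN, of V w x] serve_le_idle[OF V w, of x] by linarith
  have Mt: "(M - \<tau>) * V w x \<le> (M - \<tau>) * V n x" using dem[OF n] tM by (intro mult_left_mono) auto
  have Mw: "M * V w x = \<tau> * V w x + (M - \<tau>) * V w x" by (simp add: algebra_simps)
  show "backup V w x \<le> backup V n x"
  proof (cases "a \<in> D")
    case True
    then have act: "act V n x a = \<tau> * V a x + (M - \<tau>) * V n x" using n by (auto simp: act_def)
    have "backup V w x \<le> base V w x + (\<tau> * V a x + (M - \<tau>) * V w x)"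
    proof (cases "a = w")
      case True
      then show ?thesis using stay Mw by simp
    next
      case False
      then show ?thesis using backup_le[OF a(1), of V w x] by (simp add: act_def)
    qed
    then show ?thesis using B Mt unfolding a(2) act by linarith
  next
    case False
    have "M * V w x \<le> act V n x a"
    proof (cases "a = n")
      case True
      then show ?thesis using n dem[OF n, of x] m0 mM by (auto simp: act_def busy_def)
    next
      case an: False
      have "\<tau> * V w x \<le> \<tau> * V a x" using dem[of a x] a False t0 by auto
      then show ?thesis using an Mt Mw by (simp add: act_def)
    qed
    then show ?thesis using stay B unfolding a(2) by linarith
  qed
qed

lemma good_val: "good (val n)"
proof (induction n)
  case 0
  show ?case
    by (simp add: good_def mono_jobs_def local_better_def serve_first_def demand_better_def)
next
  case (Suc n)
  then show ?case
    unfolding val.simps good_def[of "backup (val n)"]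
    by (intro conjI backup_mono_jobs backup_local_better backup_serve_first backup_demand_better)
qed

lemma val_nonneg:
  assumes "v \<in> Nd"
  shows "0 \<le> val n v x"
  using assms
proof (induction n arbitrary: v x)
  case (Suc n)
  have act0: "0 \<le> act (val n) v x a" if "a \<in> Nd" for a
    using Suc that m0 t0 mM tM by (auto simp: act_def intro!: add_nonneg_nonneg mult_nonneg_nonneg)
  have "0 \<le> base (val n) v x"
    unfolding base_def using Suc l0 c0 by (intro add_nonneg_nonneg sum_nonneg mult_nonneg_nonneg) auto
  moreover have "0 \<le> Min (act (val n) v x ` Nd)"
    using act0 fin Suc.prems by (subst Min_ge_iff) auto
  ultimately show ?case by (simp add: backup_def)
qed simp

text \<open>
  Relabelling the nodes by an involution that respects \<open>D\<close> leaves the process unchanged.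
\<close>

lemma val_symmetric:
  assumes p: "\<And>u. p (p u) = u" "\<And>u. u \<in> D \<Longrightarrow> p u \<in> D" "\<And>u. u \<in> Nd \<Longrightarrow> p u \<in> Nd"
  shows "val n (p v) (x \<circ> p) = val n v x"
proof (induction n arbitrary: v x)
  case (Suc n)
  let ?V = "val n"
  have inj: "inj p" by (metis p(1) injI)
  have pD: "p ` D = D" and pN: "p ` Nd = Nd"
    using p by (metis image_eqI image_subsetI subsetI subset_antisym)+
  have Dp: "p u \<in> D \<longleftrightarrow> u \<in> D" for u using p by metis
  have reD: "(\<Sum>i\<in>D. f (p i)) = (\<Sum>i\<in>D. f i)" for f :: "'v \<Rightarrow> real"
  proof -
    have "sum f (p ` D) = sum (f \<circ> p) D" by (intro sum.reindex inj_on_subset[OF inj]) simp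
    then show ?thesis by (simp add: pD)
  qed
  have incp: "inc i (x \<circ> p) = inc (p i) x \<circ> p" for i and x :: "'v \<Rightarrow> nat"
    using p(1) by (auto simp: fun_eq_iff dest: injD[OF inj])
  have decp: "dec (p i) (x \<circ> p) = dec i x \<circ> p" for i and x :: "'v \<Rightarrow> nat"
    using p(1) by (auto simp: fun_eq_iff dest: injD[OF inj])
  have base: "base ?V (p v) (x \<circ> p) = base ?V v x"
    unfolding base_def incp Suc.IH using reD[of "\<lambda>i. c * real (x i)"] reD[of "\<lambda>i. l * ?V v (inc i x)"]
    by simp
  have busy: "busy (p v) (x \<circ> p) = busy v x" by (simp add: busy_def Dp p(1))
  have act: "act ?V (p v) (x \<circ> p) (p a) = act ?V v x a" for a
    unfolding act_def busy decp Suc.IH using inj by (auto dest: injD)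
  have "act ?V (p v) (x \<circ> p) ` Nd = act ?V (p v) (x \<circ> p) ` (p ` Nd)" by (simp only: pN)
  also have "\<dots> = act ?V v x ` Nd" unfolding image_image act ..
  finally show ?case unfolding val.simps backup_def base by simp
qed simp

lemma val_move_jobs:
  assumes "w \<in> D" "v \<in> D"
  shows "val n w (y(w := y w + k)) \<le> val n w (y(v := y v + k))"
proof (cases "w = v")
  case False
  show ?thesis
  proof (induction k arbitrary: y)
    case (Suc k)
    have "val n w ((inc w y)(w := inc w y w + k)) \<le> val n w ((inc w y)(v := inc w y v + k))"
      by (rule Suc)
    also have "(inc w y)(v := inc w y v + k) = inc w (y(v := y v + k))"
      using False by (auto simp: fun_eq_iff)
    also have "val n w \<dots> \<le> val n w (inc v (y(v := y v + k)))"
      by (rule goodD(2)[OF good_val]) fact+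
    also have "inc v (y(v := y v + k)) = y(v := y v + Suc k)"
      by (auto simp: fun_eq_iff)
    also have "(inc w y)(w := inc w y w + k) = y(w := y w + Suc k)"
      by (auto simp: fun_eq_iff)
    finally show ?case .
  qed simp
qed simp

text \<open>
  Swapping the labels of \<open>v\<close> and \<open>w\<close> turns the server at the shorter queue into a server at \<open>w\<close> with the
  two queue lengths exchanged. From there, moving the surplus of jobs to the server's queue
  only helps.
\<close>

lemma val_longer_queue:
  assumes w: "w \<in> D" and v: "v \<in> D" and le: "x v \<le> x w"
  shows "val n w x \<le> val n v x"
proof (cases "w = v")
  case wv: False
  define p where "p u = (if u = v then w else if u = w then v else u)" for u
  have "val n (p v) (x \<circ> p) = val n v x"
    using w v sub by (intro val_symmetric) (auto simp: p_def)
  moreover have "p v = w" by (simp add: p_def)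
  moreover define y where "y = x(w := x v)"
  moreover have "y(w := y w + (x w - x v)) = x" "y(v := y v + (x w - x v)) = x \<circ> p"
    using le wv by (auto simp: y_def p_def fun_eq_iff)
  ultimately show ?thesis using val_move_jobs[OF w v, of n y "x w - x v"] by simp
qed simp

theorem val_Suc_greedy:
  assumes v: "v \<in> Nd" and a: "a \<in> Nd"
    and busy: "busy v x \<Longrightarrow> a = v"
    and idle: "\<not> busy v x \<Longrightarrow> a = v \<and> D = {v} \<or> a \<noteq> v \<and> a \<in> D \<and> (\<forall>j\<in>D. x j \<le> x a)"
  shows "val (Suc n) v x = base (val n) v x + act (val n) v x a"
proof -
  let ?V = "val n"
  note V = good_val[of n]
  have "act ?V v x a \<le> act ?V v x b" if b: "b \<in> Nd" for b
  proof (cases "busy v x")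
    case True
    then show ?thesis
      using serve_optimal[where V = ?V and w = v and x = x and a = b, OF V _ _ b] busy
      by (simp add: busy_def)
  next
    case False
    from idle[OF False] show ?thesis
    proof (elim disjE conjE)
      assume av: "a = v" and D: "D = {v}"
      show ?thesis
      proof (cases "b = v")
        case bv: False
        then have "\<tau> * ?V v x \<le> \<tau> * ?V b x" using goodD(4)[OF V, of v b x] b D t0 by simp
        then show ?thesis using bv False av by (simp add: act_def algebra_simps)
      qed (simp add: av)
    next
      assume av: "a \<noteq> v" and aD: "a \<in> D" and max: "\<forall>j\<in>D. x j \<le> x a"
      have le: "\<tau> * ?V a x \<le> \<tau> * ?V u x" if "u \<in> Nd" for u
      proof (cases "u \<in> D")
        case True
        then show ?thesis using val_longer_queue[OF aD True] max t0 by simp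
      next
        case False
        then show ?thesis using goodD(4)[OF V aD that] t0 by simp
      qed
      show ?thesis
      proof (cases "b = v")
        case True
        then show ?thesis using le[OF v] av False by (simp add: act_def algebra_simps)
      next
        case False
        then show ?thesis using le[OF b] av by (simp add: act_def)
      qed
    qed
  qed
  then show ?thesis
    unfolding val.simps backup_def using fin a by (subst Min_eqI[of _ "act ?V v x a"]) auto
qed

end

section \<open>Shortest paths and priority orderings\<close>

lemma before_iff_map_rank:
  assumes "inj_on rk A" "set p \<subseteq> A" "set q \<subseteq> A"
  shows "before rk p q \<longleftrightarrow> map rk p < map rk q"
  using assms(2,3)
proof (induction p arbitrary: q)
  case Nil
  then show ?case by (cases q) (auto simp: before_def list_less_def)
next
  case (Cons a p)
  show ?case
  proof (cases q)
    case (Cons b q')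
    have "rk a = rk b \<longleftrightarrow> a = b"
      using Cons.prems assms(1) \<open>q = b # q'\<close> by (auto dest: inj_onD)
    then show ?thesis
      using Cons.IH[of q'] Cons.prems \<open>q = b # q'\<close> by (auto simp: before_def list_less_def)
  qed (auto simp: before_def list_less_def)
qed

text \<open>
  A score and a lexicographic tie-break select exactly one list. With constant score this is the
  choice of a shortest path; with score \<open>\<psi>\<close> it is the choice of the best sequence.
\<close>

lemma ex1_best:
  fixes f :: "'a list \<Rightarrow> real"
  assumes fin: "finite B" and ne: "B \<noteq> {}" and rk: "inj_on rk A" and sub: "\<And>p. p \<in> B \<Longrightarrow> set p \<subseteq> A"
  shows "\<exists>!q. q \<in> B \<and> (\<forall>p\<in>B. p \<noteq> q \<longrightarrow> f p < f q \<or> f p = f q \<and> before rk q p)"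
proof -
  define C where "C = {q \<in> B. f q = Max (f ` B)}"
  have le: "f p \<le> Max (f ` B)" if "p \<in> B" for p using fin that by simp
  have "Max (f ` B) \<in> f ` B" using fin ne by (intro Max_in) auto
  then have Cne: "C \<noteq> {}" by (auto simp: C_def)
  have Cfin: "finite C" using fin by (simp add: C_def)
  have "Min (map rk ` C) \<in> map rk ` C" using Cfin Cne by (intro Min_in) auto
  then obtain q where q: "q \<in> C" "map rk q = Min (map rk ` C)" by auto
  have inj: "map rk p = map rk p' \<Longrightarrow> p = p'" if "p \<in> B" "p' \<in> B" for p p'
    using rk sub[OF that(1)] sub[OF that(2)]
    by (intro map_inj_on[where f = rk and xs = p]) (auto intro: inj_on_subset)
  show ?thesis
  proof (rule ex1I[of _ q], intro conjI ballI impI)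
    show qB: "q \<in> B" using q by (simp add: C_def)
    fix p assume p: "p \<in> B" "p \<noteq> q"
    show "f p < f q \<or> f p = f q \<and> before rk q p"
    proof (cases "p \<in> C")
      case True
      have "map rk q \<le> map rk p" unfolding q(2) using Cfin True by simp
      moreover have "map rk q \<noteq> map rk p" using inj[OF qB p(1)] p(2) by blast
      ultimately have "before rk q p"
        using before_iff_map_rank[OF rk sub[OF qB] sub[OF p(1)]] by simp
      then show ?thesis using True q(1) by (simp add: C_def)
    next
      case False
      then show ?thesis using le[OF p(1)] p(1) q(1) by (auto simp: C_def)
    qed
  next
    fix q' assume q': "q' \<in> B \<and> (\<forall>p\<in>B. p \<noteq> q' \<longrightarrow> f p < f q' \<or> f p = f q' \<and> before rk q' p)"
    show "q' = q"
    proof (rule ccontr)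
      assume neq: "q' \<noteq> q"
      have qB: "q \<in> B" using q by (simp add: C_def)
      have "f q = Max (f ` B)" using q by (simp add: C_def)
      then have "f q' \<le> f q" using le[of q'] q' by simp
      moreover have "f q < f q' \<or> f q = f q' \<and> before rk q' q" using q' qB neq by auto
      ultimately have eq: "f q = f q'" and "before rk q' q" by auto
      then have "map rk q' < map rk q"
        using before_iff_map_rank[OF rk sub sub[OF qB]] q' by blast
      moreover have "q' \<in> C" using q' q eq by (simp add: C_def)
      then have "map rk q \<le> map rk q'" unfolding q(2) using Cfin by simp
      ultimately show False by simp
    qed
  qed
qed

locale network =
  fixes P :: "'v network"
  assumes valid: "valid_network P"
begin

sublocale pair_graph "graph_of P"
  using valid by (simp add: valid_network_def)

abbreviation "G \<equiv> with_proj (graph_of P)"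

lemma demand_nodes: "i \<in> demand P \<Longrightarrow> i \<in> nodes P"
  and demand_ne: "demand P \<noteq> {}"
  and tau_pos: "0 < tau P"
  using valid by (auto simp: valid_network_def)

lemma finite_demand: "finite (demand P)"
  using demand_nodes pair_finite_verts by (meson finite_subset subsetI)

lemma vwalk_awalk:
  assumes "vwalk p G"
  shows "awalk (hd p) (vwalk_arcs p) (last p) \<and> length (vwalk_arcs p) = length p - 1"
  using assms
proof (induction p rule: vwalk_induct)
  case (Base u)
  then show ?case by (simp add: awalk_Nil_iff)
next
  case (Cons u v es)
  then have "(u, v) \<in> parcs (graph_of P)" by simp
  then have "u \<in> nodes P" by (rule in_arcsD1)
  then show ?case using Cons by (auto simp: awalk_Cons_iff)
qed

lemma awalk_vwalk:
  assumes "awalk u q w"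
  shows "\<exists>p. vwalk p G \<and> hd p = u \<and> last p = w \<and> length p = Suc (length q)"
proof (intro exI conjI)
  show "vwalk (awalk_verts u q) G" using assms by (rule awalk_imp_vwalk)
  show "hd (awalk_verts u q) = u" "last (awalk_verts u q) = w"
    using awhd_of_awalk[OF assms] awlast_of_awalk[OF assms] by (simp_all add: NOMATCH_def)
  show "length (awalk_verts u q) = Suc (length q)" by (rule length_awalk_verts)
qed

lemma awalk_cost_1: "awalk_cost (\<lambda>_. 1) q = real (length q)"
  by (induction q) auto

text \<open>
  The distance is an infimum over arc walks in the extended reals; connectedness makes the set of walks
  nonempty, and a walk with fewest arcs attains the infimum.
\<close>

lemma dist_attained:
  assumes u: "u \<in> nodes P" and w: "w \<in> nodes P"
  shows "\<exists>q. awalk u q w \<and> \<delta> P u w = real (length q) \<and> (\<forall>q'. awalk u q' w \<longrightarrow> length q \<le> length q')"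
proof -
  have "Digraph_Component.connected G" using valid by (simp add: valid_network_def)
  then have "u \<rightarrow>\<^sup>*\<^bsub>with_proj (mk_symmetric G)\<^esub> w"
    using u w by (auto simp: Digraph_Component.connected_def strongly_connected_def)
  then have "u \<rightarrow>\<^sup>*\<^bsub>G\<^esub> w" using reachable_mk_symmetric_eq[OF sym_arcs] by simp
  then obtain q0 where "awalk u q0 w" by (auto simp: reachable_awalk)
  then obtain q where q: "awalk u q w" "\<And>q'. awalk u q' w \<Longrightarrow> length q \<le> length q'"
    using ex_has_least_nat[of "\<lambda>q. awalk u q w" q0 length] by blast
  have "\<mu> (\<lambda>_. 1) u w = ereal (real (length q))"
    unfolding \<mu>_def
  proof (rule INF_eqI)
    show "ereal (real (length q)) \<le> ereal (awalk_cost (\<lambda>_. 1) q')" if "q' \<in> {p. awalk u p w}" for q'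
      using q(2)[of q'] that by (simp add: awalk_cost_1)
    show "y \<le> ereal (real (length q))"
      if "\<And>i. i \<in> {p. awalk u p w} \<Longrightarrow> y \<le> ereal (awalk_cost (\<lambda>_. 1) i)" for y
      using that[of q] q(1) by (simp add: awalk_cost_1)
  qed
  then have "\<delta> P u w = real (length q)" by (simp add: \<delta>_def)
  then show ?thesis using q by blast
qed

lemma dist_le:
  assumes "vwalk p G" "hd p = u" "last p = w"
  shows "\<delta> P u w \<le> real (length p - 1)"
proof -
  have p: "awalk u (vwalk_arcs p) w" "length (vwalk_arcs p) = length p - 1"
    using vwalk_awalk[OF assms(1)] unfolding assms(2,3) by simp_all
  obtain q where q: "awalk u q w \<and> \<delta> P u w = real (length q)
      \<and> (\<forall>q'. awalk u q' w \<longrightarrow> length q \<le> length q')"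
    using dist_attained[OF awalk_hd_in_verts[OF p(1)] awalk_last_in_verts[OF p(1)]] ..
  note q = q[THEN conjunct2, THEN conjunct1] q[THEN conjunct2, THEN conjunct2]
  have "length q \<le> length (vwalk_arcs p)" by (rule q(2)[rule_format, OF p(1)])
  then show ?thesis unfolding q(1) p(2) by (simp only: of_nat_le_iff)
qed

lemma shortest_pathsD:
  assumes "p \<in> shortest_paths P u w"
  shows "vwalk p G" "hd p = u" "last p = w" "\<delta> P u w = real (length p - 1)" "p \<noteq> []"
  using assms by (simp_all add: shortest_paths_def vwalk_def)

lemma shortest_paths_ne:
  assumes "u \<in> nodes P" "w \<in> nodes P"
  shows "shortest_paths P u w \<noteq> {}"
proof -
  obtain q where q: "awalk u q w" "\<delta> P u w = real (length q)" using dist_attained[OF assms] by blast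
  then obtain p where "vwalk p G" "hd p = u" "last p = w" "length p = Suc (length q)"
    using awalk_vwalk by blast
  then have "p \<in> shortest_paths P u w" using q by (simp add: shortest_paths_def)
  then show ?thesis by blast
qed

lemma finite_shortest_paths: "finite (shortest_paths P u w)"
proof (rule finite_subset)
  show "shortest_paths P u w \<subseteq> {p. set p \<subseteq> nodes P \<and> length p \<le> Suc (nat \<lfloor>\<delta> P u w\<rfloor>)}"
  proof
    fix p assume p: "p \<in> shortest_paths P u w"
    have "set p \<subseteq> nodes P" using shortest_pathsD(1)[OF p] by (auto simp: vwalk_def)
    then show "p \<in> {p. set p \<subseteq> nodes P \<and> length p \<le> Suc (nat \<lfloor>\<delta> P u w\<rfloor>)}"
      using shortest_pathsD(4)[OF p] by simp
  qed
  show "finite {p. set p \<subseteq> nodes P \<and> length p \<le> Suc (nat \<lfloor>\<delta> P u w\<rfloor>)}"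
    by (intro finite_lists_length_le) simp
qed

lemma selected_path_shortest:
  assumes "inj_on nrk (nodes P)" "u \<in> nodes P" "w \<in> nodes P"
  shows "selected_path P nrk u w \<in> shortest_paths P u w"
proof -
  have "\<exists>!p. p \<in> shortest_paths P u w \<and>
     (\<forall>p'\<in>shortest_paths P u w. p' \<noteq> p \<longrightarrow> (0::real) < 0 \<or> (0::real) = 0 \<and> before nrk p p')"
    by (rule ex1_best[OF finite_shortest_paths shortest_paths_ne assms(1)])
       (use assms shortest_pathsD(1) in \<open>auto simp: vwalk_def\<close>)
  then have ex1: "\<exists>!p. p \<in> shortest_paths P u w \<and>
     (\<forall>p'\<in>shortest_paths P u w. p' \<noteq> p \<longrightarrow> before nrk p p')" by simp
  show ?thesis unfolding selected_path_def by (rule theI'[OF ex1, THEN conjunct1])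
qed

lemma dist_nonneg: "u \<in> nodes P \<Longrightarrow> w \<in> nodes P \<Longrightarrow> 0 \<le> \<delta> P u w"
proof -
  assume "u \<in> nodes P" "w \<in> nodes P"
  then obtain p where "p \<in> shortest_paths P u w" using shortest_paths_ne by blast
  then have "\<delta> P u w = real (length p - 1)" by (rule shortest_pathsD(4))
  then show "0 \<le> \<delta> P u w" by simp
qed

lemma dist_refl: "u \<in> nodes P \<Longrightarrow> \<delta> P u u = 0"
proof -
  assume u: "u \<in> nodes P"
  then have "vwalk [u] G" by (simp add: vwalk_def)
  then have "\<delta> P u u \<le> 0" using dist_le[of "[u]" u u] by simp
  then show "\<delta> P u u = 0" using dist_nonneg[OF u u] by (rule order_antisym)
qed

lemma dist_ge_1:
  assumes "u \<in> nodes P" "w \<in> nodes P" "u \<noteq> w"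
  shows "1 \<le> \<delta> P u w"
proof -
  obtain p where "p \<in> shortest_paths P u w" using shortest_paths_ne[OF assms(1,2)] by (meson ex_in_conv)
  note p = shortest_pathsD[OF this]
  have "length p \<noteq> 1"
  proof
    assume "length p = 1"
    then obtain a where "p = [a]" by (auto simp: length_Suc_conv)
    with p(2,3) have "u = w" by simp
    with assms(3) show False ..
  qed
  then have "1 \<le> length p - 1" using p(5) by (cases "length p") auto
  then have "1 \<le> real (length p - 1)" by linarith
  then show ?thesis by (simp only: p(4))
qed

lemma first_step:
  assumes p: "p \<in> shortest_paths P u w" and ne: "u \<noteq> w"
  shows "adjacent P u (p ! 1)" "\<delta> P (p ! 1) w = \<delta> P u w - 1"
proof -
  note D = shortest_pathsD[OF p]
  obtain a es where "p = a # es" using D(5) by (cases p) auto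
  with D ne obtain v es' where pe: "p = u # v # es'" by (cases es) auto
  have uv: "(u, v) \<in> parcs (graph_of P)" and walk: "vwalk (v # es') G"
    using D(1) unfolding pe by (auto simp: vwalk_def)
  then show "adjacent P u (p ! 1)" by (simp add: adjacent_def pe)
  have le: "\<delta> P v w \<le> \<delta> P u w - 1"
    using dist_le[OF walk, of v w] D(3,4) by (simp add: pe)
  have nodes: "v \<in> nodes P" "w \<in> nodes P"
    using walk D(1,3) last_in_set[OF D(5)] by (auto simp: vwalk_def)
  then obtain p' where p': "p' \<in> shortest_paths P v w" using shortest_paths_ne by blast
  have "vwalk (u # p') G"
    by (rule vwalk_wf_digraph_consI) (use shortest_pathsD[OF p'] uv in auto)
  then have "\<delta> P u w \<le> real (length (u # p') - 1)"
    by (rule dist_le) (use shortest_pathsD[OF p'] in auto)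
  also have "\<dots> = \<delta> P v w + 1"
    using shortest_pathsD(4,5)[OF p'] by (cases p') auto
  finally show "\<delta> P (p ! 1) w = \<delta> P u w - 1" using le unfolding pe by simp
qed

lemma complete_adjacent:
  assumes "complete_network P"
  shows "adjacent P u w \<longleftrightarrow> u \<in> nodes P \<and> w \<in> nodes P \<and> u \<noteq> w"
proof -
  have eq: "parcs (graph_of P) = {(u, v). (u, v) \<in> nodes P \<times> nodes P \<and> u \<noteq> v}"
    using assms unfolding complete_network_def complete_digraph_pair_def by (elim conjE)
  show ?thesis unfolding adjacent_def eq by simp
qed

lemma complete_dist:
  assumes "complete_network P" "u \<in> nodes P" "w \<in> nodes P" "u \<noteq> w"
  shows "\<delta> P u w = 1"
proof -
  have "(u, w) \<in> parcs (graph_of P)" using complete_adjacent[OF assms(1)] assms by (auto simp: adjacent_def)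
  then have "vwalk [u, w] G" using assms by (auto simp: vwalk_def)
  then have "\<delta> P u w \<le> 1" using dist_le[of "[u, w]" u w] by simp
  then show ?thesis using dist_ge_1[OF assms(2-)] by (rule order_antisym)
qed

end

section \<open>The index quantities of a homogeneous system\<close>

\<comment> \<open>The recursion runs through a sum over the preceding indices; as a rewrite rule it does not end.\<close>
declare Tj.simps [simp del]

locale polling =
  fixes P :: "'v network" and l m c :: real
  assumes valid: "valid_network P"
    and hom: "\<And>i. i \<in> demand P \<Longrightarrow> lam P i = l \<and> mu P i = m \<and> hold P i = c"
begin

lemma is_network: "network P"
  using valid by (rule network.intro)

lemmas demand_nodes = network.demand_nodes[OF is_network]
  and demand_ne = network.demand_ne[OF is_network]
  and tau_pos = network.tau_pos[OF is_network]
  and finite_demand = network.finite_demand[OF is_network]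
  and dist_nonneg = network.dist_nonneg[OF is_network]
  and dist_refl = network.dist_refl[OF is_network]
  and dist_ge_1 = network.dist_ge_1[OF is_network]
  and first_step = network.first_step[OF is_network]
  and selected_path_shortest = network.selected_path_shortest[OF is_network]
  and complete_dist = network.complete_dist[OF is_network]

lemma rates: "0 < l" "l < m" "0 < c" "0 < m"
proof -
  obtain i where "i \<in> demand P" using demand_ne by blast
  then show "0 < l" "l < m" "0 < c" using valid hom[of i] by (auto simp: valid_network_def)
  then show "0 < m" by simp
qed

lemma time_scale: "real (card (demand P)) * l + max (tau P) m = 1"
proof -
  have "mu P ` demand P = {m}" using hom demand_ne by force
  then have "Max (insert (tau P) (mu P ` demand P)) = max (tau P) m" by simp
  moreover have "(\<Sum>i\<in>demand P. lam P i) = real (card (demand P)) * l" using hom by simp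
  ultimately show ?thesis using valid by (simp add: valid_network_def)
qed

lemma traffic_eq: "traffic P = real (card (demand P)) * l / m"
  unfolding traffic_def using hom by simp

text \<open>
  A queue with \<open>n\<close> jobs at time \<open>0\<close> that grows at rate \<open>l\<close> and is served from time \<open>s\<close> on is
  empty at time \<open>s + (n + l s) / (m - l) = g s + n / (m - l)\<close>. This makes \<open>finish x q v e\<close> the time at
  which a fluid server that leaves \<open>v\<close> at time \<open>e\<close> has emptied all queues of \<open>q\<close>, where \<open>x\<close> are the
  queue lengths at time \<open>0\<close>; \<open>travel q v\<close> is the part of this time spent on switching.
\<close>

definition g :: real where
  "g = m / (m - l)"

lemma g_gt_1: "1 < g"
  using rates by (simp add: g_def)

primrec finish :: "('v \<Rightarrow> nat) \<Rightarrow> 'v list \<Rightarrow> 'v \<Rightarrow> real \<Rightarrow> real" where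
  "finish x [] v e = e"
| "finish x (w # q) v e = finish x q w (g * (e + \<delta> P v w / tau P) + real (x w) / (m - l))"

primrec travel :: "'v list \<Rightarrow> 'v \<Rightarrow> real" where
  "travel [] v = 0"
| "travel (w # q) v = \<delta> P v w / tau P + travel q w"

lemma finish_snoc:
  "finish x (q @ [w]) v e
    = g * (finish x q v e + \<delta> P (last (v # q)) w / tau P) + real (x w) / (m - l)"
  by (induction q arbitrary: v e) auto

lemma travel_snoc: "travel (q @ [w]) v = travel q v + \<delta> P (last (v # q)) w / tau P"
  by (induction q arbitrary: v) auto

lemma finish_affine: "finish x q v e = g ^ length q * e + finish x q v 0"
proof (induction q arbitrary: v e)
  case (Cons w q)
  have step: "finish x (w # q) v e
      = g ^ length q * (g * (e + \<delta> P v w / tau P) + real (x w) / (m - l)) + finish x q w 0" for e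
    unfolding finish.simps by (rule Cons.IH)
  show ?case unfolding step by (simp add: algebra_simps)
qed simp

lemma finish_mono:
  assumes "e \<le> e'" "\<And>w. x w \<le> x' w"
  shows "finish x q v e \<le> finish x' q v e'"
  using assms(1)
proof (induction q arbitrary: v e e')
  case (Cons w q)
  show ?case
    unfolding finish.simps using Cons.prems assms(2)[of w] g_gt_1 rates
    by (intro Cons.IH add_mono mult_left_mono divide_right_mono order_refl) auto
qed simp

lemma finish_perturb:
  assumes "e \<le> e' + a" "0 \<le> a" "\<And>w. x w \<le> x' w + 1"
  shows "finish x q v e \<le> finish x' q v e' + g ^ length q * (a + real (length q) / (m - l))"
  using assms(1,2)
proof (induction q arbitrary: v e e' a)
  case (Cons w q)
  have g: "1 < g" and ml: "0 < m - l" using g_gt_1 rates by auto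
  let ?b = "g * a + 1 / (m - l)"
  have b0: "0 \<le> ?b" using g ml Cons.prems by simp
  have "g * (e + \<delta> P v w / tau P) \<le> g * (e' + \<delta> P v w / tau P) + g * a"
    using Cons.prems g by (simp add: distrib_left[symmetric])
  moreover have "real (x w) / (m - l) \<le> real (x' w) / (m - l) + 1 / (m - l)"
    unfolding add_divide_distrib[symmetric] using ml assms(3)[of w] by (intro divide_right_mono) auto
  ultimately have "finish x (w # q) v e
      \<le> finish x' (w # q) v e' + g ^ length q * (?b + real (length q) / (m - l))"
    unfolding finish.simps by (intro Cons.IH b0) linarith
  also have "g ^ length q * (?b + real (length q) / (m - l))
      \<le> g ^ length q * (g * (a + real (length (w # q)) / (m - l)))"
  proof (intro mult_left_mono)
    have "1 * (real (length (w # q)) / (m - l)) \<le> g * (real (length (w # q)) / (m - l))"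
      using g ml by (intro mult_right_mono) auto
    then show "?b + real (length q) / (m - l) \<le> g * (a + real (length (w # q)) / (m - l))"
      by (simp add: distrib_left add_divide_distrib add_ac)
  qed (use g in auto)
  finally show ?case by (simp add: mult_ac)
qed simp

lemma travel_nonneg:
  assumes "v \<in> nodes P" "set q \<subseteq> nodes P"
  shows "0 \<le> travel q v"
  using assms
proof (induction q arbitrary: v)
  case (Cons w q)
  then show ?case using tau_pos dist_nonneg[of v w] by (simp add: add_nonneg_nonneg)
qed simp

lemma finish_gt:
  assumes "0 \<le> e" "v \<in> nodes P" "set q \<subseteq> nodes P" "0 < e + travel q v" "q \<noteq> []"
  shows "e + travel q v < finish x q v e"
proof -
  have ge: "e + travel q v \<le> finish x q v e" if "0 \<le> e" "v \<in> nodes P" "set q \<subseteq> nodes P" for e v q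
    using that
  proof (induction q arbitrary: v e)
    case (Cons w q)
    define s where "s = e + \<delta> P v w / tau P"
    have leg: "0 \<le> s" unfolding s_def using Cons.prems tau_pos dist_nonneg[of v w] by simp
    then have "1 * s \<le> g * s" using g_gt_1 by (intro mult_right_mono) auto
    moreover have "0 \<le> real (x w) / (m - l)" using rates by simp
    ultimately have le: "s \<le> g * s + real (x w) / (m - l)" by linarith
    then have "g * s + real (x w) / (m - l) + travel q w
        \<le> finish x q w (g * s + real (x w) / (m - l))"
      using Cons.prems leg by (intro Cons.IH) auto
    then show ?case unfolding finish.simps travel.simps s_def[symmetric] using le by (simp add: s_def)
  qed simp
  show ?thesis
    using assms
  proof (induction q arbitrary: v e)
    case (Cons w q)
    define s where "s = e + \<delta> P v w / tau P"
    define e' where "e' = g * s + real (x w) / (m - l)"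
    have leg: "0 \<le> s" unfolding s_def using Cons.prems tau_pos dist_nonneg[of v w] by simp
    have xw: "0 \<le> real (x w) / (m - l)" using rates by simp
    have e0: "0 \<le> e'" using leg xw g_gt_1 by (simp add: e'_def)
    have goal: "s + travel q w < finish x q w e'"
    proof (cases "0 < s")
      case True
      then have "1 * s < g * s" using g_gt_1 by (intro mult_strict_right_mono) auto
      then have "s < e'" using xw by (simp add: e'_def)
      then show ?thesis using ge[OF e0, of w q] Cons.prems by simp
    next
      case False
      then have s: "s = 0" using leg by simp
      then have tr: "0 < travel q w" using Cons.prems by (simp add: s_def)
      then have "q \<noteq> []" by auto
      then have "e' + travel q w < finish x q w e'"
        using Cons.IH[OF e0, of w] Cons.prems tr e0 by simp
      then show ?thesis using s e0 by simp
    qed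
    then show ?case by (simp add: e'_def s_def add.assoc)
  qed simp
qed

lemma travel_ge:
  assumes "v \<in> nodes P" "set q \<subseteq> nodes P" "q \<noteq> []" "hd q \<noteq> v"
  shows "1 / tau P \<le> travel q v"
proof -
  obtain w r where q: "q = w # r" using assms(3) by (cases q) auto
  have "1 / tau P \<le> \<delta> P v w / tau P"
    using assms tau_pos dist_ge_1[of v w] q by (intro divide_right_mono) auto
  moreover have "0 \<le> travel r w" using assms q by (intro travel_nonneg) auto
  ultimately show ?thesis using q by simp
qed

lemma nth_in_demand: "set q \<subseteq> demand P \<Longrightarrow> 1 \<le> k \<Longrightarrow> k \<le> length q \<Longrightarrow> (v # q) ! k \<in> demand P"
  by (cases k) auto

lemma last_take:
  assumes "j \<le> length q"
  shows "(v # q) ! j = last (v # take j q)"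
proof (cases j)
  case (Suc i)
  then have "take j q = take i q @ [q ! i]"
    using assms by (simp only: take_Suc_conv_app_nth less_eq_Suc_le)
  then show ?thesis using Suc by simp
qed simp

text \<open>
  The sums in the denominators of the indices are the successive completion times of the fluid server.
\<close>

lemma elapsed:
  assumes q: "set q \<subseteq> demand P" and j: "j \<le> length q"
  shows "t + (\<Sum>k=1..j. leg P v q k + Tj P (v, x) q t k) = finish x (take j q) v t"
  using j
proof (induction j)
  case (Suc j)
  let ?E = "finish x (take j q) v t" and ?L = "leg P v q (Suc j)"
  have IH: "t + (\<Sum>k=1..j. leg P v q k + Tj P (v, x) q t k) = ?E" using Suc by simp
  have i: "q ! j \<in> demand P" using q Suc.prems by auto
  have "{1..<Suc j} = {1..j}" by auto
  then have "Tj P (v, x) q t (Suc j) = (real (x (q ! j)) + l * (?E + ?L)) / (m - l)"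
    unfolding Tj.simps[of P v x q t "Suc j"] using hom[OF i] IH by (simp add: Let_def add.assoc)
  moreover have "y + (n + l * y) / (m - l) = g * y + n / (m - l)" for y n :: real
  proof -
    have "m - l \<noteq> 0" using rates by simp
    then show ?thesis by (simp add: g_def divide_simps) (simp add: algebra_simps)
  qed
  from this[of "?E + ?L" "real (x (q ! j))"]
  have "?E + ?L + (real (x (q ! j)) + l * (?E + ?L)) / (m - l) = g * (?E + ?L) + real (x (q ! j)) / (m - l)" .
  ultimately have "?E + (?L + Tj P (v, x) q t (Suc j)) = g * (?E + ?L) + real (x (q ! j)) / (m - l)"
    by (simp only: add.assoc)
  moreover have "?L = \<delta> P (last (v # take j q)) (q ! j) / tau P"
    using last_take[of j q v] Suc.prems by (simp add: leg_def)
  moreover have "t + (\<Sum>k=1..Suc j. leg P v q k + Tj P (v, x) q t k)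
      = ?E + (?L + Tj P (v, x) q t (Suc j))"
    using IH by simp
  moreover have "take (Suc j) q = take j q @ [q ! j]"
    using Suc.prems by (simp add: take_Suc_conv_app_nth)
  ultimately show ?case by (simp add: finish_snoc)
qed simp

lemma sum_leg: "j \<le> length q \<Longrightarrow> (\<Sum>k=1..j. leg P v q k) = travel (take j q) v"
proof (induction j)
  case (Suc j)
  then show ?case
    using last_take[of j q v] by (simp add: leg_def take_Suc_conv_app_nth travel_snoc)
qed simp

lemma sum_T:
  assumes "set q \<subseteq> demand P"
  shows "(\<Sum>k=1..length q. Tj P (v, x) q t k) = finish x q v t - t - travel q v"
  using elapsed[OF assms, of "length q" t v x] sum_leg[of "length q" q v]
  by (simp add: sum.distrib)

lemma sum_R:
  assumes "set q \<subseteq> demand P" "j \<le> length q"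
  shows "(\<Sum>k=1..j. Rj P (v, x) q t k) = c * m * (\<Sum>k=1..j. Tj P (v, x) q t k)"
  unfolding sum_distrib_left
proof (intro sum.cong refl)
  fix k assume "k \<in> {1..j}"
  then have "(v # q) ! k \<in> demand P" using assms by (intro nth_in_demand) auto
  then show "Rj P (v, x) q t k = c * m * Tj P (v, x) q t k"
    using hom by (simp add: Rj_def Let_def)
qed

lemma psi_eq:
  assumes "set q \<subseteq> demand P"
  shows "\<psi> P (v, x) q t = c * m * (finish x q v t - t - travel q v) / finish x q v t"
  unfolding \<psi>_def fst_conv elapsed[OF assms order_refl] sum_R[OF assms order_refl] sum_T[OF assms]
  by simp

lemma gamma_eq:
  assumes "set q \<subseteq> demand P" "finish x q v t - t - travel q v \<noteq> 0"
  shows "\<gamma> P (v, x) q t = c * m * traffic P"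
  unfolding \<gamma>_def sum_R[OF assms(1) order_refl] sum_T[OF assms(1)] using assms(2) by simp

lemma psi_0:
  assumes "set q \<subseteq> demand P" "0 < finish x q v 0"
  shows "\<psi> P (v, x) q 0 = c * m * (1 - travel q v / finish x q v 0)"
  unfolding psi_eq[OF assms(1)] using assms(2) by (simp add: field_simps)

text \<open>
  By \<open>finish_affine\<close>, \<open>\<psi>\<close> is a quotient of two affine functions of \<open>t\<close>.
\<close>

lemma deriv_psi_le_0:
  assumes "set q \<subseteq> demand P" "0 < finish x q v 0"
  shows "deriv (\<lambda>t. \<psi> P (v, x) q t) 0 \<le> 0 \<longleftrightarrow> g ^ length q * travel q v \<le> finish x q v 0"
proof -
  let ?G = "g ^ length q" and ?E = "finish x q v 0" and ?L = "travel q v"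
  have eq: "(\<lambda>t. \<psi> P (v, x) q t) = (\<lambda>t. c * m * (?G * t + ?E - t - ?L) / (?G * t + ?E))"
    unfolding psi_eq[OF assms(1)] by (subst (1 2) finish_affine) simp
  have "((\<lambda>t. c * m * (?G * t + ?E - t - ?L) / (?G * t + ?E)) has_real_derivative
      c * m * (?G * ?L - ?E) / ?E\<^sup>2) (at 0)"
    using assms(2) by (auto intro!: derivative_eq_intros simp: field_simps power2_eq_square)
  then have D: "deriv (\<lambda>t. \<psi> P (v, x) q t) 0 = (c * m / ?E\<^sup>2) * (?G * ?L - ?E)"
    unfolding eq times_divide_eq_left by (rule DERIV_imp_deriv)
  have "0 < c * m / ?E\<^sup>2" using rates assms(2) by simp
  then have "(c * m / ?E\<^sup>2) * (?G * ?L - ?E) \<le> (c * m / ?E\<^sup>2) * 0 \<longleftrightarrow> ?G * ?L - ?E \<le> 0"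
    by (rule mult_le_cancel_left_pos)
  then show ?thesis unfolding D mult_zero_right diff_le_0_iff_le .
qed

lemma sequencesD:
  assumes "q \<in> sequences P K v"
  shows "set q \<subseteq> demand P" "set q \<subseteq> nodes P" "q \<noteq> []" "hd q \<noteq> v" "distinct q" "length q \<le> K"
  using assms demand_nodes by (auto simp: sequences_def)

lemma finite_sequences: "finite (sequences P K v)"
proof (rule finite_subset)
  show "sequences P K v \<subseteq> {q. set q \<subseteq> demand P \<and> length q \<le> K}" by (auto simp: sequences_def)
qed (rule finite_lists_length_le[OF finite_demand])

lemma sequence_bounds:
  assumes v: "v \<in> nodes P" and q: "q \<in> sequences P K v"
  shows "1 / tau P \<le> travel q v" "0 < travel q v" "travel q v < finish x q v 0" "0 < finish x q v 0"
proof -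
  note Q = sequencesD[OF q]
  show ge: "1 / tau P \<le> travel q v" by (rule travel_ge[OF v Q(2-4)])
  moreover have "0 < 1 / tau P" using tau_pos by simp
  ultimately show tr: "0 < travel q v" by linarith
  show "travel q v < finish x q v 0" using finish_gt[of 0 v q x] v Q(2,3) tr by simp
  with tr show "0 < finish x q v 0" by simp
qed

lemma sigma2'_iff:
  assumes v: "v \<in> nodes P"
  shows "q \<in> \<sigma>\<^sub>2' P K (v, x) \<longleftrightarrow>
    q \<in> sequences P K v \<and> g ^ length q * travel q v \<le> finish x q v 0"
proof (cases "q \<in> sequences P K v")
  case True
  show ?thesis
    unfolding \<sigma>\<^sub>2'_def mem_Collect_eq fst_conv
      deriv_psi_le_0[OF sequencesD(1)[OF True] sequence_bounds(4)[OF v True, of x]] ..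
qed (simp add: \<sigma>\<^sub>2'_def)

text \<open>
  After relocation to \<open>s\<^sub>1\<close> the first leg has length \<open>0\<close>; the second one keeps the travel time positive.
\<close>

lemma relocated_travel:
  assumes "distinct q" "set q \<subseteq> nodes P" "2 \<le> length q"
  shows "0 < travel q (hd q)" "travel q (hd q) < finish x q (hd q) 0"
proof -
  obtain w u r where q: "q = w # u # r" using assms(3) by (cases q; cases "tl q") auto
  have "1 / tau P \<le> travel (u # r) w" using assms q by (intro travel_ge) auto
  moreover have "0 < 1 / tau P" using tau_pos by simp
  ultimately have "0 < travel (u # r) w" by (rule less_le_trans[rotated])
  moreover have "\<delta> P w w = 0" using dist_refl assms q by auto
  ultimately show tr: "0 < travel q (hd q)" using q by simp
  then show "travel q (hd q) < finish x q (hd q) 0"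
    using finish_gt[of 0 "hd q" q x] assms(2) q by simp
qed

lemma sigma1_iff:
  assumes v: "v \<in> nodes P"
  shows "q \<in> \<sigma>\<^sub>1 P K (v, x) \<longleftrightarrow> q \<in> \<sigma>\<^sub>2' P K (v, x) \<and>
    traffic P \<le> 1 - travel q v / finish x q v 0 \<and>
    (2 \<le> length q \<longrightarrow> traffic P \<le> 1 - travel q (hd q) / finish x q (hd q) 0)"
proof (cases "q \<in> \<sigma>\<^sub>2' P K (v, x)")
  case True
  then have s: "q \<in> sequences P K v" by (simp add: \<sigma>\<^sub>2'_def)
  note Q = sequencesD[OF s] and b = sequence_bounds(2)[OF v s] sequence_bounds(3,4)[OF v s, of x]
  have cm: "0 < c * m" using rates by simp
  have T: "finish x q v 0 - 0 - travel q v \<noteq> 0" using b(2) by simp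
  have 1: "\<psi> P (v, x) q 0 \<ge> \<gamma> P (v, x) q 0 \<longleftrightarrow> traffic P \<le> 1 - travel q v / finish x q v 0"
    unfolding psi_0[OF Q(1) b(3)] gamma_eq[OF Q(1) T] by (rule mult_le_cancel_left_pos[OF cm])
  have 2: "\<psi> P (hd q, x) q 0 \<ge> \<gamma> P (hd q, x) q 0
      \<longleftrightarrow> traffic P \<le> 1 - travel q (hd q) / finish x q (hd q) 0" if "2 \<le> length q"
  proof -
    note r = relocated_travel(1)[OF Q(5,2) that] relocated_travel(2)[OF Q(5,2) that, of x]
    have E: "0 < finish x q (hd q) 0" and T: "finish x q (hd q) 0 - 0 - travel q (hd q) \<noteq> 0"
      using r by auto
    show ?thesis
      unfolding psi_0[OF Q(1) E] gamma_eq[OF Q(1) T] by (rule mult_le_cancel_left_pos[OF cm])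
  qed
  have "length q = 1 \<or> 2 \<le> length q" using Q(3) by (cases q; cases "tl q") auto
  then show ?thesis using True 1 2 by (auto simp: \<sigma>\<^sub>1_def Let_def)
qed (simp add: \<sigma>\<^sub>1_def)

text \<open>
  Already \<open>j = 1\<close> fails: \<open>\<beta>\<^sub>1 = c m \<rho> + c m (1 - \<rho>) = c m\<close>, and \<open>\<phi>\<^sub>1\<close> is \<open>c m\<close> times the fraction of a
  round trip that is spent serving.
\<close>

lemma sigma_busy:
  assumes v: "v \<in> demand P" and x: "0 < x v"
  shows "\<sigma> P K (v, x) = {}"
proof -
  have False if q: "q \<in> sequences P K v" and phi: "\<phi> P (v, x) q 0 1 \<ge> \<beta> P (v, x) q 0 1" for q
  proof -
    note Q = sequencesD[OF q]
    obtain w r where qw: "q = w # r" using Q(3) by (cases q) auto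
    have w: "w \<in> demand P" "w \<noteq> v" using Q qw by auto
    have vN: "v \<in> nodes P" and wN: "w \<in> nodes P" using v w demand_nodes by auto
    define T where "T = Tj P (v, x) q 0 1"
    define L where "L = leg P v q 1"
    have L: "0 < L" unfolding L_def leg_def using qw dist_ge_1[OF vN wN] w tau_pos by simp
    have "L + T = g * L + real (x w) / (m - l)"
      using elapsed[of q 1 0 v x] Q(1) qw by (simp add: L_def T_def leg_def)
    moreover have "1 * L < g * L" using L g_gt_1 by (intro mult_strict_right_mono) auto
    moreover have "0 \<le> real (x w) / (m - l)" using rates by simp
    ultimately have T: "0 < T" by linarith
    have R: "(\<Sum>k=1..1. Rj P (v, x) q 0 k) = c * m * T"
      using sum_R[of q 1 v x 0] Q(1) qw by (simp add: T_def)
    have "\<phi> P (v, x) q 0 1 = c * m * T / (L + T + \<delta> P w v / tau P)"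
      unfolding \<phi>_def R using qw by (simp add: T_def L_def)
    also have "\<dots> < c * m"
    proof -
      have "0 \<le> \<delta> P w v / tau P" using dist_nonneg[OF wN vN] tau_pos by simp
      then have "0 < L + T + \<delta> P w v / tau P" "T < L + T + \<delta> P w v / tau P" using L T by auto
      moreover have "0 < c * m" using rates by simp
      ultimately show ?thesis by (simp add: pos_divide_less_eq mult_strict_left_mono del: mult_less_cancel_left_pos)
    qed
    also have "\<beta> P (v, x) q 0 1 = c * m"
    proof -
      have "\<beta> P (v, x) q 0 1 = c * m * T / T * traffic P + c * m * (1 - traffic P)"
        unfolding \<beta>_def R using qw w hom[OF v] by (simp add: T_def)
      then show ?thesis using T by (simp add: algebra_simps)
    qed
    ultimately show False using phi by simp
  qed
  then show ?thesis
    using v x by (auto simp: \<sigma>_def sequences_def) (metis One_nat_def atLeastAtMost_iff order_refl)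
qed

lemma sigma_idle:
  assumes "\<not> (v \<in> demand P \<and> 0 < x v)"
  shows "\<sigma> P K (v, x) = (if \<sigma>\<^sub>1 P K (v, x) \<noteq> {} then \<sigma>\<^sub>1 P K (v, x) else \<sigma>\<^sub>2' P K (v, x))"
  using assms by (auto simp: \<sigma>_def \<sigma>\<^sub>2_def)

lemma sigma_subset: "\<sigma> P K (v, x) \<subseteq> sequences P K v"
  by (auto simp: \<sigma>_def \<sigma>\<^sub>2_def \<sigma>\<^sub>1_def \<sigma>\<^sub>2'_def)

lemma best_sequence:
  assumes rk: "inj_on drk (demand P)" and ne: "\<sigma> P K (v, x) \<noteq> {}" and v: "v \<in> nodes P"
  defines "b \<equiv> best_sequence P drk K (v, x)"
  shows "b \<in> \<sigma> P K (v, x)"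
    and "\<And>q. q \<in> \<sigma> P K (v, x) \<Longrightarrow> finish x q v 0 * travel b v \<le> finish x b v 0 * travel q v"
proof -
  have "\<exists>!q. q \<in> \<sigma> P K (v, x) \<and> (\<forall>p\<in>\<sigma> P K (v, x). p \<noteq> q \<longrightarrow>
      \<psi> P (v, x) p 0 < \<psi> P (v, x) q 0 \<or> \<psi> P (v, x) p 0 = \<psi> P (v, x) q 0 \<and> before drk q p)"
    by (rule ex1_best[OF finite_subset[OF sigma_subset finite_sequences] ne rk])
       (use sigma_subset sequencesD(1) in blast)
  from theI'[OF this] have b: "b \<in> \<sigma> P K (v, x)"
    and best: "\<And>p. p \<in> \<sigma> P K (v, x) \<Longrightarrow> \<psi> P (v, x) p 0 \<le> \<psi> P (v, x) b 0"
    unfolding b_def best_sequence_def by (blast, fastforce)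
  show "b \<in> \<sigma> P K (v, x)" by (rule b)
  fix q assume q: "q \<in> \<sigma> P K (v, x)"
  have sb: "b \<in> sequences P K v" and sq: "q \<in> sequences P K v" using b q sigma_subset by auto
  note bb = sequence_bounds(3,4)[OF v sb, of x] and bq = sequence_bounds(3,4)[OF v sq, of x]
  have "0 < c * m" using rates by simp
  then have "1 - travel q v / finish x q v 0 \<le> 1 - travel b v / finish x b v 0"
    using best[OF q]
    unfolding psi_0[OF sequencesD(1)[OF sq] bq(2)] psi_0[OF sequencesD(1)[OF sb] bb(2)]
    by (rule mult_le_cancel_left_pos[THEN iffD1])
  then have "travel b v / finish x b v 0 \<le> travel q v / finish x q v 0" by simp
  then show "finish x q v 0 * travel b v \<le> finish x b v 0 * travel q v"
    using bb bq by (simp add: divide_le_eq field_simps)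
qed

lemma K_stop_stay:
  "\<sigma> P K (v, x) = {} \<Longrightarrow> K_stop_action P drk nrk K (v, x) = v"
  by (simp add: K_stop_action_def)

lemma K_stop_move:
  assumes drk: "inj_on drk (demand P)" and nrk: "inj_on nrk (nodes P)"
    and ne: "\<sigma> P K (v, x) \<noteq> {}" and v: "v \<in> nodes P"
  defines "a \<equiv> K_stop_action P drk nrk K (v, x)" and "w \<equiv> hd (best_sequence P drk K (v, x))"
  shows "adjacent P v a" "\<delta> P a w = \<delta> P v w - 1" "w \<in> demand P" "w \<noteq> v"
proof -
  have "best_sequence P drk K (v, x) \<in> sequences P K v"
    using best_sequence(1)[OF drk ne v] sigma_subset by blast
  note Q = sequencesD[OF this]
  show w: "w \<in> demand P" "w \<noteq> v" using Q(1,3,4) by (auto simp: w_def)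
  have "selected_path P nrk v w \<in> shortest_paths P v w"
    using w(1) demand_nodes by (intro selected_path_shortest[OF nrk v]) auto
  note step = first_step[OF this w(2)[symmetric]]
  have "a = selected_path P nrk v w ! 1" using ne by (simp add: a_def w_def K_stop_action_def)
  then show "adjacent P v a" "\<delta> P a w = \<delta> P v w - 1" using step by auto
qed

end

section \<open>Optimality on a complete graph\<close>

context polling begin

lemma finite_nodes: "finite (nodes P)"
proof -
  interpret network P by (rule is_network)
  show ?thesis by (rule pair_finite_verts)
qed

text \<open>
  By the time scaling this is \<open>max \<tau> \<mu>\<close>, the total rate that is left for the server's events.
\<close>

definition idle_rate :: real where
  "idle_rate = 1 - real (card (demand P)) * l"

lemma idle_rate_eq: "idle_rate = max (tau P) m"
  using time_scale by (simp add: idle_rate_def)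

sublocale dp: symmetric_polling "nodes P" "demand P" l m "tau P" c idle_rate
  by unfold_locales
     (use finite_nodes demand_nodes demand_ne rates tau_pos in \<open>auto simp: idle_rate_eq\<close>)

lemma busy_iff: "dp.busy v x \<longleftrightarrow> v \<in> demand P \<and> 0 < x v"
  by (simp add: dp.busy_def)

lemma not_adjacent_self: "\<not> adjacent P v v"
proof -
  interpret network P by (rule is_network)
  show ?thesis using pair_no_loops by (force simp: adjacent_def)
qed

lemma adjacent_nodes: "adjacent P v w \<Longrightarrow> v \<in> nodes P \<and> w \<in> nodes P"
proof -
  interpret network P by (rule is_network)
  show "adjacent P v w \<Longrightarrow> v \<in> nodes P \<and> w \<in> nodes P"
    using in_arcsD1 in_arcsD2 unfolding adjacent_def by blast
qed

definition targets :: "'v \<Rightarrow> ('v \<Rightarrow> nat) \<Rightarrow> 'v \<Rightarrow> 'v state set" where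
  "targets v x a = (\<lambda>i. (v, inc i x)) ` demand P \<union> {(v, dec v x), (a, x), (v, x)}"

lemma finite_targets: "finite (targets v x a)"
  unfolding targets_def using finite_demand by simp

lemma trans_prob_eq:
  "trans_prob P (v, x) a z =
     (\<Sum>i\<in>demand P. l * of_bool (z = (v, inc i x)))
     + m * of_bool (a = v \<and> dp.busy v x) * of_bool (z = (v, dec v x))
     + tau P * of_bool (adjacent P v a) * of_bool (z = (a, x))
     + (idle_rate - m * of_bool (a = v \<and> dp.busy v x) - tau P * of_bool (adjacent P v a))
       * of_bool (z = (v, x))"
proof -
  have "(\<Sum>i\<in>demand P. lam P i) = real (card (demand P)) * l" using hom by simp
  moreover have "(\<Sum>i\<in>demand P. lam P i * of_bool (z = (v, x(i := x i + 1))))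
      = (\<Sum>i\<in>demand P. l * of_bool (z = (v, inc i x)))"
    using hom by (simp add: inc_def)
  moreover have "mu P v * of_bool (served P (v, x) a) = m * of_bool (a = v \<and> dp.busy v x)"
    using hom[of v] by (auto simp: served_def busy_iff)
  ultimately show ?thesis
    unfolding trans_prob_def prod.case idle_rate_def by (simp add: dec_def)
qed

lemma set_transition: "set_pmf (transition P (v, x) a) \<subseteq> targets v x a"
proof
  fix z assume "z \<in> set_pmf (transition P (v, x) a)"
  then have "trans_prob P (v, x) a z \<noteq> 0"
    using pmf_transition[OF valid, of "(v, x)" a z] by (simp add: set_pmf_iff)
  then show "z \<in> targets v x a"
    unfolding trans_prob_eq targets_def
    by (cases "\<exists>i\<in>demand P. z = (v, inc i x)") (auto split: if_splits)
qed

lemma finite_set_transition: "finite (set_pmf (transition P s a))"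
  by (cases s) (metis finite_subset set_transition finite_targets)

lemma expectation_transition:
  fixes f :: "'v state \<Rightarrow> real"
  shows "measure_pmf.expectation (transition P (v, x) a) f =
     (\<Sum>i\<in>demand P. l * f (v, inc i x))
     + m * of_bool (a = v \<and> dp.busy v x) * f (v, dec v x)
     + tau P * of_bool (adjacent P v a) * f (a, x)
     + (idle_rate - m * of_bool (a = v \<and> dp.busy v x) - tau P * of_bool (adjacent P v a)) * f (v, x)"
proof -
  let ?A = "targets v x a"
  have pt: "(\<Sum>z\<in>?A. k * of_bool (z = y) * f z) = k * f y" if "y \<in> ?A" for k y
  proof -
    have "(\<Sum>z\<in>?A. k * of_bool (z = y) * f z) = (\<Sum>z\<in>?A. if z = y then k * f z else 0)"
      by (intro sum.cong) auto
    then show ?thesis using that finite_targets by simp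
  qed
  have "measure_pmf.expectation (transition P (v, x) a) f
      = (\<Sum>z\<in>?A. trans_prob P (v, x) a z * f z)"
    using set_transition[of v x a] finite_targets[of v x a] pmf_transition[OF valid]
    by (subst integral_measure_pmf[of ?A]) auto
  also have "\<dots> = (\<Sum>z\<in>?A. \<Sum>i\<in>demand P. l * of_bool (z = (v, inc i x)) * f z)
     + m * of_bool (a = v \<and> dp.busy v x) * f (v, dec v x)
     + tau P * of_bool (adjacent P v a) * f (a, x)
     + (idle_rate - m * of_bool (a = v \<and> dp.busy v x) - tau P * of_bool (adjacent P v a)) * f (v, x)"
    unfolding trans_prob_eq distrib_right sum.distrib sum_distrib_right
    by (subst (1 2 3) pt) (auto simp: targets_def)
  also have "(\<Sum>z\<in>?A. \<Sum>i\<in>demand P. l * of_bool (z = (v, inc i x)) * f z)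
      = (\<Sum>i\<in>demand P. \<Sum>z\<in>?A. l * of_bool (z = (v, inc i x)) * f z)"
    by (rule sum.swap)
  also have "\<dots> = (\<Sum>i\<in>demand P. l * f (v, inc i x))"
    by (intro sum.cong refl pt) (auto simp: targets_def)
  finally show ?thesis .
qed

lemma nn_integral_transition:
  fixes f :: "'v state \<Rightarrow> real"
  assumes "\<And>z. z \<in> set_pmf (transition P s a) \<Longrightarrow> 0 \<le> f z"
  shows "(\<integral>\<^sup>+z. ennreal (f z) \<partial>measure_pmf (transition P s a))
    = ennreal (measure_pmf.expectation (transition P s a) f)"
  using assms
  by (intro nn_integral_eq_integral integrable_measure_pmf_finite finite_set_transition)
     (simp add: AE_measure_pmf_iff)

lemma transition_states:
  assumes "s \<in> states P" "a \<in> actions P s"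
  shows "set_pmf (transition P s a) \<subseteq> states P"
proof -
  obtain v x where s: "s = (v, x)" by (cases s)
  have "targets v x a \<subseteq> states P"
    using assms s adjacent_nodes by (auto simp: targets_def states_def actions_def)
  then show ?thesis using set_transition[of v x a] s by blast
qed

lemma cost_eq: "cost P (v, x) = (\<Sum>i\<in>demand P. c * real (x i))"
  unfolding cost_def using hom by simp

lemma cost_nonneg: "0 \<le> cost P s"
  using rates by (cases s) (auto simp: cost_eq intro!: sum_nonneg)

lemma sum_cost_nonneg: "0 \<le> (\<Sum>(u, a)\<leftarrow>h. cost P u)"
  using cost_nonneg by (intro sum_list_nonneg) auto

lemma admissible_K_stop:
  assumes "inj_on drk (demand P)" "inj_on nrk (nodes P)"
  shows "admissible P (K_stop_policy P drk nrk K)"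
proof -
  have "K_stop_action P drk nrk K s \<in> actions P s" if "s \<in> states P" for s
  proof -
    obtain v x where s: "s = (v, x)" by (cases s)
    have "v \<in> nodes P" using that s by (simp add: states_def)
    then show ?thesis
      using K_stop_stay K_stop_move(1)[OF assms] s
      by (cases "\<sigma> P K (v, x) = {}") (auto simp: actions_def)
  qed
  then show ?thesis by (simp add: admissible_def K_stop_policy_def)
qed

definition value_at :: "nat \<Rightarrow> 'v state \<Rightarrow> real" where
  "value_at n s = dp.val n (fst s) (snd s)"

lemma value_at_nonneg: "s \<in> states P \<Longrightarrow> 0 \<le> value_at n s"
  unfolding value_at_def by (rule dp.val_nonneg) (auto simp: states_def)

lemma run_states:
  assumes "admissible P \<theta>" "s \<in> states P" "(h, y) \<in> set_pmf (run P \<theta> s n)"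
  shows "y \<in> states P"
  using assms(3)
proof (induction n arbitrary: h y)
  case 0
  then show ?case using assms(2) by simp
next
  case (Suc n)
  then obtain h' y' a where 1: "(h', y') \<in> set_pmf (run P \<theta> s n)" and a: "a \<in> set_pmf (\<theta> h' y')"
    and y: "y \<in> set_pmf (transition P y' a)"
    by auto
  have y': "y' \<in> states P" by (rule Suc.IH[OF 1])
  then have "a \<in> actions P y'" using assms(1) a by (auto simp: admissible_def)
  then show ?case using transition_states[OF y'] y by blast
qed

text \<open>
  The expected cost of following \<open>\<theta>\<close> for \<open>n\<close> steps and continuing for \<open>T - n\<close> steps with the optimal cost
  on the complete graph over the same nodes. It interpolates between this optimal cost at \<open>n = 0\<close> and
  the cost of \<open>\<theta>\<close> at \<open>n = T\<close>. The optimality equation makes it nondecreasing in \<open>n\<close> and, on a complete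
  graph, constant for the \<open>K\<close>-stop policy.
\<close>

definition mixed_cost :: "'v policy \<Rightarrow> 'v state \<Rightarrow> nat \<Rightarrow> nat \<Rightarrow> ennreal" where
  "mixed_cost \<theta> s T n = (\<integral>\<^sup>+(h, y). ennreal (\<Sum>(u, a)\<leftarrow>h. cost P u) + ennreal (value_at (T - n) y)
     \<partial>measure_pmf (run P \<theta> s n))"

lemma mixed_cost_0: "mixed_cost \<theta> s T 0 = ennreal (value_at T s)"
  by (simp add: mixed_cost_def)

lemma mixed_cost_T: "mixed_cost \<theta> s T T = expected_cost P \<theta> s T"
  by (simp add: mixed_cost_def expected_cost_def value_at_def)

definition one_step :: "nat \<Rightarrow> 'v state \<Rightarrow> 'v \<Rightarrow> ennreal" where
  "one_step n y a = ennreal (cost P y)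
     + (\<integral>\<^sup>+z. ennreal (value_at n z) \<partial>measure_pmf (transition P y a))"

lemma mixed_cost_Suc:
  "mixed_cost \<theta> s T (Suc n) = (\<integral>\<^sup>+(h, y). ennreal (\<Sum>(u, a)\<leftarrow>h. cost P u)
     + (\<integral>\<^sup>+a. one_step (T - Suc n) y a \<partial>measure_pmf (\<theta> h y)) \<partial>measure_pmf (run P \<theta> s n))"
proof -
  have eq: "ennreal (\<Sum>(u, b)\<leftarrow>h @ [(y, a)]. cost P u)
      = ennreal (\<Sum>(u, b)\<leftarrow>h. cost P u) + ennreal (cost P y)" for h y a
    using cost_nonneg sum_cost_nonneg[of h] by (simp add: ennreal_plus)
  have "(\<integral>\<^sup>+z. ennreal (\<Sum>(u, b)\<leftarrow>h @ [(y, a)]. cost P u) + ennreal (value_at (T - Suc n) z)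
        \<partial>measure_pmf (transition P y a))
      = ennreal (\<Sum>(u, b)\<leftarrow>h. cost P u) + one_step (T - Suc n) y a" for h y a
    unfolding eq one_step_def by (simp add: nn_integral_add add.assoc)
  then show ?thesis
    unfolding mixed_cost_def
    by (simp add: split_beta' nn_integral_add del: map_append sum_list.append sum_list_append)
qed

lemma one_step_eq:
  assumes s: "(v, x) \<in> states P" and a: "a \<in> actions P (v, x)"
  shows "one_step n (v, x) a = ennreal (dp.base (dp.val n) v x + dp.act (dp.val n) v x a)"
proof -
  have v: "v \<in> nodes P" using s by (simp add: states_def)
  have adj: "adjacent P v a \<longleftrightarrow> a \<noteq> v"
    using a not_adjacent_self by (auto simp: actions_def)
  have "0 \<le> value_at n z" if "z \<in> set_pmf (transition P (v, x) a)" for z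
    using transition_states[OF s a] that value_at_nonneg by blast
  note nn = nn_integral_transition[OF this]
  let ?E = "measure_pmf.expectation (transition P (v, x) a) (value_at n)"
  have "0 \<le> ?E"
    using transition_states[OF s a] value_at_nonneg
    by (intro integral_nonneg_AE AE_pmfI) blast
  then have "one_step n (v, x) a = ennreal (cost P (v, x) + ?E)"
    using cost_nonneg by (simp add: one_step_def nn ennreal_plus)
  also have "cost P (v, x) + ?E = dp.base (dp.val n) v x + dp.act (dp.val n) v x a"
    unfolding expectation_transition adj cost_eq dp.base_def dp.act_def value_at_def
    by (auto simp: algebra_simps)
  finally show ?thesis .
qed

lemma value_le_one_step:
  assumes s: "s \<in> states P" and a: "a \<in> actions P s"
  shows "ennreal (value_at (Suc n) s) \<le> one_step n s a"
proof -
  obtain v x where vx: "s = (v, x)" by (cases s)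
  have "a \<in> nodes P" using s a adjacent_nodes by (auto simp: vx states_def actions_def)
  then show ?thesis
    using one_step_eq[OF s[unfolded vx] a[unfolded vx]] dp.backup_le
    by (simp add: vx value_at_def ennreal_leI)
qed

text \<open>
  The finishing time of the fluid server when all legs have length one: only the order of the queue
  lengths matters.
\<close>

primrec uniform_finish :: "nat list \<Rightarrow> real \<Rightarrow> real" where
  "uniform_finish [] e = e"
| "uniform_finish (k # ks) e = uniform_finish ks (g * (e + 1 / tau P) + real k / (m - l))"

lemma uniform_finish_append: "uniform_finish (ks @ ks') e = uniform_finish ks' (uniform_finish ks e)"
  by (induction ks arbitrary: e) auto

lemma uniform_finish_shift: "uniform_finish ks (e + d) = uniform_finish ks e + g ^ length ks * d"
proof (induction ks arbitrary: e d)
  case (Cons k ks)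
  have "uniform_finish (k # ks) (e + d)
      = uniform_finish ks ((g * (e + 1 / tau P) + real k / (m - l)) + g * d)"
    by (simp add: algebra_simps)
  also have "\<dots> = uniform_finish ks (g * (e + 1 / tau P) + real k / (m - l)) + g ^ length ks * (g * d)"
    by (rule Cons)
  also have "\<dots> = uniform_finish (k # ks) e + g ^ length (k # ks) * d" by simp
  finally show ?case .
qed simp

lemma uniform_finish_strict: "e < e' \<Longrightarrow> uniform_finish ks e < uniform_finish ks e'"
  using uniform_finish_shift[of ks e "e' - e"] g_gt_1 by simp

text \<open>
  Serving \<open>k - i\<close> additional jobs before \<open>ks\<close> rather than after it prolongs the time until \<open>ks\<close> is
  finished, and everything that accumulates meanwhile has to be served as well.
\<close>

lemma uniform_finish_exchange:
  assumes "i < k"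
  shows "uniform_finish (ks @ k # ks') e
    < uniform_finish (ks @ i # ks') (e + (real k - real i) / (m - l))"
proof -
  let ?d = "(real k - real i) / (m - l)" and ?f = "uniform_finish ks e"
  have d: "0 < ?d" using assms rates by simp
  have "1 * ?d < g ^ Suc (length ks) * ?d"
    using g_gt_1 d by (intro mult_strict_right_mono one_less_power) auto
  then have "g * (?f + 1 / tau P) + real k / (m - l)
      < g * (uniform_finish ks (e + ?d) + 1 / tau P) + real i / (m - l)"
    unfolding uniform_finish_shift by (simp add: algebra_simps diff_divide_distrib)
  then show ?thesis
    unfolding uniform_finish_append uniform_finish.simps by (rule uniform_finish_strict)
qed

lemma complete_tour:
  assumes cn: "complete_network P" and "v \<in> nodes P" "set q \<subseteq> nodes P" "distinct q"
    and "q \<noteq> [] \<Longrightarrow> hd q \<noteq> v"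
  shows "finish x q v e = uniform_finish (map x q) e" "travel q v = real (length q) / tau P"
  using assms(2-)
proof (induction q arbitrary: v e)
  case (Cons w q)
  {
    case 1
    have "\<delta> P v w = 1" using 1 by (intro complete_dist[OF cn]) auto
    moreover have "finish x q w e' = uniform_finish (map x q) e'" for e'
      using 1 by (intro Cons.IH) (cases q; auto)+
    ultimately show ?case by simp
  next
    case 2
    have "\<delta> P v w = 1" using 2 by (intro complete_dist[OF cn]) auto
    moreover have "travel q w = real (length q) / tau P"
      using 2 by (intro Cons.IH) (cases q; auto)+
    ultimately show ?case by (simp add: add_divide_distrib)
  }
qed auto

text \<open>
  Either \<open>j\<close> replaces \<open>w\<close>, or the two exchange their positions. The additional jobs in front show as a
  later start \<open>e\<close> of the remaining tour.
\<close>

lemma longer_queue_first: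
  assumes b: "w # r \<in> sequences P K v" and j: "j \<in> demand P" "j \<noteq> v" "x w < x j"
  shows "\<exists>r'. j # r' \<in> sequences P K v \<and> length r' = length r \<and>
    (\<forall>e. uniform_finish (map x r) e
      < uniform_finish (map x r') (e + (real (x j) - real (x w)) / (m - l)))"
proof (cases "j \<in> set r")
  case False
  have "0 < (real (x j) - real (x w)) / (m - l)" using j rates by simp
  moreover have "j # r \<in> sequences P K v" using b j False by (auto simp: sequences_def)
  ultimately show ?thesis
    by (intro exI[of _ r]) (auto intro: uniform_finish_strict)
next
  case True
  then obtain r1 r2 where r: "r = r1 @ j # r2" by (auto simp: in_set_conv_decomp)
  have "j # r1 @ w # r2 \<in> sequences P K v" using b j r by (auto simp: sequences_def)
  then show ?thesis
    using uniform_finish_exchange[OF j(3), of "map x r1" "map x r2"]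
    by (intro exI[of _ "r1 @ w # r2"]) (auto simp: r)
qed

text \<open>
  At an idle server, all conditions that define \<open>\<sigma>\<close> are lower bounds on finishing times for given travel times.
\<close>

lemma sigma_exchange:
  assumes v: "v \<in> nodes P" and b: "b \<in> \<sigma> P K (v, x)" and idle: "\<not> (v \<in> demand P \<and> 0 < x v)"
    and b': "b' \<in> sequences P K v" and len: "length b' = length b" and tr: "travel b' v = travel b v"
    and fin: "finish x b v 0 \<le> finish x b' v 0"
    and reloc: "2 \<le> length b \<Longrightarrow> travel b' (hd b') = travel b (hd b) \<and>
      finish x b (hd b) 0 \<le> finish x b' (hd b') 0"
  shows "b' \<in> \<sigma> P K (v, x)"
proof -
  have bs: "b \<in> sequences P K v" using b sigma_subset by blast
  have s2: "b' \<in> \<sigma>\<^sub>2' P K (v, x)" if "b \<in> \<sigma>\<^sub>2' P K (v, x)"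
    using that b' fin unfolding sigma2'_iff[OF v] len tr by auto
  have le: "1 - L / E \<le> 1 - L / E'" if "0 < E" "E \<le> E'" "0 < L" for L E E' :: real
    using that by (simp add: divide_left_mono)
  have s1: "b' \<in> \<sigma>\<^sub>1 P K (v, x)" if b1: "b \<in> \<sigma>\<^sub>1 P K (v, x)"
    unfolding sigma1_iff[OF v] len tr
  proof (intro conjI impI)
    note B = b1[unfolded sigma1_iff[OF v]]
    show "b' \<in> \<sigma>\<^sub>2' P K (v, x)" using s2 B by blast
    show "traffic P \<le> 1 - travel b v / finish x b' v 0"
      using B le[OF sequence_bounds(4)[OF v bs] fin sequence_bounds(2)[OF v bs]] by linarith
    assume two: "2 \<le> length b"
    note Q = sequencesD[OF bs]
    have "0 < travel b (hd b)" "0 < finish x b (hd b) 0"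
      using relocated_travel(1)[OF Q(5,2) two] relocated_travel(2)[OF Q(5,2) two, of x] by auto
    then show "traffic P \<le> 1 - travel b' (hd b') / finish x b' (hd b') 0"
      using B two reloc[OF two] le[of "finish x b (hd b) 0" "finish x b' (hd b') 0" "travel b (hd b)"]
      by auto
  qed
  show ?thesis
    using b s1 s2 unfolding sigma_idle[where v = v and x = x, OF idle] by (auto split: if_splits)
qed

text \<open>
  If some queue were longer than the one at \<open>s\<^sub>1\<^sup>*\<close>, visiting it first would give an admissible sequence
  with the same travel time and a larger finishing time, hence a larger \<open>\<psi>\<close>.
\<close>

lemma K_stop_greedy:
  assumes cn: "complete_network P" and K: "K \<ge> 1"
    and rk: "inj_on drk (demand P)" "inj_on nrk (nodes P)"
    and v: "v \<in> nodes P" and idle: "\<not> (v \<in> demand P \<and> 0 < x v)"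
  defines "a \<equiv> K_stop_action P drk nrk K (v, x)"
  shows "a = v \<and> demand P = {v} \<or> a \<noteq> v \<and> a \<in> demand P \<and> (\<forall>j\<in>demand P. x j \<le> x a)"
proof (cases "\<sigma> P K (v, x) = {}")
  case True
  have "w = v" if w: "w \<in> demand P" for w
  proof (rule ccontr)
    assume "w \<noteq> v"
    then have "[w] \<in> sequences P K v" using w K by (auto simp: sequences_def)
    then have "[w] \<in> \<sigma>\<^sub>2' P K (v, x)" using rates by (simp add: sigma2'_iff[OF v])
    then show False using True unfolding sigma_idle[where v = v and x = x, OF idle] by (auto split: if_splits)
  qed
  then have "demand P = {v}" using demand_ne by blast
  then show ?thesis using True by (simp add: a_def K_stop_stay)
next
  case False
  define b where "b = best_sequence P drk K (v, x)"
  note best = best_sequence[OF rk(1) False v, folded b_def]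
  note move = K_stop_move[OF rk False v, folded b_def a_def]
  have bs: "b \<in> sequences P K v" using best(1) sigma_subset by blast
  note Q = sequencesD[OF bs]
  obtain w r where wr: "b = w # r" using Q(3) by (cases b) auto
  have "a \<in> nodes P" using adjacent_nodes move(1) by blast
  moreover have "\<delta> P v w = 1"
    using move demand_nodes v wr by (intro complete_dist[OF cn]) auto
  then have "\<delta> P a w = 0" using move(2) wr by simp
  ultimately have aw: "a = w" using dist_ge_1[of a w] move(3) demand_nodes wr by force
  have wD: "w \<in> demand P" "w \<noteq> v" and wN: "w \<in> nodes P" using move(3,4) wr demand_nodes by auto
  have "x j \<le> x w" if j: "j \<in> demand P" for j
  proof (rule ccontr)
    assume "\<not> x j \<le> x w"
    then have lt: "x w < x j" by simp
    then have jv: "j \<noteq> v" using idle j by auto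
    obtain r' where r': "j # r' \<in> sequences P K v" "length r' = length r"
      and gt: "\<And>e. uniform_finish (map x r) e
        < uniform_finish (map x r') (e + (real (x j) - real (x w)) / (m - l))"
      using longer_queue_first[where x = x, OF bs[unfolded wr] j jv lt] by blast
    note Q' = sequencesD[OF r'(1)]
    have jN: "j \<in> nodes P" using j demand_nodes by blast
    have tl_hd: "q \<noteq> [] \<Longrightarrow> hd q \<noteq> u" if "distinct (u # q)" for u :: 'v and q
      using that by (cases q) auto
    have tb: "finish x b v 0 = uniform_finish (map x b) 0" "travel b v = real (length b) / tau P"
      by (rule complete_tour[OF cn v Q(2,5)]; use Q(4) in simp)+
    have tj: "finish x (j # r') v 0 = uniform_finish (map x (j # r')) 0"
        "travel (j # r') v = real (length (j # r')) / tau P"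
      by (rule complete_tour[OF cn v Q'(2,5)]; use Q'(4) in simp)+
    have rb: "finish x r w e = uniform_finish (map x r) e" "travel r w = real (length r) / tau P" for e
      using Q(2,5) tl_hd[of w r] unfolding wr by (intro complete_tour[OF cn wN]; simp)+
    have rj: "finish x r' j e = uniform_finish (map x r') e" "travel r' j = real (length r') / tau P" for e
      using Q'(2,5) tl_hd[of j r'] by (intro complete_tour[OF cn jN]; simp)+
    have tr: "travel (j # r') v = travel b v" using tb tj r'(2) wr by simp
    have fin: "finish x b v 0 < finish x (j # r') v 0"
      using gt[of "g * (1 / tau P) + real (x w) / (m - l)"]
      unfolding tb tj by (simp add: wr diff_divide_distrib)
    have reloc: "travel (j # r') j = travel b w" "finish x b w 0 \<le> finish x (j # r') j 0"
      using gt[of "real (x w) / (m - l)"] rb rj r'(2) dist_refl[OF wN] dist_refl[OF jN]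
      by (auto simp: wr diff_divide_distrib)
    have "j # r' \<in> \<sigma> P K (v, x)"
      by (rule sigma_exchange[OF v best(1) idle r'(1) _ tr less_imp_le[OF fin]])
         (use r'(2) reloc wr in auto)
    then have "finish x (j # r') v 0 * travel b v \<le> finish x b v 0 * travel (j # r') v"
      by (rule best(2))
    then show False using fin sequence_bounds(2)[OF v bs] unfolding tr by simp
  qed
  then show ?thesis using aw wD by blast
qed

lemma value_eq_one_step_K_stop:
  assumes cn: "complete_network P" and s: "s \<in> states P"
    and K: "K \<ge> 1" and rk: "inj_on drk (demand P)" "inj_on nrk (nodes P)"
  shows "ennreal (value_at (Suc n) s) = one_step n s (K_stop_action P drk nrk K s)"
proof -
  obtain v x where vx: "s = (v, x)" by (cases s)
  let ?a = "K_stop_action P drk nrk K (v, x)"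
  have v: "v \<in> nodes P" using s vx by (simp add: states_def)
  have a: "?a \<in> actions P (v, x)"
    using admissible_K_stop[OF rk, of K] s vx by (auto simp: admissible_def K_stop_policy_def)
  then have aN: "?a \<in> nodes P" using v adjacent_nodes by (auto simp: actions_def)
  have "dp.val (Suc n) v x = dp.base (dp.val n) v x + dp.act (dp.val n) v x ?a"
  proof (rule dp.val_Suc_greedy[OF v aN])
    show "?a = v" if "dp.busy v x"
      using that K_stop_stay sigma_busy by (simp add: busy_iff)
    show "?a = v \<and> demand P = {v} \<or> ?a \<noteq> v \<and> ?a \<in> demand P \<and> (\<forall>j\<in>demand P. x j \<le> x ?a)"
      if "\<not> dp.busy v x"
      using that by (intro K_stop_greedy[OF cn K rk v]) (simp add: busy_iff)
  qed
  then show ?thesis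
    using one_step_eq[OF s[unfolded vx] a] by (simp add: vx value_at_def)
qed

lemma mixed_cost_mono:
  assumes \<theta>: "admissible P \<theta>" and s: "s \<in> states P" and n: "n < T"
  shows "mixed_cost \<theta> s T n \<le> mixed_cost \<theta> s T (Suc n)"
  unfolding mixed_cost_Suc unfolding mixed_cost_def case_prod_beta
proof (intro nn_integral_mono_AE AE_pmfI add_left_mono)
  fix hy assume hy: "hy \<in> set_pmf (run P \<theta> s n)"
  obtain h y where [simp]: "hy = (h, y)" by (cases hy)
  have y: "y \<in> states P" using run_states[OF \<theta> s] hy by simp
  have T: "T - n = Suc (T - Suc n)" using n by simp
  have "ennreal (value_at (T - n) y) = (\<integral>\<^sup>+a. ennreal (value_at (T - n) y) \<partial>measure_pmf (\<theta> h y))"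
    by simp
  also have "\<dots> \<le> (\<integral>\<^sup>+a. one_step (T - Suc n) y a \<partial>measure_pmf (\<theta> h y))"
    unfolding T using \<theta> y
    by (intro nn_integral_mono_AE AE_pmfI value_le_one_step) (auto simp: admissible_def)
  finally show "ennreal (value_at (T - n) (snd hy))
      \<le> (\<integral>\<^sup>+a. one_step (T - Suc n) (snd hy) a \<partial>measure_pmf (\<theta> (fst hy) (snd hy)))" by simp
qed

lemma value_le_expected_cost:
  assumes "admissible P \<theta>" "s \<in> states P"
  shows "ennreal (value_at T s) \<le> expected_cost P \<theta> s T"
proof -
  have "n \<le> T \<Longrightarrow> ennreal (value_at T s) \<le> mixed_cost \<theta> s T n" for n
  proof (induction n)
    case (Suc n)
    then show ?case using mixed_cost_mono[OF assms, of n T] by (auto intro: order_trans)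
  qed (simp add: mixed_cost_0)
  from this[of T] show ?thesis by (simp add: mixed_cost_T)
qed

lemma K_stop_expected_cost:
  assumes cn: "complete_network P" and s: "s \<in> states P"
    and K: "K \<ge> 1" and rk: "inj_on drk (demand P)" "inj_on nrk (nodes P)"
  shows "expected_cost P (K_stop_policy P drk nrk K) s T = ennreal (value_at T s)"
proof -
  let ?\<theta> = "K_stop_policy P drk nrk K"
  have adm: "admissible P ?\<theta>" by (rule admissible_K_stop[OF rk])
  have step: "mixed_cost ?\<theta> s T n = mixed_cost ?\<theta> s T (Suc n)" if n: "n < T" for n
    unfolding mixed_cost_Suc unfolding mixed_cost_def case_prod_beta
  proof (intro nn_integral_cong_AE AE_pmfI arg_cong2[where f = "(+)"] refl)
    fix hy assume hy: "hy \<in> set_pmf (run P ?\<theta> s n)"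
    obtain h y where [simp]: "hy = (h, y)" by (cases hy)
    have y: "y \<in> states P" using run_states[OF adm s] hy by simp
    have T: "T - n = Suc (T - Suc n)" using n by simp
    from value_eq_one_step_K_stop[OF cn y K rk, of "T - Suc n"]
    show "ennreal (value_at (T - n) (snd hy))
      = (\<integral>\<^sup>+a. one_step (T - Suc n) (snd hy) a \<partial>measure_pmf (?\<theta> (fst hy) (snd hy)))"
      unfolding T by (simp add: K_stop_policy_def)
  qed
  have "n \<le> T \<Longrightarrow> mixed_cost ?\<theta> s T n = ennreal (value_at T s)" for n
  proof (induction n)
    case (Suc n)
    then show ?case using step[of n] by simp
  qed (simp add: mixed_cost_0)
  from this[of T] show ?thesis by (simp add: mixed_cost_T)
qed

theorem K_stop_optimal:
  assumes cn: "complete_network P" and K: "K \<ge> 1"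
    and rk: "inj_on drk (demand P)" "inj_on nrk (nodes P)"
  shows "optimal P (K_stop_policy P drk nrk K)"
  unfolding optimal_def
proof (intro conjI allI impI ballI)
  show "admissible P (K_stop_policy P drk nrk K)" by (rule admissible_K_stop[OF rk])
  fix \<theta> s assume \<theta>: "admissible P \<theta>" and s: "s \<in> states P"
  show "average_cost P (K_stop_policy P drk nrk K) s \<le> average_cost P \<theta> s"
    unfolding average_cost_def K_stop_expected_cost[OF cn s K rk]
    by (intro Liminf_mono always_eventually allI divide_right_mono_ennreal
        value_le_expected_cost[OF \<theta> s])
qed

end

section \<open>Stability\<close>

lemma ln_diff_le:
  assumes "0 < b" "a \<le> b + (k::real)" "0 < a"
  shows "ln a - ln b \<le> k / b"
proof -
  have "ln a - ln b = ln (a / b)" using assms by (simp add: ln_div)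
  also have "\<dots> \<le> a / b - 1" using assms by (intro ln_le_minus_one) simp
  also have "\<dots> = (a - b) / b" using assms by (simp add: diff_divide_distrib)
  also have "\<dots> \<le> k / b" using assms by (intro divide_right_mono) auto
  finally show ?thesis .
qed

context polling begin

lemma finish_le:
  assumes "0 \<le> n" "\<And>w. w \<in> set q \<Longrightarrow> real (x w) \<le> n"
    and "v \<in> nodes P" "set q \<subseteq> nodes P" "0 \<le> e"
  shows "finish x q v e \<le> g ^ length q * (e + travel q v + real (length q) * (n / (m - l)))"
  using assms(2-)
proof (induction q arbitrary: v e)
  case (Cons w q)
  have g: "1 < g" and ml: "0 < m - l" using g_gt_1 rates by auto
  define N where "N = n / (m - l)"
  define s where "s = e + \<delta> P v w / tau P"
  have N0: "0 \<le> N" using assms(1) ml by (simp add: N_def)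
  have s0: "0 \<le> s" unfolding s_def using Cons.prems dist_nonneg tau_pos by simp
  have tr0: "0 \<le> travel q w" using Cons.prems by (intro travel_nonneg) auto
  define e1 where "e1 = g * s + real (x w) / (m - l)"
  have xw: "real (x w) / (m - l) \<le> N" unfolding N_def using Cons.prems ml by (intro divide_right_mono) auto
  have e10: "0 \<le> e1" unfolding e1_def using s0 g ml by simp
  have e1: "e1 \<le> g * (s + N)"
  proof -
    have "1 * N \<le> g * N" using g N0 by (intro mult_right_mono) auto
    then show ?thesis using xw by (simp add: e1_def distrib_left)
  qed
  have "finish x (w # q) v e = finish x q w e1" by (simp add: e1_def s_def)
  also have "\<dots> \<le> g ^ length q * (e1 + travel q w + real (length q) * N)"
    unfolding N_def using Cons.prems e10 by (intro Cons.IH) auto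
  also have "\<dots> \<le> g ^ length q * (g * (s + N + travel q w + real (length q) * N))"
  proof (intro mult_left_mono)
    have "1 * (travel q w + real (length q) * N) \<le> g * (travel q w + real (length q) * N)"
      using g tr0 N0 by (intro mult_right_mono) auto
    then show "e1 + travel q w + real (length q) * N \<le> g * (s + N + travel q w + real (length q) * N)"
      using e1 by (simp add: distrib_left)
  qed (use g in simp)
  also have "\<dots> = g ^ length (w # q) * (e + travel (w # q) v + real (length (w # q)) * N)"
    by (simp add: s_def algebra_simps)
  finally show ?case unfolding N_def .
qed simp

definition jobs :: "('v \<Rightarrow> nat) \<Rightarrow> nat" where
  "jobs x = (\<Sum>i\<in>demand P. x i)"

lemma jobs_inc: "i \<in> demand P \<Longrightarrow> jobs (inc i x) = Suc (jobs x)"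
  unfolding jobs_def using finite_demand by (simp add: sum.remove[of _ i])

lemma jobs_ge: "i \<in> demand P \<Longrightarrow> x i \<le> jobs x"
  unfolding jobs_def using finite_demand by (intro member_le_sum) auto

lemma jobs_dec:
  assumes "i \<in> demand P" "0 < x i"
  shows "jobs x = Suc (jobs (dec i x))"
  using jobs_inc[OF assms(1), of "dec i x"] assms(2) by simp

lemma long_queue:
  assumes "0 < jobs x"
  obtains j where "j \<in> demand P" "0 < x j" "real (jobs x) \<le> real (card (demand P)) * real (x j)"
proof -
  have "Max (x ` demand P) \<in> x ` demand P" using finite_demand demand_ne by (intro Max_in) auto
  then obtain j where j: "j \<in> demand P" "x j = Max (x ` demand P)" by auto
  have "jobs x \<le> card (demand P) * x j"
    unfolding jobs_def using sum_bounded_above[of "demand P" x "x j"] finite_demand by (simp add: j(2))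
  moreover from this have "0 < x j" using assms by (cases "x j") auto
  ultimately show ?thesis using that j(1) by (metis of_nat_le_iff of_nat_mult)
qed

end

locale stable_polling = polling +
  fixes K :: nat and drk nrk :: "'a \<Rightarrow> nat"
  assumes K: "1 \<le> K" and drk: "inj_on drk (demand P)" and nrk: "inj_on nrk (nodes P)"
    and rho: "traffic P < 1"
begin

abbreviation action where
  "action v x \<equiv> K_stop_action P drk nrk K (v, x)"

definition plans where
  "plans v = insert [] (sequences P K v)"

lemma plans_finite: "finite (plans v)"
  and plans_ne: "plans v \<noteq> {}"
  and Nil_plans: "[] \<in> plans v"
  by (simp_all add: plans_def finite_sequences)

lemma plansD:
  assumes "q \<in> plans v"
  shows "set q \<subseteq> demand P" "set q \<subseteq> nodes P" "length q \<le> K"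
  using assms sequencesD[of q K v] by (auto simp: plans_def)

text \<open>
  The ratio \<open>E / L\<close> has to make sense for the empty sequence too, which is all that is left on arrival at
  the last entry; hence \<open>grace\<close> is added to the travel time. Half a leg is small enough for a move, which
  saves a full leg, to raise the ratio: \<open>L\<close> is replaced by \<open>L - 2 grace + grace = L - grace\<close>.
\<close>

definition grace :: real where
  "grace = 1 / (2 * tau P)"

lemma grace_pos: "0 < grace"
  using tau_pos by (simp add: grace_def)

definition travel_max :: real where
  "travel_max = Max (insert (1 / tau P) ((\<lambda>(v, q). travel q v) ` (SIGMA v:nodes P. plans v)))"

lemma travel_max_finite: "finite ((\<lambda>(v, q). travel q v) ` (SIGMA v:nodes P. plans v))"
  using finite_nodes plans_finite by (intro finite_imageI finite_SigmaI) auto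

lemma travel_le_max: "v \<in> nodes P \<Longrightarrow> q \<in> plans v \<Longrightarrow> travel q v \<le> travel_max"
  unfolding travel_max_def using travel_max_finite by (intro Max_ge) auto

lemma travel_max_pos: "0 < travel_max"
proof -
  have "1 / tau P \<le> travel_max" unfolding travel_max_def using travel_max_finite by (intro Max_ge) auto
  moreover have "0 < 1 / tau P" using tau_pos by simp
  ultimately show ?thesis by linarith
qed

lemma plans_travel_nonneg: "v \<in> nodes P \<Longrightarrow> q \<in> plans v \<Longrightarrow> 0 \<le> travel q v"
  by (rule travel_nonneg, assumption, rule plansD(2))

text \<open>
  Starting the clock at \<open>1 + x\<^sub>v / (m - l)\<close> instead of \<open>0\<close> counts the queue at the server's own node, so
  that arriving at a queue does not lose its jobs; the summand \<open>1\<close> keeps the ratio positive.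
\<close>

definition ratio where
  "ratio v x q = finish x q v (1 + real (x v) / (m - l)) / (travel q v + grace)"

definition prospect where
  "prospect v x = Max (ratio v x ` plans v)"

lemma ratio_le_prospect: "q \<in> plans v \<Longrightarrow> ratio v x q \<le> prospect v x"
  unfolding prospect_def using plans_finite by simp

lemma prospect_le: "(\<And>q. q \<in> plans v \<Longrightarrow> ratio v x q \<le> B) \<Longrightarrow> prospect v x \<le> B"
  unfolding prospect_def using plans_finite plans_ne by (subst Max_le_iff) auto

lemma prospect_pos: "0 < prospect v x"
proof -
  have "0 < ratio v x []" using grace_pos rates by (simp add: ratio_def add_pos_nonneg)
  then show ?thesis using ratio_le_prospect[OF Nil_plans[of v], of x] by linarith
qed

lemma prospect_mono:
  assumes v: "v \<in> nodes P" and le: "\<And>w. x w \<le> x' w"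
  shows "prospect v x \<le> prospect v x'"
proof (rule prospect_le)
  fix q assume q: "q \<in> plans v"
  have "finish x q v (1 + real (x v) / (m - l)) \<le> finish x' q v (1 + real (x' v) / (m - l))"
    using le rates by (intro finish_mono add_left_mono divide_right_mono) auto
  then have "ratio v x q \<le> ratio v x' q"
    unfolding ratio_def using plans_travel_nonneg[OF v q] grace_pos by (intro divide_right_mono) auto
  also have "\<dots> \<le> prospect v x'" by (rule ratio_le_prospect[OF q])
  finally show "ratio v x q \<le> prospect v x'" .
qed

definition queue_factor :: real where
  "queue_factor = (m - l) * (travel_max + grace)"

lemma queue_factor_pos: "0 < queue_factor"
  using rates travel_max_pos grace_pos by (simp add: queue_factor_def)

lemma queue_le_prospect:
  assumes v: "v \<in> nodes P" and j: "j \<in> demand P"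
  shows "real (x j) \<le> queue_factor * prospect v x"
proof -
  have ml: "0 < m - l" using rates by simp
  obtain q where q: "q \<in> plans v" and fin: "real (x j) / (m - l) \<le> finish x q v (1 + real (x v) / (m - l))"
  proof (cases "j = v")
    case True
    show ?thesis by (rule that[OF Nil_plans]) (simp add: True)
  next
    case False
    have "[j] \<in> plans v" using False j K by (auto simp: plans_def sequences_def)
    moreover have "0 \<le> g * (1 + real (x v) / (m - l) + \<delta> P v j / tau P)"
      using g_gt_1 ml dist_nonneg[OF v demand_nodes[OF j]] tau_pos
      by (intro mult_nonneg_nonneg add_nonneg_nonneg) auto
    ultimately show ?thesis by (intro that[of "[j]"]) auto
  qed
  have den: "0 < travel q v + grace" "travel q v + grace \<le> travel_max + grace"
    using plans_travel_nonneg[OF v q] travel_le_max[OF v q] grace_pos by auto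
  have "real (x j) / (m - l) \<le> ratio v x q * (travel q v + grace)"
    using fin den by (simp add: ratio_def)
  also have "\<dots> \<le> prospect v x * (travel_max + grace)"
    using ratio_le_prospect[OF q, of x] den prospect_pos[of v x] by (intro mult_mono) auto
  finally show ?thesis using ml by (simp add: queue_factor_def field_simps)
qed

lemma jobs_le_prospect:
  assumes v: "v \<in> nodes P"
  shows "real (jobs x) \<le> real (card (demand P)) * queue_factor * prospect v x"
proof -
  have "real (jobs x) = (\<Sum>i\<in>demand P. real (x i))" by (simp add: jobs_def)
  also have "\<dots> \<le> real (card (demand P)) * (queue_factor * prospect v x)"
    by (rule sum_bounded_above) (rule queue_le_prospect[OF v])
  finally show ?thesis by (simp add: mult.assoc)
qed

lemma prospect_upper:
  obtains B where "0 < B" "\<And>v x. (v, x) \<in> states P \<Longrightarrow> prospect v x \<le> B * (real (jobs x) + 1)"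
proof -
  have ml: "0 < m - l" and g: "1 < g" using rates g_gt_1 by auto
  define A where "A = 1 + travel_max + (1 + real K) / (m - l)"
  have A0: "0 < A" unfolding A_def using travel_max_pos ml by (intro add_pos_nonneg) auto
  have "prospect v x \<le> (g ^ K * A / grace) * (real (jobs x) + 1)" if s: "(v, x) \<in> states P" for v x
  proof (rule prospect_le)
    have v: "v \<in> nodes P" using s by (simp add: states_def)
    fix q assume q: "q \<in> plans v"
    define n where "n = real (jobs x)"
    have xn: "real (x w) \<le> n" for w
      using s jobs_ge[of w x] by (cases "w \<in> demand P") (auto simp: states_def n_def)
    define e where "e = 1 + real (x v) / (m - l)"
    have e0: "0 \<le> e" using ml by (simp add: e_def)
    have tr: "0 \<le> travel q v" "travel q v \<le> travel_max"
      by (rule plans_travel_nonneg[OF v q], rule travel_le_max[OF v q])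
    have n0: "0 \<le> n" by (simp add: n_def)
    have "finish x q v e \<le> g ^ length q * (e + travel q v + real (length q) * (n / (m - l)))"
      by (rule finish_le) (use xn n0 v plansD[OF q] e0 in auto)
    also have "\<dots> \<le> g ^ K * (A * (n + 1))"
    proof (intro mult_mono)
      have "e \<le> 1 + n / (m - l)" unfolding e_def using xn[of v] ml by (simp add: divide_right_mono)
      moreover have "real (length q) * (n / (m - l)) \<le> real K * (n / (m - l))"
        using plansD(3)[OF q] n0 ml by (intro mult_right_mono) auto
      moreover have "A * (n + 1) = 1 + travel_max + (1 + real K) / (m - l)
          + (n + n * travel_max) + (n / (m - l) + real K * (n / (m - l)))"
        by (simp add: A_def algebra_simps add_divide_distrib)
      moreover have "0 \<le> (1 + real K) / (m - l)" "0 \<le> n * travel_max"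
        using ml n0 travel_max_pos by auto
      ultimately show "e + travel q v + real (length q) * (n / (m - l)) \<le> A * (n + 1)"
        using tr n0 by linarith
      show "g ^ length q \<le> g ^ K" using g plansD(3)[OF q] by (intro power_increasing) auto
      show "0 \<le> e + travel q v + real (length q) * (n / (m - l))" using e0 tr n0 ml by simp
    qed (use g in auto)
    finally have fin: "finish x q v e \<le> g ^ K * (A * (n + 1))" .
    have "ratio v x q \<le> g ^ K * (A * (n + 1)) / grace"
      unfolding ratio_def e_def[symmetric] using fin tr grace_pos g A0 n0
      by (intro frac_le mult_nonneg_nonneg) auto
    then show "ratio v x q \<le> g ^ K * A / grace * (real (jobs x) + 1)" by (simp add: n_def)
  qed
  moreover have "0 < g ^ K * A / grace" using g A0 grace_pos by simp
  ultimately show ?thesis using that by blast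
qed

definition service_loss :: real where
  "service_loss = g ^ K * ((1 + real K) / (m - l)) / grace"

lemma prospect_service:
  assumes v: "v \<in> nodes P" and xv: "0 < x v"
  shows "prospect v x \<le> prospect v (dec v x) + service_loss"
proof (rule prospect_le)
  have ml: "0 < m - l" and g: "1 < g" using rates g_gt_1 by auto
  fix q assume q: "q \<in> plans v"
  have tr: "0 \<le> travel q v" by (rule plans_travel_nonneg[OF v q])
  let ?e = "1 + real (x v) / (m - l)" and ?e' = "1 + real (dec v x v) / (m - l)"
  have "real (x v) = real (dec v x v) + 1" using xv by simp
  then have "?e = ?e' + 1 / (m - l)" by (simp only: add_divide_distrib add.assoc)
  then have le1: "finish x q v ?e
      \<le> finish (dec v x) q v ?e' + g ^ length q * (1 / (m - l) + real (length q) / (m - l))"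
    using ml by (intro finish_perturb) auto
  have le2: "g ^ length q * (1 / (m - l) + real (length q) / (m - l)) \<le> g ^ K * ((1 + real K) / (m - l))"
    unfolding add_divide_distrib[symmetric] using g ml plansD(3)[OF q]
    by (intro mult_mono power_increasing divide_right_mono) auto
  have fin: "finish x q v ?e \<le> finish (dec v x) q v ?e' + g ^ K * ((1 + real K) / (m - l))"
    by (rule order_trans[OF le1 add_left_mono[OF le2]])
  have "ratio v x q \<le> (finish (dec v x) q v ?e' + g ^ K * ((1 + real K) / (m - l))) / (travel q v + grace)"
    unfolding ratio_def by (rule divide_right_mono[OF fin]) (use tr grace_pos in simp)
  also have "\<dots> = ratio v (dec v x) q + g ^ K * ((1 + real K) / (m - l)) / (travel q v + grace)"
    by (simp only: ratio_def add_divide_distrib)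
  also have "g ^ K * ((1 + real K) / (m - l)) / (travel q v + grace) \<le> service_loss"
    unfolding service_loss_def using tr grace_pos g ml by (intro divide_left_mono) auto
  finally show "ratio v x q \<le> prospect v (dec v x) + service_loss"
    using ratio_le_prospect[OF q, of "dec v x"] by linarith
qed

text \<open>
  Every sequence that finishes after \<open>finish_min\<close> belongs to \<open>\<sigma>\<^sub>1\<close>. The first summand serves the
  condition on the derivative and the effect of the relocation to \<open>s\<^sub>1\<close>, the second one the condition
  \<open>1 - L / E \<ge> \<rho>\<close>.
\<close>

definition finish_min :: real where
  "finish_min = g ^ K * travel_max + travel_max / (1 - traffic P)"

lemma power_le_K: "q \<in> plans v \<Longrightarrow> g ^ length q \<le> g ^ K"
  using g_gt_1 plansD(3) by (intro power_increasing) auto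

lemma long_in_sigma1:
  assumes v: "v \<in> nodes P" and q: "q \<in> sequences P K v" and long: "finish_min \<le> finish x q v 0"
  shows "q \<in> \<sigma>\<^sub>1 P K (v, x)"
proof -
  note Q = sequencesD[OF q] and b = sequence_bounds(1,2)[OF v q] sequence_bounds(3,4)[OF v q, of x]
  have qp: "q \<in> plans v" using q by (simp add: plans_def)
  have tm: "travel q v \<le> travel_max" by (rule travel_le_max[OF v qp])
  have r: "0 < 1 - traffic P" using rho by simp
  have gK: "0 < g ^ K" using g_gt_1 by simp
  have tm0: "0 \<le> travel_max / (1 - traffic P)" "0 \<le> g ^ K * travel_max"
    using travel_max_pos r gK by auto
  have rho_le: "traffic P \<le> 1 - L / E" if "L \<le> travel_max" "travel_max / (1 - traffic P) \<le> E" "0 < E" for L E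
  proof -
    have "L \<le> E * (1 - traffic P)" using that r by (simp add: pos_divide_le_eq)
    then show ?thesis using that(3) by (simp add: field_simps)
  qed
  have "g ^ length q * travel q v \<le> g ^ K * travel_max"
    using power_le_K[OF qp] tm b g_gt_1 by (intro mult_mono) auto
  then have 1: "q \<in> \<sigma>\<^sub>2' P K (v, x)"
    using q long tm0 by (simp add: sigma2'_iff[OF v] finish_min_def)
  have 2: "traffic P \<le> 1 - travel q v / finish x q v 0"
    using long tm0 b by (intro rho_le tm) (auto simp: finish_min_def)
  have 3: "traffic P \<le> 1 - travel q (hd q) / finish x q (hd q) 0" if two: "2 \<le> length q"
  proof -
    obtain w r where wr: "q = w # r" using Q(3) by (cases q) auto
    have wN: "w \<in> nodes P" using Q wr by auto
    have leg: "0 \<le> \<delta> P v w / tau P" using dist_nonneg[OF v wN] tau_pos by simp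
    have tr: "travel q w \<le> travel q v" using leg dist_refl[OF wN] wr by simp
    have leg2: "\<delta> P v w / tau P \<le> travel_max"
      using tm travel_nonneg[OF wN, of r] Q wr by simp
    have "finish x q v 0 = g ^ length r * (g * (\<delta> P v w / tau P) + real (x w) / (m - l)) + finish x r w 0"
      unfolding wr finish.simps by (subst finish_affine) simp
    moreover have "finish x q w 0 = g ^ length r * (real (x w) / (m - l)) + finish x r w 0"
      unfolding wr finish.simps dist_refl[OF wN] by (subst finish_affine) simp
    ultimately have "finish x q v 0 = finish x q w 0 + g ^ length q * (\<delta> P v w / tau P)"
      by (simp add: wr algebra_simps)
    moreover have "g ^ length q * (\<delta> P v w / tau P) \<le> g ^ K * travel_max"
      using power_le_K[OF qp] leg leg2 g_gt_1 by (intro mult_mono) auto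
    ultimately have "travel_max / (1 - traffic P) \<le> finish x q w 0"
      using long by (simp add: finish_min_def)
    moreover have "0 < finish x q w 0"
      using relocated_travel(1)[OF Q(5,2) two] relocated_travel(2)[OF Q(5,2) two, of x] wr by simp
    ultimately show ?thesis using tr tm wr by (intro rho_le) auto
  qed
  show ?thesis unfolding sigma1_iff[OF v] using 1 2 3 by blast
qed

text \<open>
  Sequences in \<open>\<sigma>\<^sub>1\<close> do not beat the chosen one, all others finish early; the last summand accounts
  for the start at time \<open>1\<close>.
\<close>

lemma prospect_le_best:
  assumes s: "(v, x) \<in> states P" and idle: "\<not> (v \<in> demand P \<and> 0 < x v)"
    and ne: "\<sigma>\<^sub>1 P K (v, x) \<noteq> {}"
  defines "b \<equiv> best_sequence P drk K (v, x)"
  shows "prospect v x \<le> finish x b v 0 / travel b v + (finish_min / grace + g ^ K / grace)"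
    and "\<And>q. q \<in> sequences P K v \<Longrightarrow> finish_min \<le> finish x q v 0 \<Longrightarrow>
      finish x q v 0 / travel q v \<le> finish x b v 0 / travel b v"
proof -
  have v: "v \<in> nodes P" using s by (simp add: states_def)
  have x0: "x v = 0" using s idle by (auto simp: states_def)
  have sig: "\<sigma> P K (v, x) = \<sigma>\<^sub>1 P K (v, x)" using sigma_idle[where v = v and x = x, OF idle] ne by simp
  then have ne': "\<sigma> P K (v, x) \<noteq> {}" using ne by simp
  note best = best_sequence[OF drk ne' v, folded b_def]
  have bs: "b \<in> sequences P K v" using best(1) sigma_subset by blast
  note bb = sequence_bounds(2)[OF v bs] sequence_bounds(3,4)[OF v bs, of x]
  show le: "finish x q v 0 / travel q v \<le> finish x b v 0 / travel b v"
    if q: "q \<in> sequences P K v" and long: "finish_min \<le> finish x q v 0" for q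
  proof -
    have "finish x q v 0 * travel b v \<le> finish x b v 0 * travel q v"
      by (rule best(2)) (simp add: sig long_in_sigma1[OF v q long])
    then show ?thesis using bb sequence_bounds(2)[OF v q] by (simp add: field_simps)
  qed
  have e0: "0 \<le> finish x b v 0 / travel b v" using bb by simp
  have fm: "0 \<le> finish_min"
    unfolding finish_min_def using travel_max_pos rho g_gt_1 by simp
  have gK: "1 \<le> g ^ K" using g_gt_1 by simp
  show "prospect v x \<le> finish x b v 0 / travel b v + (finish_min / grace + g ^ K / grace)"
  proof (rule prospect_le)
    fix q assume q: "q \<in> plans v"
    show "ratio v x q \<le> finish x b v 0 / travel b v + (finish_min / grace + g ^ K / grace)"
    proof (cases "q = []")
      case True
      have "1 / grace \<le> g ^ K / grace" using gK grace_pos by (intro divide_right_mono) auto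
      moreover have "0 \<le> finish_min / grace" using fm grace_pos by simp
      moreover have "ratio v x q = 1 / grace" using True x0 by (simp add: ratio_def)
      ultimately show ?thesis using e0 by linarith
    next
      case False
      then have qs: "q \<in> sequences P K v" using q by (simp add: plans_def)
      note bq = sequence_bounds(2)[OF v qs] sequence_bounds(3,4)[OF v qs, of x]
      have "finish x q v 1 = g ^ length q + finish x q v 0" by (subst finish_affine) simp
      then have "ratio v x q = finish x q v 0 / (travel q v + grace) + g ^ length q / (travel q v + grace)"
        unfolding ratio_def x0 by (simp add: add_divide_distrib)
      moreover have "g ^ length q / (travel q v + grace) \<le> g ^ K / grace"
        using power_le_K[OF q] bq grace_pos g_gt_1 by (intro frac_le) auto
      moreover have "finish x q v 0 / (travel q v + grace) \<le> finish x b v 0 / travel b v + finish_min / grace"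
      proof (cases "finish_min \<le> finish x q v 0")
        case True
        have "finish x q v 0 / (travel q v + grace) \<le> finish x q v 0 / travel q v"
          using bq grace_pos by (intro divide_left_mono) auto
        also have "\<dots> \<le> finish x b v 0 / travel b v" by (rule le[OF qs True])
        finally show ?thesis using fm grace_pos by (simp add: add_increasing2)
      next
        case False
        then have "finish x q v 0 / (travel q v + grace) \<le> finish_min / grace"
          using bq grace_pos by (intro frac_le) auto
        then show ?thesis using e0 by linarith
      qed
      ultimately show ?thesis by linarith
    qed
  qed
qed

text \<open>
  At the new node the server can continue with the chosen sequence, or with its tail if the first entry has
  been reached. This saves one leg of travel. Without this leg everything starts \<open>1 / \<tau>\<close> earlier, which
  lowers the finishing time by at most \<open>g\<^sup>K / \<tau>\<close>.
\<close>

lemma prospect_after_move: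
  assumes v: "v \<in> nodes P" and ne: "\<sigma> P K (v, x) \<noteq> {}"
  defines "b \<equiv> best_sequence P drk K (v, x)"
  shows "(finish x b v 0 - g ^ K / tau P) / (travel b v - grace) \<le> prospect (action v x) x"
proof -
  define a where "a = action v x"
  note best = best_sequence(1)[OF drk ne v, folded b_def]
  note move = K_stop_move[OF drk nrk ne v, folded b_def a_def]
  have bs: "b \<in> sequences P K v" using best sigma_subset by blast
  note Q = sequencesD[OF bs]
  have ml: "0 < m - l" and g: "1 < g" using rates g_gt_1 by auto
  obtain w r where wr: "b = w # r" using Q(3) by (cases b) auto
  have w: "w \<in> demand P" "w \<noteq> v" "\<delta> P a w = \<delta> P v w - 1" using move wr by auto
  have aN: "a \<in> nodes P" and wN: "w \<in> nodes P" using move(1) adjacent_nodes w demand_nodes by auto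
  have gr: "1 / tau P = 2 * grace" using tau_pos by (simp add: grace_def)
  have "\<exists>q\<in>plans a. travel q a = travel b v - 1 / tau P \<and>
      finish x b v 0 \<le> finish x q a (1 + real (x a) / (m - l)) + g ^ K / tau P"
  proof (cases "a = w")
    case True
    have leg: "\<delta> P v w = 1" using w(3) dist_refl[OF wN] True by simp
    have "r \<in> plans a"
      using bs wr True by (cases r) (auto simp: plans_def sequences_def)
    moreover have "travel r a = travel b v - 1 / tau P" using wr leg True by simp
    moreover have "finish x b v 0 \<le> finish x r a (1 + real (x a) / (m - l)) + g ^ K / tau P"
    proof -
      have "finish x b v 0 = g ^ length r * (g / tau P + real (x w) / (m - l)) + finish x r w 0"
        unfolding wr finish.simps leg by (subst finish_affine) simp
      moreover have "finish x r a (1 + real (x a) / (m - l))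
          = g ^ length r * (1 + real (x w) / (m - l)) + finish x r w 0"
        unfolding True by (rule finish_affine)
      moreover have "g ^ length r * g \<le> g ^ K"
        using power_le_K[of b v] bs wr by (simp add: plans_def mult.commute)
      then have "g ^ length r * g / tau P \<le> g ^ K / tau P" using tau_pos by (intro divide_right_mono) auto
      moreover have "0 \<le> g ^ length r" using g by simp
      ultimately show ?thesis by (simp add: distrib_left)
    qed
    ultimately show ?thesis by blast
  next
    case False
    have "b \<in> plans a" using bs wr False by (auto simp: plans_def sequences_def)
    moreover have "travel b a = travel b v - 1 / tau P"
      using wr w(3) by (simp add: diff_divide_distrib)
    moreover have "finish x b v 0 \<le> finish x b a (1 + real (x a) / (m - l)) + g ^ K / tau P"
    proof -
      have "finish x b v 0 = finish x b a (1 / tau P)"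
        using wr w(3) by (simp add: diff_divide_distrib)
      also have "\<dots> = g ^ length b * (1 / tau P) + finish x b a 0" by (rule finish_affine)
      also have "g ^ length b * (1 / tau P) \<le> g ^ K / tau P"
        using power_le_K[of b v] bs tau_pos by (simp add: plans_def divide_right_mono)
      also have "finish x b a 0 \<le> finish x b a (1 + real (x a) / (m - l))"
        using ml by (intro finish_mono) auto
      finally show ?thesis by simp
    qed
    ultimately show ?thesis by blast
  qed
  then obtain q where q: "q \<in> plans a" and tr: "travel q a = travel b v - 1 / tau P"
    and fin: "finish x b v 0 - g ^ K / tau P \<le> finish x q a (1 + real (x a) / (m - l))" by force
  have den: "travel q a + grace = travel b v - grace" unfolding tr gr by simp
  have "0 < travel b v - grace" using den plans_travel_nonneg[OF aN q] grace_pos by linarith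
  then have "(finish x b v 0 - g ^ K / tau P) / (travel b v - grace) \<le> ratio a x q"
    unfolding ratio_def den using fin by (intro divide_right_mono) auto
  also have "\<dots> \<le> prospect a x" by (rule ratio_le_prospect[OF q])
  finally show ?thesis by (simp add: a_def)
qed

text \<open>
  The factor \<open>L / (L - grace)\<close> is at least \<open>1 + grace / travel_max\<close>. Half of this gain absorbs the bounded
  errors of the two preceding estimates when the ratio is large.
\<close>

definition gain :: real where
  "gain = grace / (2 * travel_max)"

lemma gain_pos: "0 < gain"
  using grace_pos travel_max_pos by (simp add: gain_def)

lemma move_gains:
  obtains X :: nat where "\<And>v x. (v, x) \<in> states P \<Longrightarrow> \<not> (v \<in> demand P \<and> 0 < x v) \<Longrightarrow> X \<le> jobs x \<Longrightarrow>
      \<sigma> P K (v, x) \<noteq> {} \<and> (1 + gain) * prospect v x \<le> prospect (action v x) x"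
proof -
  have ml: "0 < m - l" and g: "1 < g" using rates g_gt_1 by auto
  define d where "d = real (card (demand P))"
  have d0: "0 < d" unfolding d_def using demand_ne finite_demand by (simp add: card_gt_0_iff)
  define slack where "slack = finish_min / grace + g ^ K / grace"
  \<comment> \<open>the ratio above which the gain dominates the additive errors, and the number of jobs that
      guarantees such a ratio via a longest queue\<close>
  define need where "need = ((1 + gain) * slack + 2 * g ^ K) / gain"
  define Y where "Y = d * (m - l) * max finish_min (travel_max * need)"
  obtain X :: nat where X: "0 < X" "Y \<le> real X"
    using real_arch_simple[of "max Y 1"] by (metis less_le_trans max.bounded_iff of_nat_0_less_iff zero_less_one)
  have "\<sigma> P K (v, x) \<noteq> {} \<and> (1 + gain) * prospect v x \<le> prospect (action v x) x"
    if s: "(v, x) \<in> states P" and idle: "\<not> (v \<in> demand P \<and> 0 < x v)" and big: "X \<le> jobs x" for v x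
  proof -
    have v: "v \<in> nodes P" using s by (simp add: states_def)
    obtain j where j: "j \<in> demand P" "0 < x j" "real (jobs x) \<le> d * real (x j)"
      using long_queue[of x] big X unfolding d_def by auto
    then have jv: "j \<noteq> v" using idle by auto
    have js: "[j] \<in> sequences P K v" using j jv K by (auto simp: sequences_def)
    then have jp: "[j] \<in> plans v" by (simp add: plans_def)
    have "d * (m - l) * max finish_min (travel_max * need) \<le> d * real (x j)"
      using X(2) big j(3) unfolding Y_def by linarith
    then have "d * ((m - l) * max finish_min (travel_max * need)) \<le> d * real (x j)"
      by (simp only: mult.assoc)
    then have "(m - l) * max finish_min (travel_max * need) \<le> real (x j)"
      by (rule mult_le_cancel_left_pos[OF d0, THEN iffD1])
    then have xj: "max finish_min (travel_max * need) \<le> real (x j) / (m - l)"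
      by (subst pos_le_divide_eq[OF ml]) (simp only: mult.commute)
    have "0 \<le> g * (\<delta> P v j / tau P)"
      using g dist_nonneg[OF v demand_nodes[OF j(1)]] tau_pos by simp
    then have fj: "real (x j) / (m - l) \<le> finish x [j] v 0" by simp
    have long: "finish_min \<le> finish x [j] v 0" using xj fj by simp
    have ne1: "\<sigma>\<^sub>1 P K (v, x) \<noteq> {}" using long_in_sigma1[OF v js long] by blast
    then have ne: "\<sigma> P K (v, x) \<noteq> {}" using sigma_idle[where v = v and x = x, OF idle] by simp
    define b where "b = best_sequence P drk K (v, x)"
    have bs: "b \<in> sequences P K v"
      using best_sequence(1)[OF drk ne v] sigma_subset unfolding b_def by blast
    define E where "E = finish x b v 0"
    define L where "L = travel b v"
    define e where "e = E / L"
    have L: "2 * grace \<le> L" "L \<le> travel_max" "0 < L"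
      using sequence_bounds(1,2)[OF v bs] travel_le_max[OF v, of b] bs tau_pos
      by (auto simp: L_def grace_def plans_def)
    have need_le: "need \<le> e"
    proof -
      have "0 < travel [j] v" by (rule sequence_bounds(2)[OF v js])
      have "travel_max * need \<le> finish x [j] v 0" using xj fj by simp
      then have "need \<le> finish x [j] v 0 / travel_max"
        using travel_max_pos by (simp add: pos_le_divide_eq mult.commute)
      also have "\<dots> \<le> finish x [j] v 0 / travel [j] v"
        by (rule divide_left_mono[OF travel_le_max[OF v jp]
              less_imp_le[OF sequence_bounds(4)[OF v js]]
              mult_pos_pos[OF travel_max_pos \<open>0 < travel [j] v\<close>]])
      also have "\<dots> \<le> e"
        using prospect_le_best(2)[OF s idle ne1 js long] by (simp add: e_def E_def L_def b_def)
      finally show ?thesis .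
    qed
    have fm: "0 \<le> finish_min"
      unfolding finish_min_def using travel_max_pos rho g by simp
    have slack0: "0 \<le> slack" unfolding slack_def using fm grace_pos g by simp
    have need0: "0 \<le> need"
      unfolding need_def using slack0 gain_pos g by simp
    have e0: "0 \<le> e" using need_le need0 by simp
    have up: "prospect v x \<le> e + slack"
      using prospect_le_best(1)[OF s idle ne1] by (simp add: e_def E_def L_def b_def slack_def)
    have low: "(E - g ^ K / tau P) / (L - grace) \<le> prospect (action v x) x"
      using prospect_after_move[OF v ne] by (simp add: E_def L_def b_def)
    have Lg: "grace \<le> L - grace" using L grace_pos by simp
    have "e * (1 + 2 * gain) - 2 * g ^ K \<le> (E - g ^ K / tau P) / (L - grace)"
    proof -
      have "E = e * L" using L by (simp add: e_def)
      have "e * (1 + 2 * gain) \<le> E / (L - grace)"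
      proof -
        have "2 * gain \<le> grace / (L - grace)"
          unfolding gain_def using L Lg grace_pos travel_max_pos by (simp add: frac_le)
        then have "e * (1 + 2 * gain) \<le> e * (1 + grace / (L - grace))"
          using e0 by (intro mult_left_mono) auto
        also have "1 + grace / (L - grace) = L / (L - grace)"
          using Lg grace_pos by (simp add: field_simps)
        finally show ?thesis using \<open>E = e * L\<close> by simp
      qed
      moreover have "g ^ K / tau P / (L - grace) \<le> g ^ K / tau P / grace"
        using Lg grace_pos g tau_pos by (intro divide_left_mono) auto
      moreover have "g ^ K / tau P / grace = 2 * g ^ K" using tau_pos by (simp add: grace_def)
      ultimately show ?thesis by (simp add: diff_divide_distrib)
    qed
    moreover have "(1 + gain) * (e + slack) \<le> e * (1 + 2 * gain) - 2 * g ^ K"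
    proof -
      have "(1 + gain) * slack + 2 * g ^ K = need * gain" unfolding need_def using gain_pos by simp
      also have "\<dots> \<le> e * gain" using need_le gain_pos by (intro mult_right_mono) auto
      finally show ?thesis by (simp add: algebra_simps)
    qed
    moreover have "(1 + gain) * prospect v x \<le> (1 + gain) * (e + slack)"
      using up gain_pos by (intro mult_left_mono) auto
    ultimately show ?thesis using ne low by linarith
  qed
  then show ?thesis using that by blast
qed

subsection \<open>Drift\<close>

abbreviation kernel where
  "kernel \<equiv> \<lambda>s. transition P s (K_stop_action P drk nrk K s)"

lemma action_in_actions: "s \<in> states P \<Longrightarrow> K_stop_action P drk nrk K s \<in> actions P s"
  using admissible_K_stop[OF drk nrk, of K] by (simp add: admissible_def K_stop_policy_def)

lemma kernel_closed: "s \<in> states P \<Longrightarrow> set_pmf (kernel s) \<subseteq> states P"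
  using transition_states action_in_actions by blast

text \<open>
  Chosen so that a move, which succeeds at rate \<open>\<tau>\<close>, outweighs all arrivals by \<open>1\<close>.
\<close>

definition damping :: real where
  "damping = (real (card (demand P)) * l + 1) / (tau P * ln (1 + gain))"

definition lyapunov :: "'a state \<Rightarrow> real" where
  "lyapunov s = real (jobs (snd s)) - damping * ln (prospect (fst s) (snd s))"

lemma damping_pos: "0 < damping"
proof -
  have "0 < ln (1 + gain)" using gain_pos by simp
  moreover have "0 \<le> real (card (demand P)) * l" using rates by simp
  ultimately show ?thesis using tau_pos by (simp add: damping_def add_nonneg_pos)
qed

text \<open>
  The prospect grows at most linearly in the number of jobs, and the logarithm lies below each of its tangents.
\<close>

lemma lyapunov_bounded_below:
  obtains B where "\<And>s. s \<in> states P \<Longrightarrow> - B \<le> lyapunov s"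
proof -
  obtain C where C: "0 < C" "\<And>v x. (v, x) \<in> states P \<Longrightarrow> prospect v x \<le> C * (real (jobs x) + 1)"
    using prospect_upper by blast
  \<comment> \<open>the slope for which \<open>damping\<close> times the tangent of the logarithm has slope \<open>1\<close> in the number
      of jobs\<close>
  define r where "r = 1 / (damping * C)"
  have r: "0 < r" "damping * C * r = 1" using damping_pos C(1) by (auto simp: r_def)
  have "- (1 + damping * ln (1 / r)) \<le> lyapunov s" if "s \<in> states P" for s
  proof -
    obtain v x where s: "s = (v, x)" by (cases s)
    let ?H = "prospect v x"
    have "ln (r * ?H) \<le> r * ?H - 1" using r prospect_pos by (intro ln_le_minus_one) simp
    then have "ln ?H \<le> ln (1 / r) + r * ?H"
      using r(1) prospect_pos[of v x] by (simp add: ln_mult ln_div)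
    also have "r * ?H \<le> r * (C * (real (jobs x) + 1))"
      using C(2)[of v x] that s r(1) by (intro mult_left_mono) auto
    finally have "damping * ln ?H \<le> damping * (ln (1 / r) + r * (C * (real (jobs x) + 1)))"
      using damping_pos by simp
    also have "\<dots> = damping * ln (1 / r) + (damping * C * r) * (real (jobs x) + 1)"
      by (simp add: algebra_simps)
    finally show ?thesis unfolding r(2) by (simp add: lyapunov_def s)
  qed
  then show ?thesis using that by blast
qed

lemma load: "real (card (demand P)) * l < m"
  using rho rates by (simp add: traffic_eq pos_divide_less_eq)

definition drift_rate :: real where
  "drift_rate = min 1 ((m - real (card (demand P)) * l) / 2)"

lemma drift_rate_pos: "0 < drift_rate"
  using load by (simp add: drift_rate_def)

lemma arrivals_drift:
  assumes v: "v \<in> nodes P"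
  shows "(\<Sum>i\<in>demand P. l * lyapunov (v, inc i x)) \<le> real (card (demand P)) * l * (lyapunov (v, x) + 1)"
proof -
  have "l * lyapunov (v, inc i x) \<le> l * (lyapunov (v, x) + 1)" if i: "i \<in> demand P" for i
  proof (intro mult_left_mono)
    have "prospect v x \<le> prospect v (inc i x)" by (rule prospect_mono[OF v]) simp
    then have "ln (prospect v x) \<le> ln (prospect v (inc i x))" using prospect_pos[of v x] by simp
    then have "damping * ln (prospect v x) \<le> damping * ln (prospect v (inc i x))"
      using damping_pos by simp
    then show "lyapunov (v, inc i x) \<le> lyapunov (v, x) + 1"
      using jobs_inc[OF i, of x] by (simp add: lyapunov_def)
  qed (use rates in simp)
  then have "(\<Sum>i\<in>demand P. l * lyapunov (v, inc i x))
      \<le> real (card (demand P)) * (l * (lyapunov (v, x) + 1))"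
    by (rule sum_bounded_above)
  then show ?thesis by (simp only: mult.assoc)
qed

text \<open>
  During a service the prospect may fall by \<open>service_loss\<close>, but as it is of the order of the number
  of jobs, its logarithm hardly changes, and the drift is close to \<open>\<Sum>\<lambda>\<^sub>i - \<mu> < 0\<close>.
\<close>

lemma lyapunov_drift:
  obtains X :: nat where "\<And>s. s \<in> states P \<Longrightarrow> X \<le> jobs (snd s) \<Longrightarrow>
      measure_pmf.expectation (kernel s) lyapunov \<le> lyapunov s - drift_rate"
proof -
  obtain X1 :: nat where X1: "\<And>v x. (v, x) \<in> states P \<Longrightarrow> \<not> (v \<in> demand P \<and> 0 < x v) \<Longrightarrow> X1 \<le> jobs x \<Longrightarrow>
      \<sigma> P K (v, x) \<noteq> {} \<and> (1 + gain) * prospect v x \<le> prospect (action v x) x"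
    using move_gains by blast
  define dl where "dl = real (card (demand P)) * l"
  have dlm: "dl < m" using load by (simp add: dl_def)
  define F where "F = real (card (demand P)) * queue_factor"
  have F0: "0 < F" unfolding F_def using queue_factor_pos demand_ne finite_demand by (simp add: card_gt_0_iff)
  \<comment> \<open>the prospect above which the logarithmic loss uses up at most half of \<open>m - dl\<close>\<close>
  define h where "h = 2 * m * damping * service_loss / (m - dl)"
  obtain X2 :: nat where X2: "F * h + 1 \<le> real X2" using real_arch_simple by blast
  have "measure_pmf.expectation (kernel s) lyapunov \<le> lyapunov s - drift_rate"
    if s: "s \<in> states P" and big: "max X1 X2 \<le> jobs (snd s)" for s
  proof -
    obtain v x where vx: "s = (v, x)" by (cases s)
    have v: "v \<in> nodes P" using s vx by (simp add: states_def)
    let ?a = "action v x" and ?y = "lyapunov (v, x)"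
    have arr: "(\<Sum>i\<in>demand P. l * lyapunov (v, inc i x)) \<le> dl * (?y + 1)"
      using arrivals_drift[OF v] by (simp add: dl_def)
    have dlI: "dl + idle_rate = 1" by (simp add: dl_def idle_rate_def)
    show ?thesis
    proof (cases "v \<in> demand P \<and> 0 < x v")
      case True
      then have a: "?a = v" by (intro K_stop_stay sigma_busy) auto
      have jd: "real (jobs x) = real (jobs (dec v x)) + 1"
        using jobs_dec[of v x] True by simp
      have "F * h \<le> F * prospect v (dec v x)"
        using jobs_le_prospect[OF v, of "dec v x"] X2 big jd vx by (simp add: F_def)
      then have hle: "h \<le> prospect v (dec v x)" using F0 by simp
      have "ln (prospect v x) - ln (prospect v (dec v x)) \<le> service_loss / prospect v (dec v x)"
        using True by (intro ln_diff_le prospect_pos prospect_service v) auto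
      then have "m * damping * (ln (prospect v x) - ln (prospect v (dec v x)))
          \<le> m * damping * (service_loss / prospect v (dec v x))"
        using rates damping_pos by (intro mult_left_mono) auto
      also have "\<dots> \<le> (m - dl) / 2"
      proof -
        have "2 * m * damping * service_loss = h * (m - dl)" using dlm by (simp add: h_def)
        also have "\<dots> \<le> prospect v (dec v x) * (m - dl)" using hle dlm by (intro mult_right_mono) auto
        finally show ?thesis using prospect_pos[of v "dec v x"] by (simp add: field_simps)
      qed
      finally have loss: "m * damping * (ln (prospect v x) - ln (prospect v (dec v x))) \<le> (m - dl) / 2" .
      have "lyapunov (v, dec v x) - ?y = - 1 + damping * (ln (prospect v x) - ln (prospect v (dec v x)))"
        using jd by (simp add: lyapunov_def algebra_simps)
      then have "m * (lyapunov (v, dec v x) - ?y)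
          = m * (- 1 + damping * (ln (prospect v x) - ln (prospect v (dec v x))))"
        by (rule arg_cong)
      also have "\<dots> = - m + m * damping * (ln (prospect v x) - ln (prospect v (dec v x)))"
        by (simp add: algebra_simps)
      finally have "m * (lyapunov (v, dec v x) - ?y)
          = - m + m * damping * (ln (prospect v x) - ln (prospect v (dec v x)))" .
      then have ser: "m * lyapunov (v, dec v x) \<le> m * ?y - m + (m - dl) / 2"
        using loss by (simp only: right_diff_distrib)
      have "measure_pmf.expectation (kernel s) lyapunov
          = (\<Sum>i\<in>demand P. l * lyapunov (v, inc i x)) + m * lyapunov (v, dec v x) + (idle_rate - m) * ?y"
        unfolding vx a expectation_transition using True not_adjacent_self by (simp add: busy_iff)
      also have "\<dots> \<le> dl * (?y + 1) + (m * ?y - m + (m - dl) / 2) + (idle_rate - m) * ?y"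
        using arr ser by linarith
      also have "\<dots> = (dl + idle_rate) * ?y - (m - dl) / 2"
        by (simp add: algebra_simps)
      also have "\<dots> \<le> lyapunov s - drift_rate"
      proof -
        have "drift_rate \<le> (m - dl) / 2" unfolding drift_rate_def dl_def by (rule min.cobounded2)
        then show ?thesis unfolding dlI vx by simp
      qed
      finally show ?thesis .
    next
      case False
      have ne: "\<sigma> P K (v, x) \<noteq> {}" and gains: "(1 + gain) * prospect v x \<le> prospect ?a x"
        using X1[of v x] s big False vx by auto
      have adj: "adjacent P v ?a" using K_stop_move(1)[OF drk nrk ne v] by simp
      then have av: "?a \<noteq> v" using not_adjacent_self by metis
      have "ln ((1 + gain) * prospect v x) \<le> ln (prospect ?a x)"
        using gains gain_pos prospect_pos[of v x] by (subst ln_le_cancel_iff) (auto intro: prospect_pos)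
      then have "ln (1 + gain) \<le> ln (prospect ?a x) - ln (prospect v x)"
        using gain_pos prospect_pos[of v x] by (simp add: ln_mult)
      then have "tau P * damping * ln (1 + gain)
          \<le> tau P * damping * (ln (prospect ?a x) - ln (prospect v x))"
        using tau_pos damping_pos by (intro mult_left_mono) auto
      moreover have "tau P * damping * ln (1 + gain) = dl + 1"
        using tau_pos gain_pos by (simp add: damping_def dl_def)
      moreover have "tau P * (lyapunov (?a, x) - ?y)
          = - (tau P * damping * (ln (prospect ?a x) - ln (prospect v x)))"
        by (simp add: lyapunov_def algebra_simps)
      ultimately have mv: "tau P * lyapunov (?a, x) \<le> tau P * ?y - (dl + 1)"
        unfolding right_diff_distrib by linarith
      have "measure_pmf.expectation (kernel s) lyapunov
          = (\<Sum>i\<in>demand P. l * lyapunov (v, inc i x)) + tau P * lyapunov (?a, x) + (idle_rate - tau P) * ?y"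
        unfolding vx expectation_transition using adj av by simp
      also have "\<dots> \<le> dl * (?y + 1) + (tau P * ?y - (dl + 1)) + (idle_rate - tau P) * ?y"
        using arr mv by linarith
      also have "\<dots> = (dl + idle_rate) * ?y - 1" by (simp add: algebra_simps)
      also have "\<dots> \<le> lyapunov s - drift_rate"
        unfolding dlI by (simp add: vx drift_rate_def)
      finally show ?thesis .
    qed
  qed
  then show ?thesis using that[of "max X1 X2"] by auto
qed

lemma finite_few_jobs: "finite {s \<in> states P. jobs (snd s) < X}"
proof (rule finite_subset)
  let ?B = "{x. \<forall>i. (i \<in> demand P \<longrightarrow> x i \<in> {..X}) \<and> (i \<notin> demand P \<longrightarrow> x i = (0::nat))}"
  show "finite (nodes P \<times> ?B)"
    using finite_nodes finite_demand by (intro finite_cartesian_product finite_set_of_finite_funs) auto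
  show "{s \<in> states P. jobs (snd s) < X} \<subseteq> nodes P \<times> ?B"
  proof
    fix s assume s: "s \<in> {s \<in> states P. jobs (snd s) < X}"
    obtain v x where vx: "s = (v, x)" by (cases s)
    have "x i \<le> X" if "i \<in> demand P" for i using jobs_ge[OF that, of x] s vx by simp
    then show "s \<in> nodes P \<times> ?B" using s vx by (auto simp: states_def)
  qed
qed

subsection \<open>Reaching the empty system\<close>

text \<open>
  The target states of different events may coincide, so the transition probabilities are only bounded
  from below.
\<close>

lemma kernel_stepI:
  assumes s: "(v, x) \<in> states P"
  shows "i \<in> demand P \<Longrightarrow> ((v, x), (v, inc i x)) \<in> steps kernel"
    and "v \<in> demand P \<Longrightarrow> 0 < x v \<Longrightarrow> ((v, x), (v, dec v x)) \<in> steps kernel"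
    and "\<sigma> P K (v, x) \<noteq> {} \<Longrightarrow> ((v, x), (action v x, x)) \<in> steps kernel"
proof -
  have v: "v \<in> nodes P" using s by (simp add: states_def)
  define R where "R a = idle_rate - m * of_bool (a = v \<and> dp.busy v x) - tau P * of_bool (adjacent P v a)" for a
  have R0: "0 \<le> R a" for a
    using not_adjacent_self[of v] rates tau_pos by (auto simp: R_def idle_rate_eq)
  have ge: "(\<Sum>i\<in>demand P. l * of_bool (z = (v, inc i x))) \<le> trans_prob P (v, x) a z"
     "m * of_bool (a = v \<and> dp.busy v x) * of_bool (z = (v, dec v x)) \<le> trans_prob P (v, x) a z"
     "tau P * of_bool (adjacent P v a) * of_bool (z = (a, x)) \<le> trans_prob P (v, x) a z" for a z
  proof -
    have "0 \<le> (\<Sum>i\<in>demand P. l * of_bool (z = (v, inc i x)))"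
      using rates by (intro sum_nonneg) auto
    moreover have "0 \<le> m * of_bool (a = v \<and> dp.busy v x) * of_bool (z = (v, dec v x))"
      using rates by simp
    moreover have "0 \<le> tau P * of_bool (adjacent P v a) * of_bool (z = (a, x))"
      using tau_pos by simp
    moreover have "0 \<le> R a * of_bool (z = (v, x))" using R0[of a] by simp
    ultimately show
      "(\<Sum>i\<in>demand P. l * of_bool (z = (v, inc i x))) \<le> trans_prob P (v, x) a z"
      "m * of_bool (a = v \<and> dp.busy v x) * of_bool (z = (v, dec v x)) \<le> trans_prob P (v, x) a z"
      "tau P * of_bool (adjacent P v a) * of_bool (z = (a, x)) \<le> trans_prob P (v, x) a z"
      unfolding trans_prob_eq R_def[symmetric] by linarith+
  qed
  have step: "((v, x), z) \<in> steps kernel" if "0 < trans_prob P (v, x) (action v x) z" for z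
    using that pmf_transition[OF valid, of "(v, x)" "action v x" z] by (simp add: set_pmf_iff)
  show "((v, x), (v, inc i x)) \<in> steps kernel" if i: "i \<in> demand P"
  proof (rule step)
    have "l * of_bool ((v, inc i x) = (v, inc i x))
        \<le> (\<Sum>j\<in>demand P. l * of_bool ((v, inc i x) = (v, inc j x)))"
      using rates finite_demand i by (intro member_le_sum) auto
    then have "0 < (\<Sum>j\<in>demand P. l * of_bool ((v, inc i x) = (v, inc j x)))"
      using rates by simp
    then show "0 < trans_prob P (v, x) (action v x) (v, inc i x)" using ge(1) by (rule less_le_trans)
  qed
  show "((v, x), (v, dec v x)) \<in> steps kernel" if "v \<in> demand P" "0 < x v"
  proof (rule step)
    have "action v x = v" using that by (intro K_stop_stay sigma_busy)
    then have "0 < m * of_bool (action v x = v \<and> dp.busy v x) * of_bool ((v, dec v x) = (v, dec v x))"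
      using that rates by (simp add: busy_iff)
    then show "0 < trans_prob P (v, x) (action v x) (v, dec v x)" using ge(2) by (rule less_le_trans)
  qed
  show "((v, x), (action v x, x)) \<in> steps kernel" if ne: "\<sigma> P K (v, x) \<noteq> {}"
  proof (rule step)
    have "0 < tau P * of_bool (adjacent P v (action v x)) * of_bool ((action v x, x) = (action v x, x))"
      using K_stop_move(1)[OF drk nrk ne v] tau_pos by simp
    then show "0 < trans_prob P (v, x) (action v x) (action v x, x)" using ge(3) by (rule less_le_trans)
  qed
qed

lemma step_states:
  assumes "(s, s') \<in> steps kernel" "s \<in> states P"
  shows "s' \<in> states P"
  using assms kernel_closed by blast

lemma reach_states:
  assumes "(s, s') \<in> (steps kernel)\<^sup>*" "s \<in> states P"
  shows "s' \<in> states P"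
  using assms by (induction rule: rtrancl_induct) (use step_states in blast)+

text \<open>
  Run the system without arrivals. A service lowers the number of jobs, and a move raises the
  prospect, which for fixed queue lengths takes finitely many values. So this stops, and as long as the
  queue at \<open>i\<close> is untouched it can only stop with the server at \<open>i\<close>.
\<close>

lemma reach_queue:
  assumes X: "\<And>v x. (v, x) \<in> states P \<Longrightarrow> \<not> (v \<in> demand P \<and> 0 < x v) \<Longrightarrow> X \<le> jobs x \<Longrightarrow>
      \<sigma> P K (v, x) \<noteq> {} \<and> (1 + gain) * prospect v x \<le> prospect (action v x) x"
    and i: "i \<in> demand P" and s: "(v, x) \<in> states P" and big: "X \<le> x i"
  shows "\<exists>x'. ((v, x), (i, x')) \<in> (steps kernel)\<^sup>* \<and> (\<forall>w. x' w \<le> x w)"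
proof -
  \<comment> \<open>decreases with every move as long as the queue lengths stay fixed\<close>
  define better where "better v x = card {u \<in> nodes P. prospect v x < prospect u x}" for v x
  have "\<exists>x'. (s, (i, x')) \<in> (steps kernel)\<^sup>* \<and> (\<forall>w. x' w \<le> snd s w)"
    if "s \<in> states P" "X \<le> snd s i" for s
    using that
  proof (induction s rule: wf_induct[OF wf_measures[of "[\<lambda>s. jobs (snd s), \<lambda>s. better (fst s) (snd s)]"]])
    case (1 s)
    obtain v x where s: "s = (v, x)" by (cases s)
    have st: "(v, x) \<in> states P" and xi: "X \<le> x i" using 1(2,3) s by auto
    note IH = 1(1)[rule_format]
    show ?case
    proof (cases "v = i")
      case True
      then show ?thesis using s by (intro exI[of _ x]) simp
    next
      case vi: False
      show ?thesis
      proof (cases "v \<in> demand P \<and> 0 < x v")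
        case True
        then have step: "((v, x), (v, dec v x)) \<in> steps kernel" using kernel_stepI(2)[OF st] by simp
        have less: "((v, dec v x), s) \<in> measures [\<lambda>s. jobs (snd s), \<lambda>s. better (fst s) (snd s)]"
          using jobs_dec[of v x] True by (simp add: s)
        have "X \<le> snd (v, dec v x) i" using xi vi by simp
        from IH[OF less step_states[OF step st] this]
        obtain x' where x': "((v, dec v x), (i, x')) \<in> (steps kernel)\<^sup>* \<and>
          (\<forall>w. x' w \<le> snd (v, dec v x) w)" ..
        have "x' w \<le> x w" for w
          using x'[THEN conjunct2, rule_format, of w] by (auto split: if_splits)
        then show ?thesis
          using converse_rtrancl_into_rtrancl[OF step x'[THEN conjunct1]]
          unfolding s snd_conv by (intro exI[of _ x'] conjI allI)
      next
        case False
        have "X \<le> jobs x" using xi jobs_ge[OF i, of x] by linarith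
        note gains = X[OF st False this]
        then have step: "((v, x), (action v x, x)) \<in> steps kernel" using kernel_stepI(3)[OF st] by blast
        have st': "(action v x, x) \<in> states P" by (rule step_states[OF step st])
        have "0 < gain * prospect v x" using gain_pos prospect_pos by simp
        then have lt: "prospect v x < prospect (action v x) x"
          using gains by (simp add: distrib_right)
        have "better (action v x) x < better v x"
          unfolding better_def
        proof (rule psubset_card_mono)
          show "finite {u \<in> nodes P. prospect v x < prospect u x}" using finite_nodes by simp
          have "action v x \<in> nodes P" using st' by (simp add: states_def)
          then show "{u \<in> nodes P. prospect (action v x) x < prospect u x}
              \<subset> {u \<in> nodes P. prospect v x < prospect u x}"
            using lt by auto
        qed
        then have less: "((action v x, x), s) \<in> measures [\<lambda>s. jobs (snd s), \<lambda>s. better (fst s) (snd s)]"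
          by (simp add: s)
        have "X \<le> snd (action v x, x) i" using xi by simp
        from IH[OF less st' this]
        obtain x' where x': "((action v x, x), (i, x')) \<in> (steps kernel)\<^sup>* \<and>
          (\<forall>w. x' w \<le> snd (action v x, x) w)" ..
        then have "\<forall>w. x' w \<le> x w" by simp
        then show ?thesis
          using converse_rtrancl_into_rtrancl[OF step x'[THEN conjunct1]]
          unfolding s snd_conv by (intro exI[of _ x'] conjI)
      qed
    qed
  qed
  from this[OF s] big show ?thesis by simp
qed

lemma reach_served:
  assumes i: "i \<in> demand P" and s: "(i, x) \<in> states P"
  shows "((i, x), (i, x(i := 0))) \<in> (steps kernel)\<^sup>*"
  using s
proof (induction "x i" arbitrary: x)
  case 0
  then have "x(i := 0) = x" by auto
  then show ?case by simp
next
  case (Suc n)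
  then have step: "((i, x), (i, dec i x)) \<in> steps kernel" using kernel_stepI(2)[OF Suc.prems i] by simp
  have "n = dec i x i" using Suc.hyps(2) by simp
  then have "((i, dec i x), (i, (dec i x)(i := 0))) \<in> (steps kernel)\<^sup>*"
    using step_states[OF step Suc.prems] by (rule Suc.hyps(1))
  moreover have "(dec i x)(i := 0) = x(i := 0)" by (auto simp: fun_eq_iff)
  ultimately show ?case using converse_rtrancl_into_rtrancl[OF step] by simp
qed

lemma reach_arrivals:
  assumes i: "i \<in> demand P" and s: "(v, x) \<in> states P"
  shows "((v, x), (v, x(i := x i + n))) \<in> (steps kernel)\<^sup>*"
proof (induction n)
  case (Suc n)
  have "(v, x(i := x i + n)) \<in> states P" by (rule reach_states[OF Suc s])
  from kernel_stepI(1)[OF this i]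
  have step: "((v, x(i := x i + n)), (v, inc i (x(i := x i + n)))) \<in> steps kernel" .
  have eq: "inc i (x(i := x i + n)) = x(i := x i + Suc n)" by (auto simp: fun_eq_iff)
  show ?case using rtrancl_into_rtrancl[OF Suc step] unfolding eq .
qed simp

text \<open>
  First add enough arrivals at \<open>i\<close> to attract the server; the other queues do not grow meanwhile.
\<close>

lemma reach_cleared:
  assumes i: "i \<in> demand P" and s: "(v, x) \<in> states P"
  shows "\<exists>x'. ((v, x), (i, x')) \<in> (steps kernel)\<^sup>* \<and> (\<forall>w. x' w \<le> x w) \<and> x' i = 0"
proof -
  obtain X :: nat where X: "\<And>v x. (v, x) \<in> states P \<Longrightarrow> \<not> (v \<in> demand P \<and> 0 < x v) \<Longrightarrow> X \<le> jobs x \<Longrightarrow>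
      \<sigma> P K (v, x) \<noteq> {} \<and> (1 + gain) * prospect v x \<le> prospect (action v x) x"
    using move_gains by blast
  let ?y = "x(i := x i + X)"
  have 1: "((v, x), (v, ?y)) \<in> (steps kernel)\<^sup>*" by (rule reach_arrivals[OF i s])
  have y: "(v, ?y) \<in> states P" by (rule reach_states[OF 1 s])
  have "X \<le> ?y i" by simp
  from reach_queue[OF X i y this]
  obtain x' where x': "((v, ?y), (i, x')) \<in> (steps kernel)\<^sup>* \<and> (\<forall>w. x' w \<le> ?y w)" ..
  note 2 = x'[THEN conjunct1] and le = x'[THEN conjunct2]
  have 3: "((i, x'), (i, x'(i := 0))) \<in> (steps kernel)\<^sup>*"
    by (rule reach_served[OF i reach_states[OF 2 y]])
  have "((v, x), (i, x'(i := 0))) \<in> (steps kernel)\<^sup>*"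
    by (rule rtrancl_trans[OF 1 rtrancl_trans[OF 2 3]])
  moreover have "\<forall>w. (x'(i := 0)) w \<le> x w"
    using le by (auto split: if_splits)
  moreover have "(x'(i := 0)) i = 0" by simp
  ultimately show ?thesis by (intro exI[of _ "x'(i := 0)"] conjI)
qed

text \<open>
  Clear all queues one after the other, and the queue at \<open>i\<close> once more to bring the server there.
\<close>

lemma reach_empty:
  assumes i: "i \<in> demand P" and s: "s \<in> states P"
  shows "(s, (i, \<lambda>_. 0)) \<in> (steps kernel)\<^sup>*"
proof -
  have "\<exists>s'. (s, s') \<in> (steps kernel)\<^sup>* \<and> (\<forall>w\<in>A. snd s' w = 0)" if "A \<subseteq> demand P" for A
    using finite_subset[OF that finite_demand] that
  proof (induction A rule: finite_induct)
    case empty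
    show ?case by blast
  next
    case (insert j A)
    then obtain v x where 1: "(s, (v, x)) \<in> (steps kernel)\<^sup>*" and x: "\<forall>w\<in>A. x w = 0" by auto
    obtain x' where 2: "((v, x), (j, x')) \<in> (steps kernel)\<^sup>*" and x': "\<forall>w. x' w \<le> x w" "x' j = 0"
      using reach_cleared[of j v x] reach_states[OF 1 s] insert.prems by blast
    have "x' w = 0" if "w \<in> A" for w using x x'(1)[rule_format, of w] that by simp
    then show ?case using rtrancl_trans[OF 1 2] x'(2) by (intro exI[of _ "(j, x')"]) auto
  qed
  from this[OF order_refl]
  obtain v x where 1: "(s, (v, x)) \<in> (steps kernel)\<^sup>*" and x: "\<forall>w\<in>demand P. x w = 0" by auto
  have st: "(v, x) \<in> states P" by (rule reach_states[OF 1 s])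
  obtain x' where 2: "((v, x), (i, x')) \<in> (steps kernel)\<^sup>*" and x': "\<forall>w. x' w \<le> x w"
    using reach_cleared[OF i st] by blast
  have "x w = 0" for w using st x by (cases "w \<in> demand P") (auto simp: states_def)
  then have "x' = (\<lambda>_. 0)" using x' by (auto simp: fun_eq_iff)
  then show ?thesis using rtrancl_trans[OF 1 2] by (simp only:)
qed

theorem K_stop_stable: "stable P (K_stop_policy P drk nrk K)"
proof -
  obtain X :: nat where X: "\<And>s. s \<in> states P \<Longrightarrow> X \<le> jobs (snd s) \<Longrightarrow>
      measure_pmf.expectation (kernel s) lyapunov \<le> lyapunov s - drift_rate"
    using lyapunov_drift by blast
  obtain B where B: "\<And>s. s \<in> states P \<Longrightarrow> - B \<le> lyapunov s" using lyapunov_bounded_below by blast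
  obtain i where i: "i \<in> demand P" using demand_ne by blast
  define W where "W s = (lyapunov s + B) / drift_rate" for s
  define F where "F = {s \<in> states P. jobs (snd s) < X}"
  define excess where "excess s = measure_pmf.expectation (kernel s) W + 1 - W s" for s
  define b where "b = Max (insert 0 (excess ` F))"
  have finF: "finite F" unfolding F_def by (rule finite_few_jobs)
  have W0: "0 \<le> W s" if "s \<in> states P" for s
    using B[OF that] drift_rate_pos by (simp add: W_def)
  have EW: "measure_pmf.expectation (kernel s) W
      = (measure_pmf.expectation (kernel s) lyapunov + B) / drift_rate" for s
  proof -
    have "integrable (measure_pmf (kernel s)) lyapunov"
      by (intro integrable_measure_pmf_finite finite_set_transition)
    then show ?thesis unfolding W_def by simp
  qed
  have b: "0 \<le> b" "\<And>s. s \<in> F \<Longrightarrow> excess s \<le> b" unfolding b_def using finF by auto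
  have "ergodic_on (states P) kernel"
  proof (rule foster_ergodic_on[where W = W and b = b and F = F and z = "(i, \<lambda>_. 0)"])
    fix s assume s: "s \<in> states P"
    have nn: "0 \<le> W z" if "z \<in> set_pmf (kernel s)" for z
      using kernel_closed[OF s] W0 that by blast
    have E0: "0 \<le> measure_pmf.expectation (kernel s) W"
      using nn by (intro integral_nonneg_AE AE_pmfI)
    have le: "measure_pmf.expectation (kernel s) W + 1 \<le> W s + b * indicator F s"
    proof (cases "s \<in> F")
      case True
      then show ?thesis using b(2)[OF True] by (simp add: excess_def)
    next
      case False
      then have "measure_pmf.expectation (kernel s) lyapunov \<le> lyapunov s - drift_rate"
        using X[OF s] s by (simp add: F_def)
      then have "measure_pmf.expectation (kernel s) W \<le> (lyapunov s - drift_rate + B) / drift_rate"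
        unfolding EW using drift_rate_pos by (intro divide_right_mono) auto
      also have "\<dots> = W s - 1" using drift_rate_pos by (simp add: W_def field_simps)
      finally show ?thesis using False by simp
    qed
    have "(\<integral>\<^sup>+y. ennreal (W y) \<partial>measure_pmf (kernel s)) + 1
        = ennreal (measure_pmf.expectation (kernel s) W + 1)"
      using nn_integral_transition[OF nn] E0 by simp
    also have "\<dots> \<le> ennreal (W s + b * indicator F s)" by (rule ennreal_leI[OF le])
    also have "\<dots> = ennreal (W s) + ennreal b * indicator F s"
      using W0[OF s] b(1) by (simp add: indicator_def)
    finally show "(\<integral>\<^sup>+y. ennreal (W y) \<partial>measure_pmf (kernel s)) + 1
        \<le> ennreal (W s) + ennreal b * indicator F s" .
  next
    show "(i, \<lambda>_. 0) \<in> states P" using i demand_nodes by (auto simp: states_def)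
    show "F \<subseteq> states P" by (auto simp: F_def)
  qed (use kernel_closed finF b(1) reach_empty[OF i] in blast)+
  then have "ergodic_on (states P)
      (\<lambda>s. bind_pmf (return_pmf (K_stop_action P drk nrk K s)) (transition P s))"
    by (simp add: bind_return_pmf)
  then show ?thesis
    unfolding stable_def K_stop_policy_def by (intro exI[of _ "\<lambda>s. return_pmf (K_stop_action P drk nrk K s)"]) simp
qed

end

theorem theorem3p5:
  fixes P :: "'v network" and drk nrk :: "'v \<Rightarrow> nat" and K :: nat
  assumes "valid_network P"
    and "homogeneous P"
    and "inj_on drk (demand P)"
    and "inj_on nrk (nodes P)"
    and "K \<ge> 1"
  shows "(traffic P < 1 \<longrightarrow> stable P (K_stop_policy P drk nrk K)) \<and>
    (complete_network P \<longrightarrow> optimal P (K_stop_policy P drk nrk K))"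
proof -
  obtain i where i: "i \<in> demand P"
    using network.demand_ne[OF network.intro[OF assms(1)]] by blast
  have polling: "polling P (lam P i) (mu P i) (hold P i)"
  proof (rule polling.intro)
    show "valid_network P" by (rule assms(1))
    show "lam P j = lam P i \<and> mu P j = mu P i \<and> hold P j = hold P i" if "j \<in> demand P" for j
      using assms(2) i that unfolding homogeneous_def by blast
  qed
  have "stable P (K_stop_policy P drk nrk K)" if "traffic P < 1"
  proof -
    have "stable_polling P (lam P i) (mu P i) (hold P i) K drk nrk"
      using polling assms that by (simp add: stable_polling_def stable_polling_axioms_def)
    then show ?thesis by (rule stable_polling.K_stop_stable)
  qed
  moreover have "optimal P (K_stop_policy P drk nrk K)" if "complete_network P"
    using polling.K_stop_optimal[OF polling that assms(5,3,4)] .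
  ultimately show ?thesis by blast
qed

end
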